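(* Let $k$ be a field and let $\mathscr{C}$ be a finite skeletal EI category with $\mathrm{Obj}\,\mathscr{C}=\{x_1,x_2,\dots,x_n\}$, $n\ge 2$, satisfying $\mathrm{Hom}_{\mathscr{C}}(x_i,x_j)=\emptyset$ if $i<j$. Assume that $\mathscr{C}$ is projective over $k$. Then $\mathscr{C}$ is free if and only if each $M_t^*$ is a projective left $\Gamma_t$-module for $1\le t\le n-1$.
   Context: A finite EI category is a category with finitely many morphisms in which every endomorphism is an isomorphism; $\mathrm{Aut}_{\mathscr{C}}(x)=\mathrm{Hom}_{\mathscr{C}}(x,x)$. Skeletal means distinct objects are not isomorphic. Put $M_{ij}=k\mathrm{Hom}_{\mathscr{C}}(x_j,x_i)$ (the $k$-vector space with basis $\mathrm{Hom}_{\mathscr{C}}(x_j,x_i)$) and $R_i=M_{ii}=k\mathrm{Aut}_{\mathscr{C}}(x_i)$, a group algebra. $M_{ij}$ is an $R_i$-$R_j$-bimodule, and composition in $\mathscr{C}$ induces bimodule maps $M_{il}\otimes_{R_l}M_{lj}\to M_{ij}$. $\mathscr{C}$ is projective over $k$ if each $M_{ij}$ ($1\le i<j\le n$) is projective as a left $R_i$-module and as a right $R_j$-module. The category algebra $k\mathscr{C}$ is isomorphic to the algebra $\Gamma_{\mathscr{C}}$ of upper triangular $n\times n$ matrices with $(i,i)$ entries in $R_i$ and $(i,j)$ entries in $M_{ij}$ for $i<j$, multiplied via composition. $\Gamma_t$ is the algebra given by the $t\times t$ leading principal submatrix of $\Gamma_{\mathscr{C}}$ (entries $R_i$, $M_{ij}$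 with indices $\le t$), and $M_t^*$ is the left $\Gamma_t$-module of column vectors with entries in $M_{1,t+1},\dots,M_{t,t+1}$, with action by matrix multiplication via composition. A morphism $\alpha:x\to y$ is unfactorizable if it is not an isomorphism and whenever $\alpha=\gamma\circ\beta$ then either $\beta$ or $\gamma$ is an isomorphism. $\mathscr{C}$ is free if it satisfies the Unique Factorization Property: whenever a non-isomorphism $\alpha:x\to y$ has two decompositions into unfactorizable morphisms $x=u_0\xrightarrow{\alpha_1}u_1\to\cdots\xrightarrow{\alpha_p}u_p=y$ and $x=v_0\xrightarrow{\beta_1}v_1\to\cdots\xrightarrow{\beta_q}v_q=y$, then $p=q$, $u_i=v_i$ for all $i$, and there are $h_i\in\mathrm{Aut}_{\mathscr{C}}(u_i)$, $1\le i\le q-1$, with $\beta_1=h_1\circ\alpha_1$, $\beta_i=h_i\circ\alpha_i\circ h_{i-1}^{-1}$ for $2\le i\le q-1$, and $\beta_q=\alpha_q\circ h_{q-1}^{-1}$ (for $q=1$ this just says $\beta_1=\alpha_1$). *)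

theory Defs
  imports "HOL-Algebra.Module"
begin

section \<open>Modules over not necessarily commutative rings\<close>

text \<open>The locale \<open>module\<close> of HOL-Algebra requires a commutative ring of scalars.
  Its record type is reused; the fields \<open>mult\<close> and \<open>one\<close> of a module are irrelevant.\<close>

locale left_module = R?: ring R + M?: abelian_group M for R (structure) and M (structure) +
  assumes smult_closed:
      "\<lbrakk>a \<in> carrier R; m \<in> carrier M\<rbrakk> \<Longrightarrow> a \<odot>\<^bsub>M\<^esub> m \<in> carrier M"
    and smult_l_distr:
      "\<lbrakk>a \<in> carrier R; b \<in> carrier R; m \<in> carrier M\<rbrakk> \<Longrightarrow>
        (a \<oplus> b) \<odot>\<^bsub>M\<^esub> m = a \<odot>\<^bsub>M\<^esub> m \<oplus>\<^bsub>M\<^esub> b \<odot>\<^bsub>M\<^esub> m"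
    and smult_r_distr:
      "\<lbrakk>a \<in> carrier R; m \<in> carrier M; m' \<in> carrier M\<rbrakk> \<Longrightarrow>
        a \<odot>\<^bsub>M\<^esub> (m \<oplus>\<^bsub>M\<^esub> m') = a \<odot>\<^bsub>M\<^esub> m \<oplus>\<^bsub>M\<^esub> a \<odot>\<^bsub>M\<^esub> m'"
    and smult_assoc:
      "\<lbrakk>a \<in> carrier R; b \<in> carrier R; m \<in> carrier M\<rbrakk> \<Longrightarrow>
        (a \<otimes> b) \<odot>\<^bsub>M\<^esub> m = a \<odot>\<^bsub>M\<^esub> (b \<odot>\<^bsub>M\<^esub> m)"
    and smult_one:
      "m \<in> carrier M \<Longrightarrow> \<one> \<odot>\<^bsub>M\<^esub> m = m"

definition left_module_iso ::
  "('r, 'x) ring_scheme \<Rightarrow> ('r, 'a, 'y) module_scheme \<Rightarrow> ('r, 'b, 'z) module_scheme \<Rightarrow> ('a \<Rightarrow> 'b) set"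
where
  "left_module_iso R M N =
    {\<phi>. bij_betw \<phi> (carrier M) (carrier N) \<and>
        (\<forall>m\<in>carrier M. \<forall>m'\<in>carrier M. \<phi> (m \<oplus>\<^bsub>M\<^esub> m') = \<phi> m \<oplus>\<^bsub>N\<^esub> \<phi> m') \<and>
        (\<forall>r\<in>carrier R. \<forall>m\<in>carrier M. \<phi> (r \<odot>\<^bsub>M\<^esub> m) = r \<odot>\<^bsub>N\<^esub> \<phi> m)}"

definition direct_sum ::
  "('r, 'a, 'y) module_scheme \<Rightarrow> ('r, 'b, 'z) module_scheme \<Rightarrow> ('r, 'a \<times> 'b) module"
where
  "direct_sum M N =
    \<lparr>carrier = carrier M \<times> carrier N,
     mult = undefined, one = undefined,
     zero = (\<zero>\<^bsub>M\<^esub>, \<zero>\<^bsub>N\<^esub>),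
     add = (\<lambda>u v. (fst u \<oplus>\<^bsub>M\<^esub> fst v, snd u \<oplus>\<^bsub>N\<^esub> snd v)),
     smult = (\<lambda>r u. (r \<odot>\<^bsub>M\<^esub> fst u, r \<odot>\<^bsub>N\<^esub> snd u))\<rparr>"

text \<open>The free left module on a set \<open>B\<close>: finitely supported functions from \<open>B\<close> to \<open>R\<close>,
  extended by zero outside \<open>B\<close>.\<close>

definition free_left_module :: "('r, 'x) ring_scheme \<Rightarrow> 'b set \<Rightarrow> ('r, 'b \<Rightarrow> 'r) module" where
  "free_left_module R B =
    \<lparr>carrier = {f. range f \<subseteq> carrier R \<and> (\<forall>b. b \<notin> B \<longrightarrow> f b = \<zero>\<^bsub>R\<^esub>) \<and> finite {b. f b \<noteq> \<zero>\<^bsub>R\<^esub>}},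
     mult = undefined, one = undefined,
     zero = (\<lambda>b. \<zero>\<^bsub>R\<^esub>),
     add = (\<lambda>f g b. f b \<oplus>\<^bsub>R\<^esub> g b),
     smult = (\<lambda>r f b. r \<otimes>\<^bsub>R\<^esub> f b)\<rparr>"

text \<open>A module is projective iff it is a direct summand of a free module.  Restricting the
  types of the basis \<open>B\<close> and of the complement \<open>Q\<close> loses no generality: a projective \<open>P\<close>
  is a direct summand of the free module on the set \<open>carrier P\<close>, with complement
  isomorphic to a submodule of that free module.\<close>

definition projective_left_module ::
  "('r, 'x) ring_scheme \<Rightarrow> ('r, 'p, 'y) module_scheme \<Rightarrow> bool"
where
  "projective_left_module R P \<longleftrightarrow>
    left_module R P \<and>
    (\<exists>(B :: 'p set) (Q :: ('r, 'p \<Rightarrow> 'r) module).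
       left_module R Q \<and> left_module_iso R (direct_sum P Q) (free_left_module R B) \<noteq> {})"

text \<open>A right \<open>R\<close>-module is a left module over the opposite ring of \<open>R\<close>,
  so that \<open>r \<odot> m\<close> stands for \<open>m r\<close>.\<close>

definition opposite_ring :: "('r, 'x) ring_scheme \<Rightarrow> ('r, 'x) ring_scheme" where
  "opposite_ring R = R\<lparr>mult := (\<lambda>a b. b \<otimes>\<^bsub>R\<^esub> a)\<rparr>"

definition projective_right_module ::
  "('r, 'x) ring_scheme \<Rightarrow> ('r, 'p, 'y) module_scheme \<Rightarrow> bool"
where
  "projective_right_module R P \<longleftrightarrow> projective_left_module (opposite_ring R) P"


section \<open>Finite EI categories\<close>

record ('o, 'm) category =
  Obj :: "'o set"
  Mor :: "'m set"
  Dom :: "'m \<Rightarrow> 'o"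
  Cod :: "'m \<Rightarrow> 'o"
  Id :: "'o \<Rightarrow> 'm"
  Comp :: "'m \<Rightarrow> 'm \<Rightarrow> 'm"  (infixr \<open>\<cdot>\<index>\<close> 75)

text \<open>\<open>g \<cdot> f\<close> is ``first \<open>f\<close>, then \<open>g\<close>''; it is meaningful only if \<open>Cod f = Dom g\<close>.\<close>

definition Hom :: "('o, 'm, 'z) category_scheme \<Rightarrow> 'o \<Rightarrow> 'o \<Rightarrow> 'm set" where
  "Hom C a b = {f \<in> Mor C. Dom C f = a \<and> Cod C f = b}"

locale category =
  fixes C (structure)
  assumes Dom_closed: "f \<in> Mor C \<Longrightarrow> Dom C f \<in> Obj C"
    and Cod_closed: "f \<in> Mor C \<Longrightarrow> Cod C f \<in> Obj C"
    and Id_closed: "a \<in> Obj C \<Longrightarrow> Id C a \<in> Hom C a a"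
    and Comp_closed: "\<lbrakk>f \<in> Hom C a b; g \<in> Hom C b c\<rbrakk> \<Longrightarrow> g \<cdot> f \<in> Hom C a c"
    and Comp_assoc: "\<lbrakk>f \<in> Hom C a b; g \<in> Hom C b c; h \<in> Hom C c d\<rbrakk> \<Longrightarrow> (h \<cdot> g) \<cdot> f = h \<cdot> (g \<cdot> f)"
    and Comp_Id_left: "f \<in> Hom C a b \<Longrightarrow> Id C b \<cdot> f = f"
    and Comp_Id_right: "f \<in> Hom C a b \<Longrightarrow> f \<cdot> Id C a = f"

definition Aut :: "('o, 'm, 'z) category_scheme \<Rightarrow> 'o \<Rightarrow> 'm set" where
  "Aut C a = Hom C a a"

definition is_inverse :: "('o, 'm, 'z) category_scheme \<Rightarrow> 'm \<Rightarrow> 'm \<Rightarrow> bool" where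
  "is_inverse C f g \<longleftrightarrow>
    g \<in> Hom C (Cod C f) (Dom C f) \<and> g \<cdot>\<^bsub>C\<^esub> f = Id C (Dom C f) \<and> f \<cdot>\<^bsub>C\<^esub> g = Id C (Cod C f)"

definition is_iso :: "('o, 'm, 'z) category_scheme \<Rightarrow> 'm \<Rightarrow> bool" where
  "is_iso C f \<longleftrightarrow> f \<in> Mor C \<and> (\<exists>g. is_inverse C f g)"

definition inverse_mor :: "('o, 'm, 'z) category_scheme \<Rightarrow> 'm \<Rightarrow> 'm" where
  "inverse_mor C f = (THE g. is_inverse C f g)"

definition finite_EI_category :: "('o, 'm, 'z) category_scheme \<Rightarrow> bool" where
  "finite_EI_category C \<longleftrightarrow>
    category C \<and> finite (Mor C) \<and> (\<forall>a\<in>Obj C. \<forall>f\<in>Hom C a a. is_iso C f)"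

definition skeletal :: "('o, 'm, 'z) category_scheme \<Rightarrow> bool" where
  "skeletal C \<longleftrightarrow> (\<forall>a\<in>Obj C. \<forall>b\<in>Obj C. (\<exists>f\<in>Hom C a b. is_iso C f) \<longrightarrow> a = b)"

definition unfactorizable :: "('o, 'm, 'z) category_scheme \<Rightarrow> 'm \<Rightarrow> bool" where
  "unfactorizable C \<alpha> \<longleftrightarrow>
    \<alpha> \<in> Mor C \<and> \<not> is_iso C \<alpha> \<and>
    (\<forall>\<beta>\<in>Mor C. \<forall>\<gamma>\<in>Mor C. Cod C \<beta> = Dom C \<gamma> \<and> \<alpha> = \<gamma> \<cdot>\<^bsub>C\<^esub> \<beta> \<longrightarrow> is_iso C \<beta> \<or> is_iso C \<gamma>)"

text \<open>\<open>path_comp C u \<alpha> p\<close> is \<open>\<alpha> p \<cdot> \<dots> \<cdot> \<alpha> 1\<close>, where \<open>\<alpha> 1\<close> starts at \<open>u 0\<close>.\<close>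

primrec path_comp :: "('o, 'm, 'z) category_scheme \<Rightarrow> (nat \<Rightarrow> 'o) \<Rightarrow> (nat \<Rightarrow> 'm) \<Rightarrow> nat \<Rightarrow> 'm" where
  "path_comp C u \<alpha> 0 = Id C (u 0)"
| "path_comp C u \<alpha> (Suc p) = \<alpha> (Suc p) \<cdot>\<^bsub>C\<^esub> path_comp C u \<alpha> p"

definition unfactorizable_decomposition ::
  "('o, 'm, 'z) category_scheme \<Rightarrow> 'm \<Rightarrow> nat \<Rightarrow> (nat \<Rightarrow> 'o) \<Rightarrow> (nat \<Rightarrow> 'm) \<Rightarrow> bool"
where
  "unfactorizable_decomposition C a p u \<alpha> \<longleftrightarrow>
    1 \<le> p \<and> u 0 = Dom C a \<and> u p = Cod C a \<and>
    (\<forall>i\<in>{1..p}. \<alpha> i \<in> Hom C (u (i - 1)) (u i) \<and> unfactorizable C (\<alpha> i)) \<and>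
    path_comp C u \<alpha> p = a"

text \<open>A category is free if it has the Unique Factorization Property.\<close>

definition free_category :: "('o, 'm, 'z) category_scheme \<Rightarrow> bool" where
  "free_category C \<longleftrightarrow>
    (\<forall>a\<in>Mor C. \<forall>p q u v \<alpha> \<beta>.
      \<not> is_iso C a \<and> unfactorizable_decomposition C a p u \<alpha> \<and> unfactorizable_decomposition C a q v \<beta> \<longrightarrow>
      p = q \<and> (\<forall>i\<in>{0..p}. u i = v i) \<and>
      (\<exists>h. (\<forall>i\<in>{1..q - 1}. h i \<in> Aut C (u i)) \<and>
           (if q = 1 then \<beta> 1 = \<alpha> 1
            else \<beta> 1 = h 1 \<cdot>\<^bsub>C\<^esub> \<alpha> 1 \<and>
                 (\<forall>i\<in>{2..q - 1}. \<beta> i = h i \<cdot>\<^bsub>C\<^esub> \<alpha> i \<cdot>\<^bsub>C\<^esub> inverse_mor C (h (i - 1))) \<and>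
                 \<beta> q = \<alpha> q \<cdot>\<^bsub>C\<^esub> inverse_mor C (h (q - 1)))))"


section \<open>The algebras and bimodules attached to a finite category\<close>

text \<open>All categories from here on have finitely many morphisms, so the vector space with basis
  \<open>Hom C a b\<close> consists of all functions to the field that vanish outside \<open>Hom C a b\<close>.\<close>

definition kHom :: "('o, 'm, 'z) category_scheme \<Rightarrow> 'o \<Rightarrow> 'o \<Rightarrow> ('m \<Rightarrow> 'k::field) set" where
  "kHom C a b = {f. \<forall>m. m \<notin> Hom C a b \<longrightarrow> f m = 0}"

text \<open>The bilinear extension of composition.\<close>

definition conv :: "('o, 'm, 'z) category_scheme \<Rightarrow> ('m \<Rightarrow> 'k::field) \<Rightarrow> ('m \<Rightarrow> 'k) \<Rightarrow> 'm \<Rightarrow> 'k" where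
  "conv C f g = (\<lambda>m. \<Sum>(\<gamma>, \<beta>) \<in> {(\<gamma>, \<beta>). \<gamma> \<in> Mor C \<and> \<beta> \<in> Mor C \<and> Cod C \<beta> = Dom C \<gamma> \<and> \<gamma> \<cdot>\<^bsub>C\<^esub> \<beta> = m}.
                      f \<gamma> * g \<beta>)"

definition basis_mor :: "'m \<Rightarrow> 'm \<Rightarrow> 'k::field" where
  "basis_mor m = (\<lambda>m'. if m' = m then 1 else 0)"

definition group_algebra :: "('o, 'm, 'z) category_scheme \<Rightarrow> 'o \<Rightarrow> ('m \<Rightarrow> 'k::field) ring" where
  "group_algebra C a =
    \<lparr>carrier = kHom C a a,
     mult = conv C, one = basis_mor (Id C a),
     zero = (\<lambda>_. 0),
     add = (\<lambda>f g m. f m + g m)\<rparr>"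

text \<open>The bimodule \<open>k Hom(a, b)\<close>, as a left module over \<open>k Aut(b)\<close> and as a right module
  over \<open>k Aut(a)\<close>.\<close>

definition kHom_left :: "('o, 'm, 'z) category_scheme \<Rightarrow> 'o \<Rightarrow> 'o \<Rightarrow> ('m \<Rightarrow> 'k::field, 'm \<Rightarrow> 'k) module" where
  "kHom_left C a b =
    \<lparr>carrier = kHom C a b,
     mult = undefined, one = undefined,
     zero = (\<lambda>_. 0),
     add = (\<lambda>f g m. f m + g m),
     smult = (\<lambda>r f. conv C r f)\<rparr>"

definition kHom_right :: "('o, 'm, 'z) category_scheme \<Rightarrow> 'o \<Rightarrow> 'o \<Rightarrow> ('m \<Rightarrow> 'k::field, 'm \<Rightarrow> 'k) module" where
  "kHom_right C a b =
    \<lparr>carrier = kHom C a b,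
     mult = undefined, one = undefined,
     zero = (\<lambda>_. 0),
     add = (\<lambda>f g m. f m + g m),
     smult = (\<lambda>r f. conv C f r)\<rparr>"

text \<open>In the following, \<open>x 1, \<dots>, x n\<close> enumerates the objects, and
  \<open>M i j = kHom C (x j) (x i)\<close>.\<close>

definition projective_over ::
  "'k::field itself \<Rightarrow> ('o, 'm, 'z) category_scheme \<Rightarrow> (nat \<Rightarrow> 'o) \<Rightarrow> nat \<Rightarrow> bool"
where
  "projective_over _ C x n \<longleftrightarrow>
    (\<forall>i j. 1 \<le> i \<and> i < j \<and> j \<le> n \<longrightarrow>
      projective_left_module (group_algebra C (x i))
        (kHom_left C (x j) (x i) :: ('m \<Rightarrow> 'k, 'm \<Rightarrow> 'k) module) \<and>
      projective_right_module (group_algebra C (x j))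
        (kHom_right C (x j) (x i) :: ('m \<Rightarrow> 'k, 'm \<Rightarrow> 'k) module))"

text \<open>The upper triangular matrix algebra on the indices \<open>1, \<dots>, t\<close>; for \<open>t = n\<close> it is
  isomorphic to the category algebra. Entries at all other positions are set to zero.\<close>

definition Gamma ::
  "('o, 'm, 'z) category_scheme \<Rightarrow> (nat \<Rightarrow> 'o) \<Rightarrow> nat \<Rightarrow> (nat \<Rightarrow> nat \<Rightarrow> 'm \<Rightarrow> 'k::field) ring"
where
  "Gamma C x t =
    \<lparr>carrier = {A. \<forall>i j. if 1 \<le> i \<and> i \<le> j \<and> j \<le> t then A i j \<in> kHom C (x j) (x i)
                         else A i j = (\<lambda>_. 0)},
     mult = (\<lambda>A B i j m. \<Sum>l\<in>{1..t}. conv C (A i l) (B l j) m),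
     one = (\<lambda>i j. if i = j \<and> i \<in> {1..t} then basis_mor (Id C (x i)) else (\<lambda>_. 0)),
     zero = (\<lambda>_ _ _. 0),
     add = (\<lambda>A B i j m. A i j m + B i j m)\<rparr>"

text \<open>The left module of column vectors with entries in
  \<open>M 1 (t + 1), \<dots>, M t (t + 1)\<close>.\<close>

definition Mstar ::
  "('o, 'm, 'z) category_scheme \<Rightarrow> (nat \<Rightarrow> 'o) \<Rightarrow> nat \<Rightarrow>
    (nat \<Rightarrow> nat \<Rightarrow> 'm \<Rightarrow> 'k::field, nat \<Rightarrow> 'm \<Rightarrow> 'k) module"
where
  "Mstar C x t =
    \<lparr>carrier = {v. \<forall>i. if i \<in> {1..t} then v i \<in> kHom C (x (t + 1)) (x i) else v i = (\<lambda>_. 0)},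
     mult = undefined, one = undefined,
     zero = (\<lambda>_ _. 0),
     add = (\<lambda>v w i m. v i m + w i m),
     smult = (\<lambda>A v i m. \<Sum>l\<in>{1..t}. conv C (A i l) (v l) m)\<rparr>"

end

theory Submission
  imports Defs
begin

text \<open>
  Write \<open>z = x (t + 1)\<close>.  A left \<open>Gamma C x t\<close>-module is a covariant functor on the full subcategory
  on \<open>x 1, \<dots>, x t\<close>, and \<open>Mstar C x t\<close> is the functor \<open>y \<mapsto> k Hom(z, y)\<close>.  Every morphism from \<open>z\<close> to
  another object is a composite \<open>g \<cdot> b\<close> with \<open>b\<close> unfactorizable, so composition gives a surjection onto
  \<open>Mstar C x t\<close> from the direct sum, over the objects \<open>y\<close>, of the functors
  \<open>k Hom(y, -) \<otimes> k Unf(z, y)\<close>, where \<open>Unf(z, y)\<close> is the set of unfactorizable morphisms and the tensor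
  product is over \<open>k Aut(y)\<close>.  The category is free iff these surjections are bijective for all \<open>z\<close>:
  splitting off the first unfactorizable factor must be possible in only one way, up to moving an
  automorphism from one factor to the other (\<open>free_category_iff_two_step_unique\<close>).

  Projectivity of \<open>Mstar C x t\<close> is used in the form of a dual basis: matrix coefficients \<open>\<psi> u d\<close> that
  write each morphism \<open>d\<close> out of \<open>z\<close> as the sum of the \<open>\<psi> u d \<cdot> u\<close> over a set \<open>U\<close> of generating morphisms
  \<open>u\<close>, in a way compatible with composing \<open>d\<close> on the left.  Such equivariant coordinates exist iff the
  module is projective (\<open>equivariant_coordinates_projective\<close>, \<open>projective_equivariant_coordinates\<close>).

  If the category is free, take coordinates \<open>D u b\<close> of the projective \<open>k Aut(y)\<close>-module \<open>k Hom(z, y)\<close>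
  and put \<open>\<psi> u (g \<cdot> b) = g \<cdot> D u b\<close> for \<open>b\<close> unfactorizable.  Uniqueness of \<open>(g, b)\<close> up to an automorphism,
  together with the equivariance of \<open>D\<close>, makes this well defined and equivariant
  (\<open>two_step_unique_coordinates\<close>).

  Conversely, let \<open>\<psi>\<close> be equivariant coordinates with respect to the unfactorizable morphisms, and let
  \<open>g \<cdot> b = g' \<cdot> b'\<close> with \<open>g\<close> and \<open>g'\<close> not invertible
  (if one of them is, so is the other, and the claim is clear).  Factorizations of morphisms from \<open>z\<close> to the source of
  \<open>g\<close> may be assumed to be unique, by induction on the index of the object,
  which is larger for the source of \<open>g\<close> than for its target.  Hence the
  coordinates of \<open>b\<close> can only be the trivial ones, modulo equivalence of factorizations, and by
  equivariance those of \<open>g \<cdot> b\<close> are concentrated in the class of \<open>(g, b)\<close>.  For the same reason they are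
  concentrated in the class of \<open>(g', b')\<close>, so the two classes coincide
  (\<open>coordinates_two_step_unique\<close>).
\<close>

section \<open>Projective modules as retracts of free modules\<close>

definition module_hom ::
  "('r, 'x) ring_scheme \<Rightarrow> ('r, 'a, 'y) module_scheme \<Rightarrow> ('r, 'b, 'z) module_scheme \<Rightarrow> ('a \<Rightarrow> 'b) set"
where
  "module_hom R M N =
    {h. h \<in> carrier M \<rightarrow> carrier N \<and>
        (\<forall>m\<in>carrier M. \<forall>m'\<in>carrier M. h (m \<oplus>\<^bsub>M\<^esub> m') = h m \<oplus>\<^bsub>N\<^esub> h m') \<and>
        (\<forall>r\<in>carrier R. \<forall>m\<in>carrier M. h (r \<odot>\<^bsub>M\<^esub> m) = r \<odot>\<^bsub>N\<^esub> h m)}"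

lemma module_homI:
  assumes "\<And>m. m \<in> carrier M \<Longrightarrow> h m \<in> carrier N"
    and "\<And>m m'. m \<in> carrier M \<Longrightarrow> m' \<in> carrier M \<Longrightarrow> h (m \<oplus>\<^bsub>M\<^esub> m') = h m \<oplus>\<^bsub>N\<^esub> h m'"
    and "\<And>r m. r \<in> carrier R \<Longrightarrow> m \<in> carrier M \<Longrightarrow> h (r \<odot>\<^bsub>M\<^esub> m) = r \<odot>\<^bsub>N\<^esub> h m"
  shows "h \<in> module_hom R M N"
  using assms by (auto simp: module_hom_def)

lemma module_hom_closed: "h \<in> module_hom R M N \<Longrightarrow> m \<in> carrier M \<Longrightarrow> h m \<in> carrier N"
  and module_hom_add: "h \<in> module_hom R M N \<Longrightarrow> m \<in> carrier M \<Longrightarrow> m' \<in> carrier M \<Longrightarrow>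
        h (m \<oplus>\<^bsub>M\<^esub> m') = h m \<oplus>\<^bsub>N\<^esub> h m'"
  and module_hom_smult: "h \<in> module_hom R M N \<Longrightarrow> r \<in> carrier R \<Longrightarrow> m \<in> carrier M \<Longrightarrow>
        h (r \<odot>\<^bsub>M\<^esub> m) = r \<odot>\<^bsub>N\<^esub> h m"
  by (auto simp: module_hom_def)

lemma module_hom_compose:
  assumes "h \<in> module_hom R M N" "g \<in> module_hom R N L"
  shows "g \<circ> h \<in> module_hom R M L"
  using assms by (auto simp: module_hom_def Pi_def)

context left_module
begin

lemma smult_zero_left: "m \<in> carrier M \<Longrightarrow> \<zero> \<odot>\<^bsub>M\<^esub> m = \<zero>\<^bsub>M\<^esub>"
proof -
  assume m: "m \<in> carrier M"
  have "\<zero> \<odot>\<^bsub>M\<^esub> m \<oplus>\<^bsub>M\<^esub> \<zero> \<odot>\<^bsub>M\<^esub> m = \<zero> \<odot>\<^bsub>M\<^esub> m"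
    using smult_l_distr[of \<zero> \<zero> m] m by simp
  then show ?thesis
    using m by (metis M.add.l_cancel_one R.zero_closed smult_closed)
qed

lemma smult_zero_right: "r \<in> carrier R \<Longrightarrow> r \<odot>\<^bsub>M\<^esub> \<zero>\<^bsub>M\<^esub> = \<zero>\<^bsub>M\<^esub>"
proof -
  assume r: "r \<in> carrier R"
  have "r \<odot>\<^bsub>M\<^esub> \<zero>\<^bsub>M\<^esub> \<oplus>\<^bsub>M\<^esub> r \<odot>\<^bsub>M\<^esub> \<zero>\<^bsub>M\<^esub> = r \<odot>\<^bsub>M\<^esub> \<zero>\<^bsub>M\<^esub>"
    using smult_r_distr[of r "\<zero>\<^bsub>M\<^esub>" "\<zero>\<^bsub>M\<^esub>"] r by simp
  then show ?thesis
    using r by (metis M.add.l_cancel_one M.zero_closed smult_closed)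
qed

lemma smult_finsum:
  assumes "r \<in> carrier R" "f \<in> A \<rightarrow> carrier M"
  shows "r \<odot>\<^bsub>M\<^esub> (\<Oplus>\<^bsub>M\<^esub>i\<in>A. f i) = (\<Oplus>\<^bsub>M\<^esub>i\<in>A. r \<odot>\<^bsub>M\<^esub> f i)"
  using assms(2)
proof (induction A rule: infinite_finite_induct)
  case (insert a A)
  then have "f \<in> A \<rightarrow> carrier M" "f a \<in> carrier M" by auto
  moreover have "(\<lambda>i. r \<odot>\<^bsub>M\<^esub> f i) \<in> A \<rightarrow> carrier M"
    using calculation assms(1) smult_closed by auto
  ultimately show ?case
    using insert assms(1) by (simp add: smult_r_distr smult_closed)
qed (simp_all add: smult_zero_right assms(1) M.add.finprod_infinite)

lemma hom_zero:
  assumes "left_module R N" "h \<in> module_hom R M N"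
  shows "h \<zero>\<^bsub>M\<^esub> = \<zero>\<^bsub>N\<^esub>"
proof -
  interpret N: left_module R N by (fact assms(1))
  have "h (\<zero> \<odot>\<^bsub>M\<^esub> \<zero>\<^bsub>M\<^esub>) = \<zero> \<odot>\<^bsub>N\<^esub> h \<zero>\<^bsub>M\<^esub>"
    by (rule module_hom_smult[OF assms(2)]) auto
  then show ?thesis
    using module_hom_closed[OF assms(2)] by (simp add: smult_zero_left N.smult_zero_left)
qed

end

lemma (in ring) free_left_module_is_left_module: "left_module R (free_left_module R B)"
proof -
  have "abelian_group (free_left_module R B)"
  proof (rule abelian_groupI, goal_cases)
    case (1 f g)
    have "{b. f b \<oplus> g b \<noteq> \<zero>} \<subseteq> {b. f b \<noteq> \<zero>} \<union> {b. g b \<noteq> \<zero>}" by auto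
    then have "finite {b. f b \<oplus> g b \<noteq> \<zero>}"
      using 1 by (auto simp: free_left_module_def intro: finite_subset)
    then show ?case using 1 by (auto simp: free_left_module_def)
  next
    case (6 f)
    have "(\<lambda>b. \<ominus> f b) \<in> carrier (free_left_module R B)"
    proof -
      have "{b. \<ominus> f b \<noteq> \<zero>} \<subseteq> {b. f b \<noteq> \<zero>}" by auto
      then show ?thesis
        using 6 by (auto simp: free_left_module_def intro: finite_subset)
    qed
    moreover have "(\<lambda>b. \<ominus> f b) \<oplus>\<^bsub>free_left_module R B\<^esub> f = \<zero>\<^bsub>free_left_module R B\<^esub>"
      using 6 by (auto simp: free_left_module_def fun_eq_iff l_neg image_subset_iff)
    ultimately show ?case by blast
  qed (auto simp: free_left_module_def fun_eq_iff a_ac image_subset_iff)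
  moreover have "finite {b. r \<otimes> f b \<noteq> \<zero>}" if "finite {b. f b \<noteq> \<zero>}" "r \<in> carrier R" for r f
    by (rule finite_subset[OF _ that(1)]) (use that in auto)
  ultimately show ?thesis
    unfolding left_module_def left_module_axioms_def
    using ring_axioms
    by (auto simp: free_left_module_def fun_eq_iff l_distr r_distr m_assoc image_subset_iff)
qed

text \<open>The homomorphism out of a free module that takes prescribed values on the basis.  The sum runs over
  the support of \<open>w\<close>, which keeps it finite for an infinite basis.\<close>

definition free_lift :: "('r, 'x) ring_scheme \<Rightarrow> ('r, 'a, 'y) module_scheme \<Rightarrow> ('b \<Rightarrow> 'a) \<Rightarrow> ('b \<Rightarrow> 'r) \<Rightarrow> 'a"
  where "free_lift R M g w = (\<Oplus>\<^bsub>M\<^esub>b\<in>{b. w b \<noteq> \<zero>\<^bsub>R\<^esub>}. w b \<odot>\<^bsub>M\<^esub> g b)"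

definition free_basis :: "('r, 'x) ring_scheme \<Rightarrow> 'b \<Rightarrow> 'b \<Rightarrow> 'r"
  where "free_basis R b = (\<lambda>b'. if b' = b then \<one>\<^bsub>R\<^esub> else \<zero>\<^bsub>R\<^esub>)"

lemma (in ring) free_basis_closed: "b \<in> B \<Longrightarrow> free_basis R b \<in> carrier (free_left_module R B)"
proof -
  assume b: "b \<in> B"
  have "{b'. free_basis R b b' \<noteq> \<zero>} \<subseteq> {b}" by (auto simp: free_basis_def split: if_splits)
  then show ?thesis
    using b by (auto simp: free_left_module_def free_basis_def intro: finite_subset)
qed

context left_module
begin

lemma free_lift_eq_finsum:
  assumes "w \<in> carrier (free_left_module R B)" "finite A" "{b. w b \<noteq> \<zero>} \<subseteq> A" "A \<subseteq> B"
    "g \<in> B \<rightarrow> carrier M"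
  shows "free_lift R M g w = (\<Oplus>\<^bsub>M\<^esub>b\<in>A. w b \<odot>\<^bsub>M\<^esub> g b)"
  unfolding free_lift_def
proof (rule M.add.finprod_mono_neutral_cong_left[OF assms(2,3)])
  show "(\<lambda>b. w b \<odot>\<^bsub>M\<^esub> g b) \<in> A \<rightarrow> carrier M"
    using assms by (auto simp: free_left_module_def image_subset_iff Pi_def subset_iff intro!: smult_closed)
  show "w b \<odot>\<^bsub>M\<^esub> g b = \<zero>\<^bsub>M\<^esub>" if "b \<in> A - {b. w b \<noteq> \<zero>}" for b
    using that assms smult_zero_left by auto
qed simp

lemma free_lift_hom:
  assumes g: "g \<in> B \<rightarrow> carrier M"
  shows "free_lift R M g \<in> module_hom R (free_left_module R B) M"
proof (rule module_homI)
  let ?F = "free_left_module R B"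
  have supp: "finite {b. w b \<noteq> \<zero>}" "{b. w b \<noteq> \<zero>} \<subseteq> B" "w b \<in> carrier R"
    if "w \<in> carrier ?F" for w b
    using that by (auto simp: free_left_module_def image_subset_iff)
  interpret F: left_module R ?F by (rule R.free_left_module_is_left_module)
  have cl: "(\<lambda>b. w b \<odot>\<^bsub>M\<^esub> g b) \<in> A \<rightarrow> carrier M" if "w \<in> carrier ?F" "A \<subseteq> B" for w A
    using that g supp(3)[of w] by (auto simp: Pi_def subset_iff intro!: smult_closed)
  show "free_lift R M g w \<in> carrier M" if "w \<in> carrier ?F" for w
    unfolding free_lift_def using cl[OF that supp(2)[OF that]] by (rule M.finsum_closed)
  show "free_lift R M g (w \<oplus>\<^bsub>?F\<^esub> w') = free_lift R M g w \<oplus>\<^bsub>M\<^esub> free_lift R M g w'"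
    if w: "w \<in> carrier ?F" "w' \<in> carrier ?F" for w w'
  proof -
    let ?A = "{b. w b \<noteq> \<zero>} \<union> {b. w' b \<noteq> \<zero>}"
    have A: "finite ?A" "?A \<subseteq> B" using supp w by auto
    have add: "(w \<oplus>\<^bsub>?F\<^esub> w') b = w b \<oplus> w' b" for b
      by (simp add: free_left_module_def)
    have "{b. (w \<oplus>\<^bsub>?F\<^esub> w') b \<noteq> \<zero>} \<subseteq> ?A" by (auto simp: add)
    then have "free_lift R M g (w \<oplus>\<^bsub>?F\<^esub> w') = (\<Oplus>\<^bsub>M\<^esub>b\<in>?A. (w \<oplus>\<^bsub>?F\<^esub> w') b \<odot>\<^bsub>M\<^esub> g b)"
      using A g w by (intro free_lift_eq_finsum) auto
    also have "\<dots> = (\<Oplus>\<^bsub>M\<^esub>b\<in>?A. w b \<odot>\<^bsub>M\<^esub> g b \<oplus>\<^bsub>M\<^esub> w' b \<odot>\<^bsub>M\<^esub> g b)"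
    proof (rule M.finsum_cong')
      fix b assume b: "b \<in> ?A"
      then have "g b \<in> carrier M" using A(2) g by auto
      then show "(w \<oplus>\<^bsub>?F\<^esub> w') b \<odot>\<^bsub>M\<^esub> g b = w b \<odot>\<^bsub>M\<^esub> g b \<oplus>\<^bsub>M\<^esub> w' b \<odot>\<^bsub>M\<^esub> g b"
        unfolding add using supp(3) w by (intro smult_l_distr) auto
    qed (use cl[OF w(1) A(2)] cl[OF w(2) A(2)] in auto)
    also have "\<dots> = (\<Oplus>\<^bsub>M\<^esub>b\<in>?A. w b \<odot>\<^bsub>M\<^esub> g b) \<oplus>\<^bsub>M\<^esub> (\<Oplus>\<^bsub>M\<^esub>b\<in>?A. w' b \<odot>\<^bsub>M\<^esub> g b)"
      by (rule M.finsum_addf[OF cl[OF w(1) A(2)] cl[OF w(2) A(2)]])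
    also have "\<dots> = free_lift R M g w \<oplus>\<^bsub>M\<^esub> free_lift R M g w'"
      using A g w by (simp add: free_lift_eq_finsum[of _ B ?A])
    finally show ?thesis .
  qed
  show "free_lift R M g (r \<odot>\<^bsub>?F\<^esub> w) = r \<odot>\<^bsub>M\<^esub> free_lift R M g w"
    if w: "r \<in> carrier R" "w \<in> carrier ?F" for r w
  proof -
    let ?A = "{b. w b \<noteq> \<zero>}"
    have A: "finite ?A" "?A \<subseteq> B" using supp w by auto
    have mul: "(r \<odot>\<^bsub>?F\<^esub> w) b = r \<otimes> w b" for b
      by (simp add: free_left_module_def)
    have "{b. (r \<odot>\<^bsub>?F\<^esub> w) b \<noteq> \<zero>} \<subseteq> ?A" using w by (auto simp: mul)
    then have "free_lift R M g (r \<odot>\<^bsub>?F\<^esub> w) = (\<Oplus>\<^bsub>M\<^esub>b\<in>?A. (r \<odot>\<^bsub>?F\<^esub> w) b \<odot>\<^bsub>M\<^esub> g b)"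
      using A g w by (intro free_lift_eq_finsum) (auto intro: F.smult_closed)
    also have "\<dots> = (\<Oplus>\<^bsub>M\<^esub>b\<in>?A. r \<odot>\<^bsub>M\<^esub> (w b \<odot>\<^bsub>M\<^esub> g b))"
    proof (rule M.finsum_cong')
      fix b assume b: "b \<in> ?A"
      then have "g b \<in> carrier M" using A(2) g by auto
      then show "(r \<odot>\<^bsub>?F\<^esub> w) b \<odot>\<^bsub>M\<^esub> g b = r \<odot>\<^bsub>M\<^esub> (w b \<odot>\<^bsub>M\<^esub> g b)"
        unfolding mul using supp(3) w by (intro smult_assoc) auto
    qed (use cl[OF w(2) A(2)] w(1) smult_closed in auto)
    also have "\<dots> = r \<odot>\<^bsub>M\<^esub> (\<Oplus>\<^bsub>M\<^esub>b\<in>?A. w b \<odot>\<^bsub>M\<^esub> g b)"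
      by (rule smult_finsum[OF w(1) cl[OF w(2) A(2)], symmetric])
    finally show ?thesis by (simp add: free_lift_def)
  qed
qed

lemma free_lift_basis:
  assumes "g \<in> B \<rightarrow> carrier M" "b \<in> B"
  shows "free_lift R M g (free_basis R b) = g b"
proof -
  have "free_lift R M g (free_basis R b) = (\<Oplus>\<^bsub>M\<^esub>b'\<in>{b}. free_basis R b b' \<odot>\<^bsub>M\<^esub> g b')"
    using assms by (intro free_lift_eq_finsum[of _ B]) (auto simp: R.free_basis_closed, auto simp: free_basis_def split: if_splits)
  also have "\<dots> = g b"
    using assms smult_one smult_closed M.finsum_insert[of "{}" b "\<lambda>b'. free_basis R b b' \<odot>\<^bsub>M\<^esub> g b'"]
    by (auto simp: free_basis_def Pi_def)
  finally show ?thesis .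
qed

text \<open>Induction on a finite set that contains the support of \<open>w\<close>: removing one basis element from the
  support changes \<open>w\<close> by a multiple of that basis vector.\<close>

lemma free_hom_ext:
  assumes h: "h \<in> module_hom R (free_left_module R B) M" "h' \<in> module_hom R (free_left_module R B) M"
    and eq: "\<And>b. b \<in> B \<Longrightarrow> h (free_basis R b) = h' (free_basis R b)"
    and w: "w \<in> carrier (free_left_module R B)"
  shows "h w = h' w"
proof -
  let ?F = "free_left_module R B"
  interpret F: left_module R ?F by (rule R.free_left_module_is_left_module)
  have "finite A \<Longrightarrow> w \<in> carrier ?F \<Longrightarrow> {b. w b \<noteq> \<zero>} \<subseteq> A \<Longrightarrow> h w = h' w" for A w
  proof (induction A arbitrary: w rule: finite_induct)
    case empty
    then have "w = \<zero>\<^bsub>?F\<^esub>" by (auto simp: free_left_module_def)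
    then show ?case
      using F.hom_zero[OF left_module_axioms h(1)] F.hom_zero[OF left_module_axioms h(2)] by simp
  next
    case (insert a A)
    show ?case
    proof (cases "w a = \<zero>")
      case True
      then show ?thesis using insert by (metis (mono_tags, lifting) mem_Collect_eq subset_insert)
    next
      case False
      define w' where "w' = w(a := \<zero>)"
      have a: "a \<in> B" "w a \<in> carrier R"
        using insert.prems(1) False by (auto simp: free_left_module_def)
      have "{b. w' b \<noteq> \<zero>} \<subseteq> {b. w b \<noteq> \<zero>}" by (auto simp: w'_def)
      then have w': "w' \<in> carrier ?F"
        using insert.prems(1) by (auto simp: free_left_module_def w'_def intro: finite_subset)
      have wcl: "w b \<in> carrier R" for b
        using insert.prems(1) by (auto simp: free_left_module_def)
      have dec: "w = w' \<oplus>\<^bsub>?F\<^esub> w a \<odot>\<^bsub>?F\<^esub> free_basis R a"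
        using wcl by (auto simp: free_left_module_def w'_def free_basis_def)
      have eb: "free_basis R a \<in> carrier ?F" using a by (simp add: R.free_basis_closed)
      have "h w' = h' w'"
        using insert.prems by (intro insert.IH w') (auto simp: w'_def)
      then show ?thesis
        using eb a w' eq[OF a(1)] by (subst (1 2) dec)
          (simp add: module_hom_add[OF h(1)] module_hom_add[OF h(2)]
            module_hom_smult[OF h(1)] module_hom_smult[OF h(2)] F.smult_closed)
    qed
  qed
  then show ?thesis using w by (auto simp: free_left_module_def)
qed

end

lemma left_module_direct_sum:
  assumes "left_module R P" "left_module R Q"
  shows "left_module R (direct_sum P Q)"
proof -
  interpret P: left_module R P by (fact assms(1))
  interpret Q: left_module R Q by (fact assms(2))
  have "abelian_group (direct_sum P Q)"
  proof (rule abelian_groupI, goal_cases)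
    case (6 u)
    then show ?case
      by (intro bexI[of _ "(\<ominus>\<^bsub>P\<^esub> fst u, \<ominus>\<^bsub>Q\<^esub> snd u)"]) (auto simp: direct_sum_def P.l_neg Q.l_neg)
  qed (auto simp: direct_sum_def P.a_ac Q.a_ac)
  then show ?thesis
    unfolding left_module_def left_module_axioms_def
    using P.R.ring_axioms
    by (auto simp: direct_sum_def P.smult_closed Q.smult_closed P.smult_l_distr Q.smult_l_distr
        P.smult_r_distr Q.smult_r_distr P.smult_assoc Q.smult_assoc P.smult_one Q.smult_one)
qed

text \<open>Let \<open>P \<oplus> Q\<close> be free.  Lifting the \<open>P\<close>-components of its basis along \<open>G\<close> defines a homomorphism from
  the free module to \<open>N\<close>, whose restriction to \<open>P\<close> is a section of \<open>G\<close>.\<close>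

lemma projective_surjection_splits:
  fixes P :: "('r, 'p, 'y) module_scheme"
  assumes proj: "projective_left_module R P" and N: "left_module R N"
    and G: "G \<in> module_hom R N P" and surj: "\<And>p. p \<in> carrier P \<Longrightarrow> \<exists>n\<in>carrier N. G n = p"
  obtains s where "s \<in> module_hom R P N" "\<And>p. p \<in> carrier P \<Longrightarrow> G (s p) = p"
proof -
  obtain B :: "'p set" and Q :: "('r, 'p \<Rightarrow> 'r) module" and \<phi> where Q: "left_module R Q"
    and \<phi>: "\<phi> \<in> left_module_iso R (direct_sum P Q) (free_left_module R B)"
    and P: "left_module R P"
    using proj unfolding projective_left_module_def by blast
  interpret P: left_module R P by (fact P)
  interpret Q: left_module R Q by (fact Q)
  interpret N: left_module R N by (fact N)
  let ?F = "free_left_module R B" and ?S = "direct_sum P Q"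
  interpret F: left_module R ?F by (rule P.R.free_left_module_is_left_module)
  interpret S: left_module R ?S by (rule left_module_direct_sum[OF P Q])
  define \<psi> where "\<psi> = inv_into (carrier ?S) \<phi>"
  have bij: "bij_betw \<phi> (carrier ?S) (carrier ?F)" and \<phi>h: "\<phi> \<in> module_hom R ?S ?F"
    using \<phi> by (auto simp: left_module_iso_def module_hom_def bij_betw_def)
  have \<psi>c: "\<psi> w \<in> carrier ?S" "\<phi> (\<psi> w) = w" if "w \<in> carrier ?F" for w
    using that bij by (auto simp: \<psi>_def bij_betw_def inv_into_into f_inv_into_f)
  have \<psi>\<phi>: "\<psi> (\<phi> u) = u" if "u \<in> carrier ?S" for u
    using that bij by (auto simp: \<psi>_def bij_betw_def)
  have \<psi>h: "\<psi> \<in> module_hom R ?F ?S"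
  proof (rule module_homI)
    show "\<psi> w \<in> carrier ?S" if "w \<in> carrier ?F" for w using \<psi>c(1)[OF that] .
    show "\<psi> (w \<oplus>\<^bsub>?F\<^esub> w') = \<psi> w \<oplus>\<^bsub>?S\<^esub> \<psi> w'"
      if "w \<in> carrier ?F" "w' \<in> carrier ?F" for w w'
      using \<psi>\<phi>[of "\<psi> w \<oplus>\<^bsub>?S\<^esub> \<psi> w'"] \<psi>c that by (simp add: module_hom_add[OF \<phi>h])
    show "\<psi> (r \<odot>\<^bsub>?F\<^esub> w) = r \<odot>\<^bsub>?S\<^esub> \<psi> w"
      if "r \<in> carrier R" "w \<in> carrier ?F" for r w
      using \<psi>\<phi>[of "r \<odot>\<^bsub>?S\<^esub> \<psi> w"] \<psi>c that by (simp add: module_hom_smult[OF \<phi>h] S.smult_closed)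
  qed
  have "fst \<in> module_hom R ?S P" by (rule module_homI) (auto simp: direct_sum_def)
  then have proj_h: "fst \<circ> \<psi> \<in> module_hom R ?F P" by (rule module_hom_compose[OF \<psi>h])
  have "\<forall>b. \<exists>n. b \<in> B \<longrightarrow> n \<in> carrier N \<and> G n = (fst \<circ> \<psi>) (free_basis R b)"
    using surj module_hom_closed[OF proj_h] P.R.free_basis_closed by meson
  then obtain n where n: "\<And>b. b \<in> B \<Longrightarrow> n b \<in> carrier N"
    "\<And>b. b \<in> B \<Longrightarrow> G (n b) = (fst \<circ> \<psi>) (free_basis R b)"
    by metis
  then have nB: "n \<in> B \<rightarrow> carrier N" by auto
  let ?L = "free_lift R N n"
  have Lh: "?L \<in> module_hom R ?F N" by (rule N.free_lift_hom[OF nB])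
  have GL: "G (?L w) = fst (\<psi> w)" if "w \<in> carrier ?F" for w
    using P.free_hom_ext[OF module_hom_compose[OF Lh G] proj_h _ that] n
    by (simp add: N.free_lift_basis[OF nB])
  have inc: "(\<lambda>p. (p, \<zero>\<^bsub>Q\<^esub>)) \<in> module_hom R P ?S"
    by (rule module_homI) (auto simp: direct_sum_def Q.smult_zero_right)
  show ?thesis
  proof (rule that)
    show "(?L \<circ> \<phi>) \<circ> (\<lambda>p. (p, \<zero>\<^bsub>Q\<^esub>)) \<in> module_hom R P N"
      by (intro module_hom_compose[OF inc] module_hom_compose[OF \<phi>h Lh])
    show "G (((?L \<circ> \<phi>) \<circ> (\<lambda>p. (p, \<zero>\<^bsub>Q\<^esub>))) p) = p" if "p \<in> carrier P" for p
      using module_hom_closed[OF inc that] module_hom_closed[OF \<phi>h] by (simp add: GL \<psi>\<phi>)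
  qed
qed

text \<open>The kernel of \<open>\<pi>\<close> is a complement of \<open>P\<close>, by way of \<open>(p, q) \<mapsto> s p + q\<close>.\<close>

lemma retract_of_free_projective:
  fixes P :: "('r, 'p, 'y) module_scheme" and B :: "'p set"
  assumes P: "left_module R P" and s: "s \<in> module_hom R P (free_left_module R B)"
    and \<pi>: "\<pi> \<in> module_hom R (free_left_module R B) P"
    and retr: "\<And>p. p \<in> carrier P \<Longrightarrow> \<pi> (s p) = p"
  shows "projective_left_module R P"
proof -
  interpret P: left_module R P by (fact P)
  let ?F = "free_left_module R B"
  interpret F: left_module R ?F by (rule P.R.free_left_module_is_left_module)
  define Q where "Q = ?F\<lparr>carrier := {q \<in> carrier ?F. \<pi> q = \<zero>\<^bsub>P\<^esub>}\<rparr>"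
  have \<pi>0: "\<pi> \<zero>\<^bsub>?F\<^esub> = \<zero>\<^bsub>P\<^esub>" by (rule F.hom_zero[OF P \<pi>])
  have \<pi>neg: "\<pi> (\<ominus>\<^bsub>?F\<^esub> q) = \<ominus>\<^bsub>P\<^esub> \<pi> q" if "q \<in> carrier ?F" for q
  proof -
    have "\<pi> (\<ominus>\<^bsub>?F\<^esub> q) \<oplus>\<^bsub>P\<^esub> \<pi> q = \<zero>\<^bsub>P\<^esub>"
      using that module_hom_add[OF \<pi>, of "\<ominus>\<^bsub>?F\<^esub> q" q] by (simp add: F.l_neg \<pi>0)
    then show ?thesis
      using that module_hom_closed[OF \<pi>] by (simp add: P.minus_equality)
  qed
  have "abelian_group Q"
  proof (rule abelian_groupI, goal_cases)
    case (6 q)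
    then show ?case
      by (intro bexI[of _ "\<ominus>\<^bsub>?F\<^esub> q"]) (auto simp: Q_def F.l_neg \<pi>neg)
  qed (auto simp: Q_def F.a_ac module_hom_add[OF \<pi>] \<pi>0)
  then have Q: "left_module R Q"
    unfolding left_module_def left_module_axioms_def
    using P.R.ring_axioms
    by (auto simp: Q_def F.smult_closed F.smult_l_distr F.smult_r_distr F.smult_assoc F.smult_one
        module_hom_smult[OF \<pi>] P.smult_zero_right)
  define \<phi> where "\<phi> = (\<lambda>u. s (fst u) \<oplus>\<^bsub>?F\<^esub> snd u)"
  have Qc: "q \<in> carrier ?F" "\<pi> q = \<zero>\<^bsub>P\<^esub>" if "q \<in> carrier Q" for q
    using that by (auto simp: Q_def)
  have \<pi>\<phi>: "\<pi> (\<phi> (p, q)) = p" if "p \<in> carrier P" "q \<in> carrier Q" for p q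
    using that Qc[of q] module_hom_closed[OF s]
    by (simp add: \<phi>_def module_hom_add[OF \<pi>] retr)
  have "bij_betw \<phi> (carrier (direct_sum P Q)) (carrier ?F)"
    unfolding bij_betw_def
  proof
    show "inj_on \<phi> (carrier (direct_sum P Q))"
    proof (rule inj_onI)
      fix u u'
      assume u: "u \<in> carrier (direct_sum P Q)" "u' \<in> carrier (direct_sum P Q)" "\<phi> u = \<phi> u'"
      obtain p q p' q' where uu: "u = (p, q)" "u' = (p', q')" by (metis surj_pair)
      have c: "p \<in> carrier P" "p' \<in> carrier P" "q \<in> carrier Q" "q' \<in> carrier Q"
        using u uu by (auto simp: direct_sum_def)
      have pp: "p = p'" using \<pi>\<phi> c u(3) uu by metis
      have "s p \<oplus>\<^bsub>?F\<^esub> q = s p \<oplus>\<^bsub>?F\<^esub> q'" using u(3) uu pp by (simp add: \<phi>_def)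
      then have "q = q'"
        using c Qc(1) module_hom_closed[OF s] by simp
      then show "u = u'" using uu pp by simp
    qed
    show "\<phi> ` carrier (direct_sum P Q) = carrier ?F"
    proof
      show "\<phi> ` carrier (direct_sum P Q) \<subseteq> carrier ?F"
        using Qc(1) module_hom_closed[OF s] by (auto simp: direct_sum_def \<phi>_def)
      show "carrier ?F \<subseteq> \<phi> ` carrier (direct_sum P Q)"
      proof
        fix w assume w: "w \<in> carrier ?F"
        have p: "\<pi> w \<in> carrier P" "s (\<pi> w) \<in> carrier ?F"
          using w module_hom_closed[OF \<pi>] module_hom_closed[OF s] by auto
        have q: "\<ominus>\<^bsub>?F\<^esub> s (\<pi> w) \<oplus>\<^bsub>?F\<^esub> w \<in> carrier Q"
          using w p by (simp add: Q_def module_hom_add[OF \<pi>] \<pi>neg retr P.l_neg)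
        have "w = \<phi> (\<pi> w, \<ominus>\<^bsub>?F\<^esub> s (\<pi> w) \<oplus>\<^bsub>?F\<^esub> w)"
          using w p F.r_neg by (simp add: \<phi>_def F.a_assoc[symmetric])
        then show "w \<in> \<phi> ` carrier (direct_sum P Q)"
          using p q by (auto simp: direct_sum_def)
      qed
    qed
  qed
  moreover have "\<phi> \<in> module_hom R (direct_sum P Q) ?F"
  proof (rule module_homI)
    fix u u' assume "u \<in> carrier (direct_sum P Q)" "u' \<in> carrier (direct_sum P Q)"
    then have c: "fst u \<in> carrier P" "fst u' \<in> carrier P" "snd u \<in> carrier ?F" "snd u' \<in> carrier ?F"
      using Qc(1) by (auto simp: direct_sum_def)
    then have "s (fst u) \<in> carrier ?F" "s (fst u') \<in> carrier ?F" using module_hom_closed[OF s] by auto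
    with c show "\<phi> (u \<oplus>\<^bsub>direct_sum P Q\<^esub> u') = \<phi> u \<oplus>\<^bsub>?F\<^esub> \<phi> u'"
      by (simp add: \<phi>_def direct_sum_def Q_def module_hom_add[OF s] F.a_ac)
  next
    fix r u assume r: "r \<in> carrier R" and "u \<in> carrier (direct_sum P Q)"
    then have c: "fst u \<in> carrier P" "snd u \<in> carrier ?F"
      using Qc(1) by (auto simp: direct_sum_def)
    then have "s (fst u) \<in> carrier ?F" using module_hom_closed[OF s] by auto
    with c r show "\<phi> (r \<odot>\<^bsub>direct_sum P Q\<^esub> u) = r \<odot>\<^bsub>?F\<^esub> \<phi> u"
      by (simp add: \<phi>_def direct_sum_def Q_def module_hom_smult[OF s] F.smult_r_distr)
  qed (use Qc(1) module_hom_closed[OF s] in \<open>auto simp: direct_sum_def \<phi>_def\<close>)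
  ultimately have "\<phi> \<in> left_module_iso R (direct_sum P Q) ?F"
    by (auto simp: left_module_iso_def module_hom_def)
  then show ?thesis
    unfolding projective_left_module_def using P Q by blast
qed

section \<open>Factorizations in finite skeletal EI categories\<close>

context category
begin

lemma Hom_iff: "f \<in> Hom C a b \<longleftrightarrow> f \<in> Mor C \<and> Dom C f = a \<and> Cod C f = b"
  by (simp add: Hom_def)

lemma comp_simps [simp]:
  assumes "f \<in> Mor C" "g \<in> Mor C" "Cod C f = Dom C g"
  shows "g \<cdot> f \<in> Mor C" "Dom C (g \<cdot> f) = Dom C f" "Cod C (g \<cdot> f) = Cod C g"
  using Comp_closed[of f "Dom C f" "Cod C f" g "Cod C g"] assms by (auto simp: Hom_iff)

lemma Id_simps [simp]:
  assumes "a \<in> Obj C"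
  shows "Id C a \<in> Mor C" "Dom C (Id C a) = a" "Cod C (Id C a) = a"
  using Id_closed[OF assms] by (auto simp: Hom_iff)

lemma comp_assoc:
  assumes "f \<in> Mor C" "g \<in> Mor C" "h \<in> Mor C" "Cod C f = Dom C g" "Cod C g = Dom C h"
  shows "(h \<cdot> g) \<cdot> f = h \<cdot> (g \<cdot> f)"
  by (rule Comp_assoc[of f "Dom C f" "Cod C f" g "Cod C g" h "Cod C h"]) (use assms in \<open>auto simp: Hom_iff\<close>)

lemma comp_Id [simp]:
  assumes "f \<in> Mor C"
  shows "Cod C f = b \<Longrightarrow> Id C b \<cdot> f = f" "Dom C f = a \<Longrightarrow> f \<cdot> Id C a = f"
  using Comp_Id_left[of f "Dom C f" "Cod C f"] Comp_Id_right[of f "Dom C f" "Cod C f"] assms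
  by (auto simp: Hom_iff)

lemma inverse_mor:
  assumes "is_iso C f"
  shows "is_inverse C f (inverse_mor C f)"
proof -
  obtain g where g: "is_inverse C f g" and f: "f \<in> Mor C"
    using assms by (auto simp: is_iso_def)
  have "g' = g" if "is_inverse C f g'" for g'
  proof -
    have "g' = g' \<cdot> (f \<cdot> g)" using f g that by (auto simp: is_inverse_def Hom_iff)
    also have "\<dots> = (g' \<cdot> f) \<cdot> g"
      using f g that comp_assoc[of g f g'] by (auto simp: is_inverse_def Hom_iff simp del: comp_simps)
    also have "\<dots> = g" using f g that by (auto simp: is_inverse_def Hom_iff)
    finally show ?thesis .
  qed
  then show ?thesis unfolding inverse_mor_def using g by (metis theI)
qed

end

text \<open>In this setting the invertible morphisms are exactly the endomorphisms, and every other morphism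
  leads to an object of strictly smaller index.  The inductions below run over this index.\<close>

locale directed_EI_category = category C
  for C :: "('o, 'm, 'z) category_scheme" (structure) +
  fixes x :: "nat \<Rightarrow> 'o" and n :: nat
  assumes finite_Mor [simp]: "finite (Mor C)"
    and endo_iso: "\<lbrakk>a \<in> Obj C; f \<in> Hom C a a\<rbrakk> \<Longrightarrow> is_iso C f"
    and skel: "skeletal C"
    and bij_x: "bij_betw x {1..n} (Obj C)"
    and triangular: "\<lbrakk>i \<in> {1..n}; j \<in> {1..n}; i < j\<rbrakk> \<Longrightarrow> Hom C (x i) (x j) = {}"
begin

definition rank :: "'o \<Rightarrow> nat" where "rank = inv_into {1..n} x"

lemma rank_x [simp]: "i \<in> {1..n} \<Longrightarrow> rank (x i) = i"
  unfolding rank_def using bij_x by (simp add: bij_betw_def)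

lemma x_rank: "a \<in> Obj C \<Longrightarrow> x (rank a) = a" "a \<in> Obj C \<Longrightarrow> rank a \<in> {1..n}"
  unfolding rank_def using bij_x
  by (auto simp: bij_betw_def f_inv_into_f simp del: atLeastAtMost_iff intro!: inv_into_into)

lemma x_Obj [simp]: "i \<in> {1..n} \<Longrightarrow> x i \<in> Obj C"
  using bij_x by (auto simp: bij_betw_def)

lemma rank_eq_iff: "\<lbrakk>a \<in> Obj C; b \<in> Obj C\<rbrakk> \<Longrightarrow> rank a = rank b \<longleftrightarrow> a = b"
  using x_rank(1) by metis

lemma rank_mono:
  assumes "f \<in> Mor C"
  shows "rank (Cod C f) \<le> rank (Dom C f)"
proof (rule ccontr)
  assume "\<not> ?thesis"
  then have "Hom C (Dom C f) (Cod C f) = {}"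
    using triangular[of "rank (Dom C f)" "rank (Cod C f)"] x_rank Dom_closed[OF assms] Cod_closed[OF assms]
    by auto
  then show False using assms by (auto simp: Hom_iff)
qed

lemma iso_iff_endo:
  assumes "f \<in> Mor C"
  shows "is_iso C f \<longleftrightarrow> Dom C f = Cod C f"
proof
  assume "is_iso C f"
  moreover have "f \<in> Hom C (Dom C f) (Cod C f)" using assms by (simp add: Hom_iff)
  ultimately show "Dom C f = Cod C f"
    using skel Dom_closed[OF assms] Cod_closed[OF assms] unfolding skeletal_def by blast
next
  assume "Dom C f = Cod C f"
  then show "is_iso C f"
    using endo_iso[of "Dom C f" f] Dom_closed[OF assms] assms by (simp add: Hom_iff)
qed

lemma rank_less:
  assumes "f \<in> Mor C" "Dom C f \<noteq> Cod C f"
  shows "rank (Cod C f) < rank (Dom C f)"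
  using rank_mono[OF assms(1)] rank_eq_iff Dom_closed Cod_closed assms by (metis order_le_less)

lemma unfactorizable_iff:
  "unfactorizable C f \<longleftrightarrow> f \<in> Mor C \<and> Dom C f \<noteq> Cod C f \<and>
    (\<forall>b\<in>Mor C. \<forall>g\<in>Mor C. Cod C b = Dom C g \<and> f = g \<cdot> b \<longrightarrow> Dom C b = Cod C b \<or> Dom C g = Cod C g)"
  unfolding unfactorizable_def using iso_iff_endo by blast

lemma Aut_inverse:
  assumes "h \<in> Aut C a"
  shows "inverse_mor C h \<in> Aut C a" "inverse_mor C h \<cdot> h = Id C a" "h \<cdot> inverse_mor C h = Id C a"
proof -
  have "is_iso C h" using assms iso_iff_endo by (auto simp: Aut_def Hom_iff)
  from inverse_mor[OF this]
  show "inverse_mor C h \<in> Aut C a" "inverse_mor C h \<cdot> h = Id C a" "h \<cdot> inverse_mor C h = Id C a"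
    using assms by (auto simp: is_inverse_def Aut_def Hom_iff)
qed

text \<open>Cancelling the automorphism turns a factorization of the composite into one of \<open>f\<close>.\<close>

lemma unfactorizable_comp_Aut:
  assumes f: "unfactorizable C f"
  shows "h \<in> Aut C (Cod C f) \<Longrightarrow> unfactorizable C (h \<cdot> f)"
    and "g \<in> Aut C (Dom C f) \<Longrightarrow> unfactorizable C (f \<cdot> g)"
proof -
  have fM: "f \<in> Mor C" "Dom C f \<noteq> Cod C f" using f by (auto simp: unfactorizable_iff)
  assume h: "h \<in> Aut C (Cod C f)"
  have hM: "h \<in> Mor C" "Dom C h = Cod C f" "Cod C h = Cod C f" using h by (auto simp: Aut_def Hom_iff)
  show "unfactorizable C (h \<cdot> f)"
    unfolding unfactorizable_iff
  proof (intro conjI ballI impI)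
    fix b c assume bc: "b \<in> Mor C" "c \<in> Mor C" "Cod C b = Dom C c \<and> h \<cdot> f = c \<cdot> b"
    obtain h' where h': "h' \<in> Aut C (Cod C f)" "h' \<cdot> h = Id C (Cod C f)" using Aut_inverse[OF h] by blast
    then have h'M: "h' \<in> Mor C" "Dom C h' = Cod C f" "Cod C h' = Cod C f" by (auto simp: Aut_def Hom_iff)
    have cc: "Cod C c = Cod C f" using bc comp_simps(3)[of b c] comp_simps(3)[of f h] fM hM by metis
    have "f = (h' \<cdot> h) \<cdot> f" using h' fM by simp
    also have "\<dots> = h' \<cdot> (h \<cdot> f)" using hM h'M fM by (simp add: comp_assoc)
    also have "\<dots> = (h' \<cdot> c) \<cdot> b" using bc cc h'M by (simp add: comp_assoc)
    finally have "Dom C b = Cod C b \<or> Dom C (h' \<cdot> c) = Cod C (h' \<cdot> c)"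
      using f bc cc h'M unfolding unfactorizable_iff by (metis comp_simps(1,2))
    then show "Dom C b = Cod C b \<or> Dom C c = Cod C c" using bc cc h'M by simp
  qed (use fM hM in auto)
next
  have fM: "f \<in> Mor C" "Dom C f \<noteq> Cod C f" using f by (auto simp: unfactorizable_iff)
  assume g: "g \<in> Aut C (Dom C f)"
  have gM: "g \<in> Mor C" "Dom C g = Dom C f" "Cod C g = Dom C f" using g by (auto simp: Aut_def Hom_iff)
  show "unfactorizable C (f \<cdot> g)"
    unfolding unfactorizable_iff
  proof (intro conjI ballI impI)
    fix b c assume bc: "b \<in> Mor C" "c \<in> Mor C" "Cod C b = Dom C c \<and> f \<cdot> g = c \<cdot> b"
    obtain g' where g': "g' \<in> Aut C (Dom C f)" "g \<cdot> g' = Id C (Dom C f)" using Aut_inverse[OF g] by blast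
    then have g'M: "g' \<in> Mor C" "Dom C g' = Dom C f" "Cod C g' = Dom C f" by (auto simp: Aut_def Hom_iff)
    have bb: "Dom C b = Dom C f" using bc comp_simps(2)[of b c] comp_simps(2)[of g f] fM gM by metis
    have "f = f \<cdot> (g \<cdot> g')" using g' fM by simp
    also have "\<dots> = (f \<cdot> g) \<cdot> g'" using gM g'M fM by (simp add: comp_assoc)
    also have "\<dots> = c \<cdot> (b \<cdot> g')" using bc bb g'M by (simp add: comp_assoc)
    finally have "Dom C (b \<cdot> g') = Cod C (b \<cdot> g') \<or> Dom C c = Cod C c"
      using f bc bb g'M unfolding unfactorizable_iff by (metis comp_simps(1,3))
    then show "Dom C b = Cod C b \<or> Dom C c = Cod C c" using bc bb g'M by simp
  qed (use fM gM in auto)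
qed

text \<open>As long as the right factor can be factored further, move its left part into the left factor; the
  difference of the indices of its two ends drops each time.\<close>

lemma exists_unfactorizable_factor:
  assumes "f \<in> Mor C" "Dom C f \<noteq> Cod C f"
  shows "\<exists>g b. g \<in> Mor C \<and> unfactorizable C b \<and> Cod C b = Dom C g \<and> f = g \<cdot> b"
  using assms
proof (induction "rank (Dom C f) - rank (Cod C f)" arbitrary: f rule: less_induct)
  case less
  show ?case
  proof (cases "unfactorizable C f")
    case True
    then show ?thesis
      using less.prems Cod_closed by (intro exI[of _ "Id C (Cod C f)"] exI[of _ f]) auto
  next
    case False
    then obtain b g where bg: "b \<in> Mor C" "g \<in> Mor C" "Cod C b = Dom C g" "f = g \<cdot> b"
      "Dom C b \<noteq> Cod C b" "Dom C g \<noteq> Cod C g"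
      using less.prems by (auto simp: unfactorizable_iff)
    have "rank (Dom C b) - rank (Cod C b) < rank (Dom C f) - rank (Cod C f)"
      using rank_less[OF bg(1,5)] rank_less[OF bg(2,6)] bg by simp
    from less.hyps[OF this bg(1,5)] obtain g1 b1 where
      g1: "g1 \<in> Mor C" "unfactorizable C b1" "Cod C b1 = Dom C g1" "b = g1 \<cdot> b1" by blast
    have "b1 \<in> Mor C" using g1 by (auto simp: unfactorizable_iff)
    then show ?thesis
      using bg g1 by (intro exI[of _ "g \<cdot> g1"] exI[of _ b1]) (auto simp: comp_assoc)
  qed
qed

text \<open>Equality of \<open>g \<otimes> b\<close> and \<open>g' \<otimes> b'\<close> in the product of sets of morphisms balanced over the automorphisms
  of the object in the middle.\<close>

definition equiv_factorizations :: "'m \<Rightarrow> 'm \<Rightarrow> 'm \<Rightarrow> 'm \<Rightarrow> bool" where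
  "equiv_factorizations g b g' b' \<longleftrightarrow>
    Cod C b = Cod C b' \<and> (\<exists>h\<in>Aut C (Cod C b). b' = h \<cdot> b \<and> g = g' \<cdot> h)"

lemma equiv_factorizations_refl: "\<lbrakk>b \<in> Mor C; g \<in> Mor C; Dom C g = Cod C b\<rbrakk> \<Longrightarrow> equiv_factorizations g b g b"
  unfolding equiv_factorizations_def using Cod_closed[of b]
  by (auto simp: Aut_def Hom_iff intro!: bexI[of _ "Id C (Cod C b)"])

lemma equiv_factorizations_sym:
  assumes "equiv_factorizations g b g' b'" "b \<in> Mor C" "g' \<in> Mor C" "Dom C g' = Cod C b'"
  shows "equiv_factorizations g' b' g b"
proof -
  obtain h where h: "Cod C b = Cod C b'" "h \<in> Aut C (Cod C b)" "b' = h \<cdot> b" "g = g' \<cdot> h"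
    using assms(1) by (auto simp: equiv_factorizations_def)
  obtain k where k: "k \<in> Aut C (Cod C b)" "k \<cdot> h = Id C (Cod C b)" "h \<cdot> k = Id C (Cod C b)"
    using Aut_inverse[OF h(2)] by blast
  have M: "h \<in> Mor C" "Dom C h = Cod C b" "Cod C h = Cod C b" "k \<in> Mor C" "Dom C k = Cod C b" "Cod C k = Cod C b"
    using h k by (auto simp: Aut_def Hom_iff)
  have "k \<cdot> b' = b"
    using comp_assoc[of b h k] M assms(2) k(2) by (simp add: h(3))
  moreover have "g \<cdot> k = g'"
    using comp_assoc[of k h g'] M assms(3,4) k(3) h(1) by (simp add: h(4))
  ultimately show ?thesis
    using h(1) k(1) unfolding equiv_factorizations_def
    by (intro conjI bexI[of _ k] sym[OF h(1)]) simp_all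
qed

lemma equiv_factorizations_trans:
  assumes "equiv_factorizations g b g' b'" "equiv_factorizations g' b' g'' b''" "b \<in> Mor C"
    "g'' \<in> Mor C" "Dom C g'' = Cod C b''"
  shows "equiv_factorizations g b g'' b''"
proof -
  obtain h where h: "Cod C b = Cod C b'" "h \<in> Aut C (Cod C b)" "b' = h \<cdot> b" "g = g' \<cdot> h"
    using assms(1) by (auto simp: equiv_factorizations_def)
  obtain k where k: "Cod C b' = Cod C b''" "k \<in> Aut C (Cod C b')" "b'' = k \<cdot> b'" "g' = g'' \<cdot> k"
    using assms(2) by (auto simp: equiv_factorizations_def)
  have M: "h \<in> Mor C" "Dom C h = Cod C b" "Cod C h = Cod C b" "k \<in> Mor C" "Dom C k = Cod C b" "Cod C k = Cod C b"
    using h k by (auto simp: Aut_def Hom_iff)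
  have "b'' = (k \<cdot> h) \<cdot> b"
    using comp_assoc[of b h k] M assms(3) by (simp add: k(3) h(3))
  moreover have "g = g'' \<cdot> (k \<cdot> h)"
    using comp_assoc[of h k g''] M assms(4,5) h(1) k(1) by (simp add: h(4) k(4))
  moreover have "k \<cdot> h \<in> Aut C (Cod C b)" using M by (simp add: Aut_def Hom_iff)
  ultimately show ?thesis using h(1) k(1) unfolding equiv_factorizations_def by auto
qed

lemma equiv_factorizations_comp:
  assumes "equiv_factorizations g b g' b'" "g' \<in> Mor C" "Dom C g' = Cod C b'" "a \<in> Mor C" "Dom C a = Cod C g'"
  shows "equiv_factorizations (a \<cdot> g) b (a \<cdot> g') b'"
proof -
  obtain h where h: "Cod C b = Cod C b'" "h \<in> Aut C (Cod C b)" "b' = h \<cdot> b" "g = g' \<cdot> h"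
    using assms(1) by (auto simp: equiv_factorizations_def)
  have M: "h \<in> Mor C" "Dom C h = Cod C b" "Cod C h = Cod C b" using h by (auto simp: Aut_def Hom_iff)
  have "a \<cdot> g = (a \<cdot> g') \<cdot> h" using comp_assoc[of h g' a] M h(1) assms(2-) by (simp add: h(4))
  then show ?thesis using h unfolding equiv_factorizations_def by auto
qed

text \<open>If one of \<open>g\<close>, \<open>g'\<close> is invertible, the common composite is unfactorizable, hence the other one is
  invertible too, and their quotient is the required automorphism.\<close>

lemma equiv_factorizations_of_Aut:
  assumes g: "g \<in> Hom C (Cod C b) y" and b: "unfactorizable C b"
    and g': "g' \<in> Hom C (Cod C b') y" and b': "unfactorizable C b'"
    and eq: "g \<cdot> b = g' \<cdot> b'" and y: "Cod C b = y \<or> Cod C b' = y"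
  shows "equiv_factorizations g b g' b'"
proof -
  have bM: "b \<in> Mor C" "Dom C b \<noteq> Cod C b" "b' \<in> Mor C" "Dom C b' \<noteq> Cod C b'"
    using b b' by (auto simp: unfactorizable_iff)
  have gM: "g \<in> Mor C" "Dom C g = Cod C b" "Cod C g = y" "g' \<in> Mor C" "Dom C g' = Cod C b'" "Cod C g' = y"
    using g g' by (auto simp: Hom_iff)
  have iso: "Cod C b2 = y" if "unfactorizable C b1" "unfactorizable C b2" "Cod C b1 = y"
    "g1 \<in> Hom C (Cod C b1) y" "g2 \<in> Hom C (Cod C b2) y" "g1 \<cdot> b1 = g2 \<cdot> b2" for g1 b1 g2 b2
  proof -
    have "unfactorizable C (g1 \<cdot> b1)"
      using unfactorizable_comp_Aut(1)[of b1 g1] that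
      by (auto simp: Aut_def Hom_iff unfactorizable_def)
    moreover have "b2 \<in> Mor C" "g2 \<in> Mor C" "Cod C b2 = Dom C g2"
      using that by (auto simp: unfactorizable_iff Hom_iff)
    ultimately have "Dom C b2 = Cod C b2 \<or> Dom C g2 = Cod C g2"
      using that(6) unfactorizable_iff[of "g1 \<cdot> b1"] by metis
    then show ?thesis using that by (auto simp: unfactorizable_iff Hom_iff)
  qed
  have c: "Cod C b = y" "Cod C b' = y"
    using y iso[OF b b' _ g g' eq] iso[OF b' b _ g' g eq[symmetric]] by auto
  have "g' \<in> Aut C y" using g' c by (simp add: Aut_def)
  then obtain k where k: "k \<in> Aut C y" "k \<cdot> g' = Id C y" "g' \<cdot> k = Id C y"
    using Aut_inverse by blast
  have kM: "k \<in> Mor C" "Dom C k = y" "Cod C k = y" using k by (auto simp: Aut_def Hom_iff)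
  have "b' = (k \<cdot> g') \<cdot> b'" using k bM c by simp
  also have "\<dots> = (k \<cdot> g) \<cdot> b" using kM gM bM c eq by (simp add: comp_assoc)
  finally have "b' = (k \<cdot> g) \<cdot> b" .
  moreover have "g = g' \<cdot> (k \<cdot> g)" using kM gM c k by (simp add: comp_assoc[symmetric])
  moreover have "k \<cdot> g \<in> Aut C y" using kM gM c by (simp add: Aut_def Hom_iff)
  ultimately show ?thesis using c by (auto simp: equiv_factorizations_def)
qed

text \<open>Injectivity of composition on the balanced product of \<open>Hom(-, y)\<close> and the unfactorizable morphisms
  out of \<open>z\<close>: only the first factor of a decomposition is compared.\<close>

definition two_step_unique :: "'o \<Rightarrow> 'o \<Rightarrow> bool" where
  "two_step_unique z y \<longleftrightarrow>
    (\<forall>g b g' b'. g \<in> Hom C (Cod C b) y \<and> unfactorizable C b \<and> Dom C b = z \<and>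
       g' \<in> Hom C (Cod C b') y \<and> unfactorizable C b' \<and> Dom C b' = z \<and> g \<cdot> b = g' \<cdot> b' \<longrightarrow>
       equiv_factorizations g b g' b')"

text \<open>Paths of length 0 are admitted, so that inductions can start from an identity.\<close>

definition unf_path :: "nat \<Rightarrow> (nat \<Rightarrow> 'o) \<Rightarrow> (nat \<Rightarrow> 'm) \<Rightarrow> bool" where
  "unf_path p u \<alpha> \<longleftrightarrow> u 0 \<in> Obj C \<and> (\<forall>i\<in>{1..p}. \<alpha> i \<in> Hom C (u (i - 1)) (u i) \<and> unfactorizable C (\<alpha> i))"

lemma unf_path_Suc:
  "unf_path (Suc p) u \<alpha> \<longleftrightarrow> u 0 \<in> Obj C \<and> \<alpha> 1 \<in> Hom C (u 0) (u 1) \<and> unfactorizable C (\<alpha> 1) \<and>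
    unf_path p (\<lambda>i. u (Suc i)) (\<lambda>i. \<alpha> (Suc i))"
proof -
  have "(\<forall>i\<in>{1..Suc p}. P i) \<longleftrightarrow> P 1 \<and> (\<forall>i\<in>{1..p}. P (Suc i))" for P
  proof -
    have eq: "{1..Suc p} = insert 1 (Suc ` {1..p})" by auto
    show ?thesis unfolding eq by (simp only: ball_simps image_iff bex_simps)
  qed
  note this[of "\<lambda>i. \<alpha> i \<in> Hom C (u (i - 1)) (u i) \<and> unfactorizable C (\<alpha> i)"]
  moreover have "\<alpha> 1 \<in> Hom C (u 0) (u 1) \<Longrightarrow> u 1 \<in> Obj C" using Cod_closed[of "\<alpha> 1"] by (auto simp: Hom_iff)
  moreover have "(\<forall>i\<in>{1..p}. \<alpha> (Suc i) \<in> Hom C (u (Suc i - 1)) (u (Suc i)) \<and> unfactorizable C (\<alpha> (Suc i))) \<longleftrightarrow>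
      (\<forall>i\<in>{1..p}. \<alpha> (Suc i) \<in> Hom C (u (Suc (i - 1))) (u (Suc i)) \<and> unfactorizable C (\<alpha> (Suc i)))"
    by (intro ball_cong) auto
  ultimately show ?thesis unfolding unf_path_def by auto
qed

lemma path_comp_Hom:
  assumes "unf_path p u \<alpha>"
  shows "path_comp C u \<alpha> p \<in> Hom C (u 0) (u p)"
  using assms
proof (induction p)
  case 0
  then show ?case by (auto simp: unf_path_def Hom_iff)
next
  case (Suc p)
  then have "path_comp C u \<alpha> p \<in> Hom C (u 0) (u p)" "\<alpha> (Suc p) \<in> Hom C (u p) (u (Suc p))"
    by (auto simp: unf_path_def dest!: bspec[where x = "Suc p"])
  then show ?case by (auto simp: Hom_iff)
qed

lemma path_comp_Suc_shift:
  assumes "unf_path (Suc p) u \<alpha>"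
  shows "path_comp C u \<alpha> (Suc p) = path_comp C (\<lambda>i. u (Suc i)) (\<lambda>i. \<alpha> (Suc i)) p \<cdot> \<alpha> 1"
  using assms
proof (induction p)
  case 0
  then show ?case by (auto simp: unf_path_Suc Hom_iff Cod_closed)
next
  case (Suc p)
  have p: "unf_path (Suc p) u \<alpha>" using Suc.prems by (auto simp: unf_path_def)
  have a: "\<alpha> (Suc (Suc p)) \<in> Hom C (u (Suc p)) (u (Suc (Suc p)))"
    using Suc.prems by (auto simp: unf_path_def dest!: bspec[where x = "Suc (Suc p)"])
  have "path_comp C (\<lambda>i. u (Suc i)) (\<lambda>i. \<alpha> (Suc i)) p \<in> Hom C (u (Suc 0)) (u (Suc p))"
    "\<alpha> (Suc 0) \<in> Hom C (u 0) (u (Suc 0))"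
    using p path_comp_Hom[of p "\<lambda>i. u (Suc i)" "\<lambda>i. \<alpha> (Suc i)"] unf_path_Suc[of p u \<alpha>] by auto
  then show ?case using Suc.IH[OF p] a by (auto simp: Hom_iff comp_assoc)
qed

lemma rank_path: "unf_path p u \<alpha> \<Longrightarrow> rank (u p) + p \<le> rank (u 0)"
proof (induction p)
  case (Suc p)
  then have "unf_path p u \<alpha>" "\<alpha> (Suc p) \<in> Hom C (u p) (u (Suc p))" "unfactorizable C (\<alpha> (Suc p))"
    by (auto simp: unf_path_def dest!: bspec[where x = "Suc p"])
  then show ?case using Suc.IH rank_less[of "\<alpha> (Suc p)"] by (auto simp: unfactorizable_iff Hom_iff)
qed simp

lemma decomposition_iff_path:
  assumes "a \<in> Mor C" "\<not> is_iso C a"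
  shows "unfactorizable_decomposition C a p u \<alpha> \<longleftrightarrow>
    unf_path p u \<alpha> \<and> u 0 = Dom C a \<and> u p = Cod C a \<and> path_comp C u \<alpha> p = a"
proof -
  have "p \<ge> 1" if "u 0 = Dom C a" "u p = Cod C a"
    using that assms iso_iff_endo by (cases p) auto
  then show ?thesis
    using assms Dom_closed by (auto simp: unfactorizable_decomposition_def unf_path_def)
qed

lemma unf_path_prepend:
  assumes path: "unf_path p u \<alpha>" "u 0 = Cod C b" and b: "unfactorizable C b"
  defines "u' \<equiv> case_nat (Dom C b) u" and "\<alpha>' \<equiv> \<lambda>i. if i = 1 then b else \<alpha> (i - 1)"
  shows "unf_path (Suc p) u' \<alpha>'" "path_comp C u' \<alpha>' (Suc p) = path_comp C u \<alpha> p \<cdot> b"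
proof -
  have "unf_path p u (\<lambda>i. \<alpha>' (Suc i))"
    using path by (auto simp: unf_path_def \<alpha>'_def)
  then show path': "unf_path (Suc p) u' \<alpha>'"
    using b path Dom_closed by (auto simp: unf_path_Suc Hom_iff unfactorizable_iff u'_def \<alpha>'_def)
  have "path_comp C u (\<lambda>i. \<alpha>' (Suc i)) q = path_comp C u \<alpha> q" if "q \<le> p" for q
    using that by (induction q) (auto simp: \<alpha>'_def)
  then show "path_comp C u' \<alpha>' (Suc p) = path_comp C u \<alpha> p \<cdot> b"
    using path_comp_Suc_shift[OF path'] by (simp add: u'_def \<alpha>'_def)
qed

lemma exists_unf_path:
  assumes "f \<in> Mor C"  "Dom C f \<noteq> Cod C f"
  shows "\<exists>p u \<alpha>. unf_path p u \<alpha> \<and> u 0 = Dom C f \<and> u p = Cod C f \<and> path_comp C u \<alpha> p = f"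
  using assms
proof (induction "rank (Dom C f)" arbitrary: f rule: less_induct)
  case less
  obtain g b where gb: "g \<in> Mor C" "unfactorizable C b" "Cod C b = Dom C g" "f = g \<cdot> b"
    using exists_unfactorizable_factor[OF less.prems] by blast
  have b: "b \<in> Mor C" "Dom C b \<noteq> Cod C b" using gb by (auto simp: unfactorizable_iff)
  show ?case
  proof (cases "Dom C g = Cod C g")
    case True
    then have "unfactorizable C f"
      using unfactorizable_comp_Aut(1)[OF gb(2), of g] gb b
      by (auto simp: Aut_def Hom_iff)
    then show ?thesis
      using less.prems Dom_closed
      by (intro exI[of _ "Suc 0"] exI[of _ "\<lambda>i. if i = 0 then Dom C f else Cod C f"] exI[of _ "\<lambda>_. f"])
        (auto simp: unf_path_def Hom_iff)
  next
    case False
    have "rank (Dom C g) < rank (Dom C f)"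
      using rank_less[OF b] gb b by simp
    from less.hyps[OF this gb(1) False] obtain p u \<alpha> where
      p: "unf_path p u \<alpha>" "u 0 = Dom C g" "u p = Cod C g" "path_comp C u \<alpha> p = g" by blast
    let ?u = "case_nat (Dom C b) u" and ?\<alpha> = "\<lambda>i. if i = 1 then b else \<alpha> (i - 1)"
    have path: "unf_path (Suc p) ?u ?\<alpha>" and "path_comp C ?u ?\<alpha> (Suc p) = f"
      using unf_path_prepend[OF p(1) _ gb(2)] p gb by simp_all
    then show ?thesis
      using path gb b p by (intro exI[of _ "Suc p"] exI[of _ ?u] exI[of _ ?\<alpha>]) auto
  qed
qed

text \<open>The relation between two decompositions in the Unique Factorization Property, written as commuting
  squares without inverses.  The automorphisms at both ends are part of the ladder and arbitrary.\<close>

definition ladder :: "nat \<Rightarrow> (nat \<Rightarrow> 'o) \<Rightarrow> (nat \<Rightarrow> 'm) \<Rightarrow> (nat \<Rightarrow> 'm) \<Rightarrow> (nat \<Rightarrow> 'm) \<Rightarrow> bool" where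
  "ladder p u \<alpha> \<beta> h \<longleftrightarrow> (\<forall>i\<le>p. h i \<in> Aut C (u i)) \<and> (\<forall>i\<in>{1..p}. \<beta> i \<cdot> h (i - 1) = h i \<cdot> \<alpha> i)"

text \<open>The commuting squares of a ladder compose to one square.\<close>

lemma ladder_path_comp:
  assumes "ladder p u \<alpha> \<beta> h" "unf_path p u \<alpha>" "unf_path p u \<beta>"
  shows "path_comp C u \<beta> p \<cdot> h 0 = h p \<cdot> path_comp C u \<alpha> p"
  using assms
proof (induction p)
  case 0
  then show ?case by (simp add: ladder_def Aut_def Hom_iff unf_path_def)
next
  case (Suc p)
  then have lp: "ladder p u \<alpha> \<beta> h" "unf_path p u \<alpha>" "unf_path p u \<beta>"
    by (auto simp: ladder_def unf_path_def)
  have h: "h 0 \<in> Hom C (u 0) (u 0)" "h p \<in> Hom C (u p) (u p)" "h (Suc p) \<in> Hom C (u (Suc p)) (u (Suc p))"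
    using Suc.prems(1) by (auto simp: ladder_def Aut_def)
  have c: "\<beta> (Suc p) \<cdot> h p = h (Suc p) \<cdot> \<alpha> (Suc p)" using Suc.prems(1) by (auto simp: ladder_def dest!: bspec[where x = "Suc p"])
  have ab: "\<alpha> (Suc p) \<in> Hom C (u p) (u (Suc p))" "\<beta> (Suc p) \<in> Hom C (u p) (u (Suc p))"
    using Suc.prems by (auto simp: unf_path_def dest!: bspec[where x = "Suc p"])
  note P = path_comp_Hom[OF lp(2)] path_comp_Hom[OF lp(3)]
  have "path_comp C u \<beta> (Suc p) \<cdot> h 0 = \<beta> (Suc p) \<cdot> (path_comp C u \<beta> p \<cdot> h 0)"
    using h ab P by (auto simp: Hom_iff comp_assoc)
  also have "\<dots> = (\<beta> (Suc p) \<cdot> h p) \<cdot> path_comp C u \<alpha> p"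
    unfolding Suc.IH[OF lp] using h ab P by (auto simp: Hom_iff comp_assoc)
  also have "\<dots> = h (Suc p) \<cdot> path_comp C u \<alpha> (Suc p)"
    unfolding c using h ab P by (auto simp: Hom_iff comp_assoc)
  finally show ?case .
qed

text \<open>Comparing the first factors by two-step uniqueness leaves an automorphism \<open>h\<close> by which the remaining
  composites differ.  The induction therefore has to be about paths that start with a given
  automorphism \<open>g\<close>.\<close>

lemma two_step_unique_paths:
  assumes unique: "\<And>z y. two_step_unique z y"
    and "unf_path p u \<alpha>" "unf_path q v \<beta>" "u 0 = v 0" "g \<in> Aut C (u 0)"
    and "path_comp C v \<beta> q \<cdot> g = path_comp C u \<alpha> p"
  shows "p = q \<and> (\<forall>i\<le>p. u i = v i) \<and> (\<exists>h. ladder p u \<alpha> \<beta> h \<and> h 0 = g \<and> h p = Id C (u p))"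
  using assms(2-)
proof (induction p arbitrary: q u v \<alpha> \<beta> g)
  case 0
  note P = path_comp_Hom[OF 0(1)] path_comp_Hom[OF 0(2)]
  have g: "g \<in> Hom C (u 0) (u 0)" using 0 by (simp add: Aut_def)
  have "v q = u 0" using 0(5) P g 0(3) by (auto simp: Hom_iff) (metis comp_simps(3))
  then have q: "q = 0" using rank_path[OF 0(2)] 0(3) by simp
  then have "g = Id C (u 0)" using 0 g by (auto simp: Hom_iff)
  then show ?case using q 0 by (auto simp: ladder_def Aut_def intro!: exI[of _ "\<lambda>_. g"])
next
  case (Suc p)
  note P = path_comp_Hom[OF Suc.prems(1)] path_comp_Hom[OF Suc.prems(2)]
  have g: "g \<in> Hom C (u 0) (u 0)" using Suc.prems by (simp add: Aut_def)
  have ends: "v q = u (Suc p)" using Suc.prems(5) P g Suc.prems(3) by (auto simp: Hom_iff simp del: path_comp.simps) (metis comp_simps(3))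
  then have "q \<noteq> 0" using rank_path[OF Suc.prems(1)] Suc.prems(3) by (intro notI) auto
  then obtain r where q: "q = Suc r" by (cases q) auto
  let ?u = "\<lambda>i. u (Suc i)" and ?v = "\<lambda>i. v (Suc i)" and ?\<alpha> = "\<lambda>i. \<alpha> (Suc i)" and ?\<beta> = "\<lambda>i. \<beta> (Suc i)"
  have pu: "unf_path p ?u ?\<alpha>" "\<alpha> 1 \<in> Hom C (u 0) (u 1)" "unfactorizable C (\<alpha> 1)"
    and pv: "unf_path r ?v ?\<beta>" "\<beta> 1 \<in> Hom C (v 0) (v 1)" "unfactorizable C (\<beta> 1)"
    using Suc.prems(1,2) q by (auto simp: unf_path_Suc)
  note P' = path_comp_Hom[OF pu(1)] path_comp_Hom[OF pv(1)]
  have b1: "\<beta> 1 \<cdot> g \<in> Hom C (u 0) (v 1)" "unfactorizable C (\<beta> 1 \<cdot> g)"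
    using g pv Suc.prems(3,4) unfactorizable_comp_Aut(2)[OF pv(3), of g]
    by (auto simp: Hom_iff Aut_def)
  have "path_comp C ?u ?\<alpha> p \<cdot> \<alpha> 1 = path_comp C u \<alpha> (Suc p)"
    by (rule path_comp_Suc_shift[OF Suc.prems(1), symmetric])
  also have "\<dots> = (path_comp C ?v ?\<beta> r \<cdot> \<beta> 1) \<cdot> g"
    using Suc.prems(5) path_comp_Suc_shift[of r v \<beta>] Suc.prems(2) q by simp
  also have "\<dots> = path_comp C ?v ?\<beta> r \<cdot> (\<beta> 1 \<cdot> g)"
    using P' pv g Suc.prems(3) by (auto simp: Hom_iff comp_assoc)
  finally have eq: "path_comp C ?u ?\<alpha> p \<cdot> \<alpha> 1 = path_comp C ?v ?\<beta> r \<cdot> (\<beta> 1 \<cdot> g)" .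
  have "equiv_factorizations (path_comp C ?u ?\<alpha> p) (\<alpha> 1) (path_comp C ?v ?\<beta> r) (\<beta> 1 \<cdot> g)"
    using unique[of "u 0" "u (Suc p)"] eq P' pu pv b1 ends q
    unfolding two_step_unique_def by (auto simp: Hom_iff)
  then obtain h where h: "u 1 = v 1" "h \<in> Aut C (u 1)" "\<beta> 1 \<cdot> g = h \<cdot> \<alpha> 1"
    "path_comp C ?u ?\<alpha> p = path_comp C ?v ?\<beta> r \<cdot> h"
    using pu b1 unfolding equiv_factorizations_def by (auto simp: Hom_iff)
  have "p = r \<and> (\<forall>i\<le>p. ?u i = ?v i) \<and> (\<exists>h'. ladder p ?u ?\<alpha> ?\<beta> h' \<and> h' 0 = h \<and> h' p = Id C (?u p))"
    by (rule Suc.IH[OF pu(1) pv(1)]) (use h in \<open>simp_all only: One_nat_def\<close>)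
  then obtain h' where h': "p = r" "\<And>i. i \<le> p \<Longrightarrow> ?u i = ?v i" "ladder p ?u ?\<alpha> ?\<beta> h'" "h' 0 = h"
    "h' p = Id C (?u p)" by blast
  have "ladder (Suc p) u \<alpha> \<beta> (case_nat g h')"
    unfolding ladder_def
  proof (intro conjI allI ballI impI)
    fix i assume "i \<le> Suc p"
    then show "(case i of 0 \<Rightarrow> g | Suc x \<Rightarrow> h' x) \<in> Aut C (u i)"
      using h'(3) Suc.prems(4) by (cases i) (auto simp: ladder_def)
  next
    fix i assume i: "i \<in> {1..Suc p}"
    show "\<beta> i \<cdot> (case i - 1 of 0 \<Rightarrow> g | Suc x \<Rightarrow> h' x) = (case i of 0 \<Rightarrow> g | Suc x \<Rightarrow> h' x) \<cdot> \<alpha> i"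
    proof (cases "i = 1")
      case True
      then show ?thesis using h h' by simp
    next
      case False
      then obtain j where j: "i = Suc (Suc j)" "Suc j \<in> {1..p}" using i by (cases i; cases "i - 1") auto
      then have "\<beta> (Suc (Suc j)) \<cdot> h' (Suc j - 1) = h' (Suc j) \<cdot> \<alpha> (Suc (Suc j))"
        using h'(3) unfolding ladder_def by blast
      then show ?thesis using j by simp
    qed
  qed
  moreover have "u i = v i" if "i \<le> Suc p" for i
    using h'(2)[of "i - 1"] Suc.prems(3) that by (cases i) simp_all
  ultimately show ?case
    using q h'(1,5) by (intro conjI allI impI exI[of _ "case_nat g h'"]) simp_all
qed

text \<open>Ladders that are trivial at both ends, in the notation with conjugating automorphisms.  Their
  automorphisms at the ends are identities, which accounts for the special first and last equations.\<close>

lemma ladder_iff_conjugate: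
  assumes p: "1 \<le> p" and \<alpha>: "unf_path p u \<alpha>" and \<beta>: "unf_path p u \<beta>"
  shows "(\<exists>h. ladder p u \<alpha> \<beta> h \<and> h 0 = Id C (u 0) \<and> h p = Id C (u p)) \<longleftrightarrow>
    (\<exists>h. (\<forall>i\<in>{1..p - 1}. h i \<in> Aut C (u i)) \<and>
       (if p = 1 then \<beta> 1 = \<alpha> 1
        else \<beta> 1 = h 1 \<cdot> \<alpha> 1 \<and>
             (\<forall>i\<in>{2..p - 1}. \<beta> i = h i \<cdot> \<alpha> i \<cdot> inverse_mor C (h (i - 1))) \<and>
             \<beta> p = \<alpha> p \<cdot> inverse_mor C (h (p - 1))))"
    (is "?L \<longleftrightarrow> (\<exists>h. ?R h)")
proof -
  have ab: "\<alpha> i \<in> Hom C (u (i - 1)) (u i)" "\<beta> i \<in> Hom C (u (i - 1)) (u i)" if "i \<in> {1..p}" for i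
    using \<alpha> \<beta> that by (auto simp: unf_path_def)
  have u: "u i \<in> Obj C" if "i \<le> p" for i
  proof (cases "i = 0")
    case True
    then show ?thesis using \<alpha> by (simp add: unf_path_def)
  next
    case False
    then show ?thesis using ab(1)[of i] that Cod_closed[of "\<alpha> i"] by (simp add: Hom_iff)
  qed
  have conj: "b \<cdot> h = c \<longleftrightarrow> b = c \<cdot> inverse_mor C h"
    if "h \<in> Aut C a" "b \<in> Mor C" "c \<in> Mor C" "Dom C b = a" "Dom C c = a" for a b c h
  proof -
    have "(b \<cdot> h) \<cdot> inverse_mor C h = b" "(c \<cdot> inverse_mor C h) \<cdot> h = c"
      using that Aut_inverse[OF that(1)] by (auto simp: Aut_def Hom_iff comp_assoc)
    then show ?thesis by auto
  qed
  show ?thesis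
  proof
    assume ?L
    then obtain h where h: "ladder p u \<alpha> \<beta> h" "h 0 = Id C (u 0)" "h p = Id C (u p)" by blast
    have hA: "h i \<in> Aut C (u i)" if "i \<le> p" for i using h that by (auto simp: ladder_def)
    have e: "\<beta> i \<cdot> h (i - 1) = h i \<cdot> \<alpha> i" if "i \<in> {1..p}" for i using h that by (auto simp: ladder_def)
    have step: "\<beta> i = (h i \<cdot> \<alpha> i) \<cdot> inverse_mor C (h (i - 1))" if i: "i \<in> {1..p}" for i
      using e[OF i] conj[of "h (i - 1)" "u (i - 1)" "\<beta> i" "h i \<cdot> \<alpha> i"] hA[of i] hA[of "i - 1"] ab[OF i] i
      by (auto simp: Aut_def Hom_iff)
    have one: "\<beta> 1 = h 1 \<cdot> \<alpha> 1" using e[of 1] h(2) ab[of 1] p by (simp add: Hom_iff)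
    have inv: "inverse_mor C (h i) \<in> Hom C (u i) (u i)" if "i \<le> p" for i
      using Aut_inverse(1)[OF hA[OF that]] by (simp add: Aut_def)
    have "\<beta> i = h i \<cdot> \<alpha> i \<cdot> inverse_mor C (h (i - 1))" if i: "i \<in> {1..p}" for i
      using step[OF i] hA[of i] ab[OF i] inv[of "i - 1"] i by (auto simp: Aut_def Hom_iff comp_assoc)
    moreover have "\<beta> p = \<alpha> p \<cdot> inverse_mor C (h (p - 1))"
      using step[of p] p h(3) ab[of p] by (simp add: Hom_iff)
    moreover have "p = 1 \<Longrightarrow> \<beta> 1 = \<alpha> 1" using one h(3) ab[of 1] by (simp add: Hom_iff)
    ultimately have "?R h" using hA one p by (auto simp: if_splits)
    then show "\<exists>h. ?R h" by blast
  next
    assume "\<exists>h. ?R h"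
    then obtain h where R: "?R h" by blast
    define h' where "h' i = (if i \<in> {1..p - 1} then h i else Id C (u i))" for i
    have hA: "h' i \<in> Aut C (u i)" if "i \<le> p" for i
      using R u[OF that] by (auto simp: h'_def Aut_def Hom_iff)
    have "\<beta> i \<cdot> h' (i - 1) = h' i \<cdot> \<alpha> i" if i: "i \<in> {1..p}" for i
    proof (cases "i = 1")
      case True
      then show ?thesis using R ab[OF i] p u[of 0] by (auto simp: h'_def Hom_iff split: if_splits)
    next
      case False
      then have i2: "i \<ge> 2" "p \<noteq> 1" using i by auto
      have h1: "h' (i - 1) = h (i - 1)" using i i2 by (auto simp: h'_def)
      have inv: "inverse_mor C (h (i - 1)) \<in> Hom C (u (i - 1)) (u (i - 1))"
        using Aut_inverse(1)[OF hA[of "i - 1"]] i h1 by (auto simp: Aut_def)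
      have "\<beta> i = h' i \<cdot> \<alpha> i \<cdot> inverse_mor C (h (i - 1))"
      proof (cases "i = p")
        case True
        then have "h' i = Id C (u i)" using p by (auto simp: h'_def)
        then show ?thesis using R i2 True ab[OF i] inv by (auto simp: Hom_iff)
      next
        case False
        then show ?thesis using R i2 i by (auto simp: h'_def)
      qed
      then have "\<beta> i = (h' i \<cdot> \<alpha> i) \<cdot> inverse_mor C (h' (i - 1))"
        using ab[OF i] inv hA[of i] i h1 by (auto simp: Aut_def Hom_iff comp_assoc)
      then show ?thesis
        using conj[of "h' (i - 1)" "u (i - 1)" "\<beta> i" "h' i \<cdot> \<alpha> i"] hA[of i] hA[of "i - 1"] ab[OF i] i
        by (auto simp: Aut_def Hom_iff)
    qed
    then have "ladder p u \<alpha> \<beta> h'" using hA by (auto simp: ladder_def)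
    then show ?L using p by (intro exI[of _ h']) (auto simp: h'_def)
  qed
qed

theorem free_category_iff_ladder:
  "free_category C \<longleftrightarrow>
    (\<forall>p q u v \<alpha> \<beta>. unf_path p u \<alpha> \<and> unf_path q v \<beta> \<and> u 0 = v 0 \<and>
       path_comp C u \<alpha> p = path_comp C v \<beta> q \<longrightarrow>
       p = q \<and> (\<forall>i\<le>p. u i = v i) \<and> (\<exists>h. ladder p u \<alpha> \<beta> h \<and> h 0 = Id C (u 0) \<and> h p = Id C (u p)))"
    (is "?L \<longleftrightarrow> ?R")
proof
  assume L: ?L
  show ?R
  proof (intro allI impI)
    fix p q u v \<alpha> \<beta>
    assume A: "unf_path p u \<alpha> \<and> unf_path q v \<beta> \<and> u 0 = v 0 \<and> path_comp C u \<alpha> p = path_comp C v \<beta> q"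
    let ?a = "path_comp C u \<alpha> p"
    have a: "?a \<in> Hom C (u 0) (u p)" "?a \<in> Hom C (v 0) (v q)"
      using A path_comp_Hom[of p u \<alpha>] path_comp_Hom[of q v \<beta>] by auto
    then have e: "u p = v q" by (auto simp: Hom_iff)
    show "p = q \<and> (\<forall>i\<le>p. u i = v i) \<and> (\<exists>h. ladder p u \<alpha> \<beta> h \<and> h 0 = Id C (u 0) \<and> h p = Id C (u p))"
    proof (cases "u 0 = u p")
      case True
      then have "p = 0" "q = 0" using A e rank_path[of p u \<alpha>] rank_path[of q v \<beta>] by auto
      then show ?thesis
        using A by (auto simp: ladder_def Aut_def unf_path_def Hom_iff intro!: exI[of _ "\<lambda>_. Id C (u 0)"])
    next
      case False
      then have ni: "?a \<in> Mor C" "\<not> is_iso C ?a" using a iso_iff_endo by (auto simp: Hom_iff)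
      have "unfactorizable_decomposition C ?a p u \<alpha>" "unfactorizable_decomposition C ?a q v \<beta>"
        using A a unfolding decomposition_iff_path[OF ni] by (auto simp: Hom_iff)
      with ni have concl: "p = q \<and> (\<forall>i\<in>{0..p}. u i = v i) \<and>
        (\<exists>h. (\<forall>i\<in>{1..q - 1}. h i \<in> Aut C (u i)) \<and>
           (if q = 1 then \<beta> 1 = \<alpha> 1
            else \<beta> 1 = h 1 \<cdot> \<alpha> 1 \<and>
                 (\<forall>i\<in>{2..q - 1}. \<beta> i = h i \<cdot> \<alpha> i \<cdot> inverse_mor C (h (i - 1))) \<and>
                 \<beta> q = \<alpha> q \<cdot> inverse_mor C (h (q - 1))))"
        by (intro L[unfolded free_category_def, rule_format, of ?a p u \<alpha> q v \<beta>] conjI)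
      note pq = conjunct1[OF concl] and uv = conjunct1[OF conjunct2[OF concl]]
        and h = conjunct2[OF conjunct2[OF concl]]
      have p1: "1 \<le> p" using False by (cases p) auto
      have "unf_path p u \<alpha>" "unf_path p u \<beta>" using A pq uv by (auto simp: unf_path_def)
      from iffD2[OF ladder_iff_conjugate[OF p1 this] h[folded pq]]
      show ?thesis using pq uv by auto
    qed
  qed
next
  assume R: ?R
  show ?L
    unfolding free_category_def
  proof (intro ballI allI impI)
    fix a p q u v \<alpha> \<beta>
    assume a: "a \<in> Mor C"
      and A: "\<not> is_iso C a \<and> unfactorizable_decomposition C a p u \<alpha> \<and> unfactorizable_decomposition C a q v \<beta>"
    then have paths: "unf_path p u \<alpha>" "unf_path q v \<beta>" "u 0 = v 0" "path_comp C u \<alpha> p = path_comp C v \<beta> q"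
      by (auto simp: decomposition_iff_path)
    have p1: "1 \<le> p" using A by (simp add: unfactorizable_decomposition_def)
    have L: "p = q" "\<forall>i\<le>p. u i = v i" "\<exists>h. ladder p u \<alpha> \<beta> h \<and> h 0 = Id C (u 0) \<and> h p = Id C (u p)"
      using R[rule_format, of p u \<alpha> q v \<beta>] paths by blast+
    then have p\<beta>: "unf_path p u \<beta>" using paths by (auto simp: unf_path_def)
    show "p = q \<and> (\<forall>i\<in>{0..p}. u i = v i) \<and>
      (\<exists>h. (\<forall>i\<in>{1..q - 1}. h i \<in> Aut C (u i)) \<and>
           (if q = 1 then \<beta> 1 = \<alpha> 1
            else \<beta> 1 = h 1 \<cdot> \<alpha> 1 \<and>
                 (\<forall>i\<in>{2..q - 1}. \<beta> i = h i \<cdot> \<alpha> i \<cdot> inverse_mor C (h (i - 1))) \<and>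
                 \<beta> q = \<alpha> q \<cdot> inverse_mor C (h (q - 1))))"
      using iffD1[OF ladder_iff_conjugate[OF p1 paths(1) p\<beta>] L(3)] L(1,2)
      by (intro conjI) (simp_all only: atLeastAtMost_iff, simp)
  qed
qed

text \<open>For the forward direction, decompose \<open>g\<close> and \<open>g'\<close> and prepend \<open>b\<close> and \<open>b'\<close>.  The first square of the
  ladder between the two paths compares \<open>b\<close> with \<open>b'\<close>, and the rest of it composes to
  \<open>g = g' \<cdot> h\<close>.\<close>

theorem free_category_iff_two_step_unique:
  "free_category C \<longleftrightarrow> (\<forall>z y. two_step_unique z y)"
proof
  assume "\<forall>z y. two_step_unique z y"
  then have unique: "\<And>z y. two_step_unique z y" by blast
  show "free_category C"
    unfolding free_category_iff_ladder
  proof (intro allI impI)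
    fix p q u v \<alpha> \<beta>
    assume A: "unf_path p u \<alpha> \<and> unf_path q v \<beta> \<and> u 0 = v 0 \<and> path_comp C u \<alpha> p = path_comp C v \<beta> q"
    then have "path_comp C v \<beta> q \<in> Hom C (u 0) (v q)" "u 0 \<in> Obj C"
      using path_comp_Hom[of q v \<beta>] by (auto simp: unf_path_def)
    then show "p = q \<and> (\<forall>i\<le>p. u i = v i) \<and>
        (\<exists>h. ladder p u \<alpha> \<beta> h \<and> h 0 = Id C (u 0) \<and> h p = Id C (u p))"
      using two_step_unique_paths[OF unique, of p u \<alpha> q v \<beta> "Id C (u 0)"] A
      by (auto simp: Aut_def Hom_iff)
  qed
next
  assume F: "free_category C"
  have "equiv_factorizations g b g' b'"
    if g: "g \<in> Hom C (Cod C b) y" and b: "unfactorizable C b"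
      and g': "g' \<in> Hom C (Cod C b') y" and b': "unfactorizable C b'" and D: "Dom C b' = Dom C b"
      and eq: "g \<cdot> b = g' \<cdot> b'" for g b g' b' y
  proof -
    have bM: "b \<in> Mor C" "Dom C b \<noteq> Cod C b" "b' \<in> Mor C" "Dom C b' \<noteq> Cod C b'"
      using b b' by (auto simp: unfactorizable_iff)
    have gM: "g \<in> Mor C" "Dom C g = Cod C b" "Cod C g = y" "g' \<in> Mor C" "Dom C g' = Cod C b'" "Cod C g' = y"
      using g g' by (auto simp: Hom_iff)
    show ?thesis
    proof (cases "Cod C b = y \<or> Cod C b' = y")
      case True
      then show ?thesis by (rule equiv_factorizations_of_Aut[OF g b g' b' eq])
    next
      case False
      then have ne: "Dom C g \<noteq> Cod C g" "Dom C g' \<noteq> Cod C g'" using gM by auto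
      obtain p u \<alpha> where p: "unf_path p u \<alpha>" "u 0 = Dom C g" "u p = Cod C g" "path_comp C u \<alpha> p = g"
        using exists_unf_path[OF gM(1) ne(1)] by blast
      obtain q v \<beta> where q: "unf_path q v \<beta>" "v 0 = Dom C g'" "v q = Cod C g'" "path_comp C v \<beta> q = g'"
        using exists_unf_path[OF gM(4) ne(2)] by blast
      let ?u = "case_nat (Dom C b) u" and ?\<alpha> = "\<lambda>i. if i = 1 then b else \<alpha> (i - 1)"
      let ?v = "case_nat (Dom C b') v" and ?\<beta> = "\<lambda>i. if i = 1 then b' else \<beta> (i - 1)"
      have ab: "unf_path (Suc p) ?u ?\<alpha>" "path_comp C ?u ?\<alpha> (Suc p) = g \<cdot> b"
        "unf_path (Suc q) ?v ?\<beta>" "path_comp C ?v ?\<beta> (Suc q) = g' \<cdot> b'"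
        using unf_path_prepend[OF p(1) _ b] unf_path_prepend[OF q(1) _ b'] p q gM by simp_all
      have "Suc p = Suc q \<and> (\<forall>i\<le>Suc p. ?u i = ?v i) \<and>
          (\<exists>h. ladder (Suc p) ?u ?\<alpha> ?\<beta> h \<and> h 0 = Id C (?u 0) \<and> h (Suc p) = Id C (?u (Suc p)))"
        by (rule F[unfolded free_category_iff_ladder, rule_format]) (use ab eq D in auto)
      then obtain h where pq: "p = q" and uv: "\<And>i. i \<le> Suc p \<Longrightarrow> ?u i = ?v i"
        and h: "ladder (Suc p) ?u ?\<alpha> ?\<beta> h" "h 0 = Id C (?u 0)" "h (Suc p) = Id C (?u (Suc p))"
        by blast
      have u_v: "u i = v i" if "i \<le> p" for i using uv[of "Suc i"] that by simp
      have lad: "ladder p u \<alpha> \<beta> (\<lambda>i. h (Suc i))"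
        unfolding ladder_def
      proof (intro conjI allI impI ballI)
        show "h (Suc i) \<in> Aut C (u i)" if "i \<le> p" for i
          using h(1) that unfolding ladder_def by (auto dest!: spec[where x = "Suc i"])
        show "\<beta> i \<cdot> h (Suc (i - 1)) = h (Suc i) \<cdot> \<alpha> i" if "i \<in> {1..p}" for i
          using h(1) that unfolding ladder_def by (auto dest!: bspec[where x = "Suc i"])
      qed
      have q': "unf_path p u \<beta>" using q(1) u_v pq by (auto simp: unf_path_def)
      have "path_comp C u \<beta> r = path_comp C v \<beta> r" if "r \<le> p" for r
        using that u_v by (induction r) auto
      then have "g' \<cdot> h 1 = g"
        using ladder_path_comp[OF lad p(1) q'] p q pq h(3) gM by simp
      moreover have "b' \<cdot> h 0 = h 1 \<cdot> b" using h(1) unfolding ladder_def by (auto dest!: bspec[where x = 1])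
      then have "b' = h 1 \<cdot> b" using h(2) D bM by simp
      moreover have "h 1 \<in> Aut C (Cod C b)" using lad p gM unfolding ladder_def by auto
      moreover have "Cod C b = Cod C b'" using u_v[of 0] p q gM by simp
      ultimately show ?thesis by (auto simp: equiv_factorizations_def)
    qed
  qed
  then show "\<forall>z y. two_step_unique z y" by (auto simp: two_step_unique_def)
qed

end

section \<open>Linearized composition\<close>

context directed_EI_category
begin

lemma conv_eq_sum:
  "conv C f g m = (\<Sum>c\<in>Mor C. \<Sum>b\<in>Mor C. if Cod C b = Dom C c \<and> c \<cdot> b = m then f c * g b else 0)"
proof -
  have "conv C f g m =
      (\<Sum>(c, b)\<in>{p \<in> Mor C \<times> Mor C. case p of (c, b) \<Rightarrow> Cod C b = Dom C c \<and> c \<cdot> b = m}. f c * g b)"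
    unfolding conv_def by (rule sum.cong) auto
  also have "\<dots> = (\<Sum>p\<in>Mor C \<times> Mor C.
      if (case p of (c, b) \<Rightarrow> Cod C b = Dom C c \<and> c \<cdot> b = m) then (case p of (c, b) \<Rightarrow> f c * g b) else 0)"
    by (rule sum.inter_filter) simp
  also have "\<dots> = (\<Sum>p\<in>Mor C \<times> Mor C.
      case p of (c, b) \<Rightarrow> if Cod C b = Dom C c \<and> c \<cdot> b = m then f c * g b else 0)"
    by (rule sum.cong) (auto split: prod.splits)
  finally show ?thesis by (simp add: sum.cartesian_product)
qed

text \<open>\<open>conv\<close> pushes the product measure on composable pairs forward along composition; \<open>\<Phi>\<close> is the function
  being integrated.\<close>

lemma sum_conv:
  "(\<Sum>m\<in>Mor C. conv C f g m * \<Phi> m) =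
    (\<Sum>c\<in>Mor C. \<Sum>b\<in>Mor C. if Cod C b = Dom C c then f c * g b * \<Phi> (c \<cdot> b) else 0)"
proof -
  have "(\<Sum>m\<in>Mor C. conv C f g m * \<Phi> m) =
      (\<Sum>m\<in>Mor C. \<Sum>c\<in>Mor C. \<Sum>b\<in>Mor C.
        (if Cod C b = Dom C c \<and> c \<cdot> b = m then f c * g b else 0) * \<Phi> m)"
    by (simp add: conv_eq_sum sum_distrib_right)
  also have "\<dots> = (\<Sum>c\<in>Mor C. \<Sum>m\<in>Mor C. \<Sum>b\<in>Mor C.
        (if Cod C b = Dom C c \<and> c \<cdot> b = m then f c * g b else 0) * \<Phi> m)"
    by (rule sum.swap)
  also have "\<dots> = (\<Sum>c\<in>Mor C. \<Sum>b\<in>Mor C. \<Sum>m\<in>Mor C.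
        (if Cod C b = Dom C c \<and> c \<cdot> b = m then f c * g b else 0) * \<Phi> m)"
    by (intro sum.cong refl sum.swap)
  also have "\<dots> = (\<Sum>c\<in>Mor C. \<Sum>b\<in>Mor C. if Cod C b = Dom C c then f c * g b * \<Phi> (c \<cdot> b) else 0)"
  proof (intro sum.cong refl)
    fix c b assume cb: "c \<in> Mor C" "b \<in> Mor C"
    have "(\<Sum>m\<in>Mor C. (if Cod C b = Dom C c \<and> c \<cdot> b = m then f c * g b else 0) * \<Phi> m) =
        (\<Sum>m\<in>Mor C. if c \<cdot> b = m then (if Cod C b = Dom C c then f c * g b * \<Phi> m else 0) else 0)"
      by (rule sum.cong) auto
    then show "(\<Sum>m\<in>Mor C. (if Cod C b = Dom C c \<and> c \<cdot> b = m then f c * g b else 0) * \<Phi> m) =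
        (if Cod C b = Dom C c then f c * g b * \<Phi> (c \<cdot> b) else 0)"
      using cb by (auto simp: sum.delta')
  qed
  finally show ?thesis .
qed

lemma conv_assoc: "conv C (conv C f g) h = conv C f (conv C g h)"
proof
  fix m
  have "conv C (conv C f g) h m =
      (\<Sum>b\<in>Mor C. \<Sum>e\<in>Mor C. conv C f g e * (if Cod C b = Dom C e \<and> e \<cdot> b = m then h b else 0))"
    by (subst sum.swap, subst conv_eq_sum) (intro sum.cong, auto)
  also have "\<dots> = (\<Sum>b\<in>Mor C. \<Sum>c\<in>Mor C. \<Sum>d\<in>Mor C. if Cod C d = Dom C c then
      f c * g d * (if Cod C b = Dom C (c \<cdot> d) \<and> (c \<cdot> d) \<cdot> b = m then h b else 0) else 0)"
    by (simp only: sum_conv)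
  also have "\<dots> = (\<Sum>c\<in>Mor C. \<Sum>d\<in>Mor C. \<Sum>b\<in>Mor C. if Cod C d = Dom C c then
      f c * g d * (if Cod C b = Dom C (c \<cdot> d) \<and> (c \<cdot> d) \<cdot> b = m then h b else 0) else 0)"
    by (subst sum.swap) (intro sum.cong refl sum.swap)
  also have "\<dots> = (\<Sum>c\<in>Mor C. \<Sum>d\<in>Mor C. \<Sum>b\<in>Mor C. if Cod C b = Dom C d then
      g d * h b * (if Cod C (d \<cdot> b) = Dom C c \<and> c \<cdot> (d \<cdot> b) = m then f c else 0) else 0)"
    by (intro sum.cong refl) (auto simp: comp_assoc)
  also have "\<dots> = (\<Sum>c\<in>Mor C. \<Sum>e\<in>Mor C. conv C g h e * (if Cod C e = Dom C c \<and> c \<cdot> e = m then f c else 0))"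
    by (simp only: sum_conv)
  also have "\<dots> = conv C f (conv C g h) m"
    by (subst (2) conv_eq_sum) (intro sum.cong refl, auto)
  finally show "conv C (conv C f g) h m = conv C f (conv C g h) m" .
qed

lemma conv_add_left: "conv C (\<lambda>m. f m + f' m) g m = conv C f g m + conv C f' g m"
  unfolding conv_eq_sum sum.distrib[symmetric] by (intro sum.cong refl) (auto simp: algebra_simps)

lemma conv_add_right: "conv C f (\<lambda>m. g m + g' m) m = conv C f g m + conv C f g' m"
  unfolding conv_eq_sum sum.distrib[symmetric] by (intro sum.cong refl) (auto simp: algebra_simps)

lemma conv_zero [simp]: "conv C (\<lambda>_. 0) g = (\<lambda>_. 0)" "conv C f (\<lambda>_. 0) = (\<lambda>_. 0)"
  by (auto simp: fun_eq_iff conv_eq_sum intro!: sum.neutral)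

lemma conv_scale_left: "conv C (\<lambda>m. a * f m) g m = a * conv C f g m"
  unfolding conv_eq_sum sum_distrib_left by (intro sum.cong refl) auto

lemma conv_scale_right: "conv C f (\<lambda>m. a * g m) m = a * conv C f g m"
  unfolding conv_eq_sum sum_distrib_left by (intro sum.cong refl) auto

lemma conv_sum_left: "conv C (\<lambda>m. \<Sum>s\<in>S. f s m) g m = (\<Sum>s\<in>S. conv C (f s) g m)"
  by (induction S rule: infinite_finite_induct) (simp_all add: conv_add_left)

lemma conv_sum_right: "conv C f (\<lambda>m. \<Sum>s\<in>S. g s m) m = (\<Sum>s\<in>S. conv C f (g s) m)"
  by (induction S rule: infinite_finite_induct) (simp_all add: conv_add_right)

lemma conv_kHom:
  assumes "f \<in> kHom C b c" "g \<in> kHom C a b"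
  shows "conv C f g \<in> kHom C a c"
  unfolding kHom_def mem_Collect_eq
proof (intro allI impI)
  fix m assume "m \<notin> Hom C a c"
  then have "(if Cod C d = Dom C e \<and> e \<cdot> d = m then f e * g d else 0) = 0"
    if "e \<in> Mor C" "d \<in> Mor C" for e d
    using assms that by (auto simp: kHom_def Hom_iff)
  then show "conv C f g m = 0" by (simp add: conv_eq_sum)
qed

lemma conv_basis:
  assumes "c \<in> Mor C" "b \<in> Mor C" "Cod C b = Dom C c"
  shows "conv C (basis_mor c) (basis_mor b) = basis_mor (c \<cdot> b)"
proof
  fix m
  have "conv C (basis_mor c) (basis_mor b) m = (\<Sum>c'\<in>Mor C. \<Sum>b'\<in>Mor C. if b' = b then
      (if c' = c \<and> c \<cdot> b = m then 1 else 0) else 0)"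
    unfolding conv_eq_sum by (intro sum.cong refl) (use assms in \<open>auto simp: basis_mor_def\<close>)
  also have "\<dots> = (\<Sum>c'\<in>Mor C. if c' = c then (if c \<cdot> b = m then 1 else 0) else 0)"
    using assms by (intro sum.cong refl) (simp add: sum.delta)
  also have "\<dots> = basis_mor (c \<cdot> b) m" using assms by (auto simp: sum.delta basis_mor_def)
  finally show "conv C (basis_mor c) (basis_mor b) m = basis_mor (c \<cdot> b) m" .
qed

lemma basis_mor_kHom: "basis_mor m \<in> kHom C a b \<longleftrightarrow> m \<in> Hom C a b"
  by (auto simp: basis_mor_def kHom_def)

lemma kHom_expand:
  assumes "f \<in> kHom C a b"
  shows "f = (\<lambda>m. \<Sum>d\<in>Mor C. f d * basis_mor d m)"
proof
  fix m
  have "(\<Sum>d\<in>Mor C. f d * basis_mor d m) = (\<Sum>d\<in>Mor C. if m = d then f m else 0)"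
    by (intro sum.cong refl) (auto simp: basis_mor_def)
  also have "\<dots> = f m" using assms by (auto simp: sum.delta' kHom_def Hom_iff)
  finally show "f m = (\<Sum>d\<in>Mor C. f d * basis_mor d m)" ..
qed

lemma conv_Id:
  assumes "f \<in> kHom C a b" "a \<in> Obj C" "b \<in> Obj C"
  shows "conv C (basis_mor (Id C b)) f = f" "conv C f (basis_mor (Id C a)) = f"
proof -
  have sup: "f d = 0" if "d \<notin> Hom C a b" for d using assms that by (auto simp: kHom_def)
  have l: "f d * conv C (basis_mor (Id C b)) (basis_mor d) m = f d * basis_mor d m" for d m
    using sup[of d] assms by (cases "d \<in> Hom C a b") (auto simp: Hom_iff conv_basis)
  have r: "f d * conv C (basis_mor d) (basis_mor (Id C a)) m = f d * basis_mor d m" for d m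
    using sup[of d] assms by (cases "d \<in> Hom C a b") (auto simp: Hom_iff conv_basis)
  show "conv C (basis_mor (Id C b)) f = f"
  proof
    fix m
    have "conv C (basis_mor (Id C b)) f m = (\<Sum>d\<in>Mor C. f d * basis_mor d m)"
      by (subst kHom_expand[OF assms(1)]) (simp add: conv_sum_right conv_scale_right l)
    then show "conv C (basis_mor (Id C b)) f m = f m" using kHom_expand[OF assms(1)] by metis
  qed
  show "conv C f (basis_mor (Id C a)) = f"
  proof
    fix m
    have "conv C f (basis_mor (Id C a)) m = (\<Sum>d\<in>Mor C. f d * basis_mor d m)"
      by (subst kHom_expand[OF assms(1)]) (simp add: conv_sum_left conv_scale_left r)
    then show "conv C f (basis_mor (Id C a)) m = f m" using kHom_expand[OF assms(1)] by metis
  qed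
qed

lemma kHom_0 [simp]: "(\<lambda>_. 0) \<in> kHom C a b" by (simp add: kHom_def)

lemma kHom_sum: "(\<And>s. s \<in> S \<Longrightarrow> f s \<in> kHom C a b) \<Longrightarrow> (\<lambda>m. \<Sum>s\<in>S. f s m) \<in> kHom C a b"
  by (simp add: kHom_def)

lemma kHom_scale: "f \<in> kHom C a b \<Longrightarrow> (\<lambda>m. r * f m) \<in> kHom C a b"
  by (simp add: kHom_def)

section \<open>The triangular matrix algebra and its column modules\<close>

lemma zero_or_kHom:
  "(if P then f \<in> kHom C a b else f = (\<lambda>_. 0)) \<longleftrightarrow> f \<in> kHom C a b \<and> (\<not> P \<longrightarrow> f = (\<lambda>_. 0))"
  by auto

lemma Gamma_carrier:
  "A \<in> carrier (Gamma C x t) \<longleftrightarrow>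
    (\<forall>i j. A i j \<in> kHom C (x j) (x i) \<and> (\<not> (1 \<le> i \<and> i \<le> j \<and> j \<le> t) \<longrightarrow> A i j = (\<lambda>_. 0)))"
  by (simp only: Gamma_def partial_object.simps mem_Collect_eq zero_or_kHom)

lemma Mstar_carrier:
  "v \<in> carrier (Mstar C x t) \<longleftrightarrow>
    (\<forall>i. v i \<in> kHom C (x (t + 1)) (x i) \<and> (i \<notin> {1..t} \<longrightarrow> v i = (\<lambda>_. 0)))"
  by (simp only: Mstar_def partial_object.simps mem_Collect_eq zero_or_kHom)

lemma Gamma_ring:
  assumes t: "t \<le> n"
  shows "ring (Gamma C x t :: (nat \<Rightarrow> nat \<Rightarrow> 'm \<Rightarrow> 'k::field) ring)"
proof (rule ringI)
  let ?G = "Gamma C x t :: (nat \<Rightarrow> nat \<Rightarrow> 'm \<Rightarrow> 'k) ring"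
  show "abelian_group ?G"
  proof (rule abelian_groupI, goal_cases)
    case (1 A B)
    then show ?case unfolding Gamma_carrier by (auto simp: Gamma_def kHom_def)
  next
    case 2
    show ?case unfolding Gamma_carrier by (auto simp: Gamma_def)
  next
    case (6 A)
    have "(\<lambda>i j m. - A i j m) \<in> carrier ?G" using 6 unfolding Gamma_carrier by (auto simp: kHom_def)
    moreover have "(\<lambda>i j m. - A i j m) \<oplus>\<^bsub>?G\<^esub> A = \<zero>\<^bsub>?G\<^esub>" by (simp add: Gamma_def)
    ultimately show ?case by blast
  qed (simp_all add: Gamma_def algebra_simps)
  have mult: "(A \<otimes>\<^bsub>?G\<^esub> B) i j = (\<lambda>m. \<Sum>l\<in>{1..t}. conv C (A i l) (B l j) m)" for A B i j
    by (simp add: Gamma_def)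
  have one: "\<one>\<^bsub>?G\<^esub> i j = (if i = j \<and> i \<in> {1..t} then basis_mor (Id C (x i)) else (\<lambda>_. 0))" for i j
    by (simp add: Gamma_def)
  have onec: "\<one>\<^bsub>?G\<^esub> \<in> carrier ?G"
    unfolding Gamma_carrier using t by (auto simp: one basis_mor_kHom Hom_iff)
  have clos: "A \<otimes>\<^bsub>?G\<^esub> B \<in> carrier ?G" if "A \<in> carrier ?G" "B \<in> carrier ?G" for A B
    unfolding Gamma_carrier
  proof (intro allI conjI impI)
    fix i j
    show "(A \<otimes>\<^bsub>?G\<^esub> B) i j \<in> kHom C (x j) (x i)"
      unfolding mult by (intro kHom_sum conv_kHom[of _ "x l" for l]) (use that in \<open>auto simp: Gamma_carrier\<close>)
    assume "\<not> (1 \<le> i \<and> i \<le> j \<and> j \<le> t)"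
    then have "A i l = (\<lambda>_. 0) \<or> B l j = (\<lambda>_. 0)" for l
      using that unfolding Gamma_carrier by (metis le_trans)
    then have "conv C (A i l) (B l j) m = 0" for l m by (metis conv_zero)
    then show "(A \<otimes>\<^bsub>?G\<^esub> B) i j = (\<lambda>_. 0)" by (simp add: mult)
  qed
  show "monoid ?G"
  proof (rule monoidI)
    fix A B D assume AB: "A \<in> carrier ?G" "B \<in> carrier ?G"
    show "A \<otimes>\<^bsub>?G\<^esub> B \<in> carrier ?G" using clos AB .
    show "(A \<otimes>\<^bsub>?G\<^esub> B) \<otimes>\<^bsub>?G\<^esub> D = A \<otimes>\<^bsub>?G\<^esub> (B \<otimes>\<^bsub>?G\<^esub> D)"
    proof (intro ext)
      fix i j m
      have "((A \<otimes>\<^bsub>?G\<^esub> B) \<otimes>\<^bsub>?G\<^esub> D) i j m =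
          (\<Sum>l\<in>{1..t}. \<Sum>p\<in>{1..t}. conv C (A i p) (conv C (B p l) (D l j)) m)"
        by (simp add: mult conv_sum_left conv_assoc)
      also have "\<dots> = (A \<otimes>\<^bsub>?G\<^esub> (B \<otimes>\<^bsub>?G\<^esub> D)) i j m"
        by (subst sum.swap) (simp add: mult conv_sum_right)
      finally show "((A \<otimes>\<^bsub>?G\<^esub> B) \<otimes>\<^bsub>?G\<^esub> D) i j m = (A \<otimes>\<^bsub>?G\<^esub> (B \<otimes>\<^bsub>?G\<^esub> D)) i j m" .
    qed
  next
    fix A assume A: "A \<in> carrier ?G"
    have Ac: "A i j \<in> kHom C (x j) (x i)" "\<not> (1 \<le> i \<and> i \<le> j \<and> j \<le> t) \<Longrightarrow> A i j = (\<lambda>_. 0)" for i j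
      using A by (auto simp: Gamma_carrier)
    show "\<one>\<^bsub>?G\<^esub> \<otimes>\<^bsub>?G\<^esub> A = A"
    proof (intro ext)
      fix i j m
      have "(\<one>\<^bsub>?G\<^esub> \<otimes>\<^bsub>?G\<^esub> A) i j m =
          (\<Sum>l\<in>{1..t}. if i = l then conv C (basis_mor (Id C (x i))) (A i j) m else 0)"
        unfolding mult one by (intro sum.cong refl) auto
      also have "\<dots> = A i j m"
        using Ac[of i j] conv_Id(1)[OF Ac(1)[of i j]] t
        by (cases "1 \<le> i \<and> i \<le> j \<and> j \<le> t") (auto simp: sum.delta')
      finally show "(\<one>\<^bsub>?G\<^esub> \<otimes>\<^bsub>?G\<^esub> A) i j m = A i j m" .
    qed
    show "A \<otimes>\<^bsub>?G\<^esub> \<one>\<^bsub>?G\<^esub> = A"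
    proof (intro ext)
      fix i j m
      have "(A \<otimes>\<^bsub>?G\<^esub> \<one>\<^bsub>?G\<^esub>) i j m =
          (\<Sum>l\<in>{1..t}. if j = l then conv C (A i j) (basis_mor (Id C (x j))) m else 0)"
        unfolding mult one by (intro sum.cong refl) auto
      also have "\<dots> = A i j m"
        using Ac[of i j] conv_Id(2)[OF Ac(1)[of i j]] t
        by (cases "1 \<le> i \<and> i \<le> j \<and> j \<le> t") (auto simp: sum.delta')
      finally show "(A \<otimes>\<^bsub>?G\<^esub> \<one>\<^bsub>?G\<^esub>) i j m = A i j m" .
    qed
  qed (rule onec)
  have add: "(A \<oplus>\<^bsub>?G\<^esub> B) i j = (\<lambda>m. A i j m + B i j m)" for A B i j by (simp add: Gamma_def)
  show "(A \<oplus>\<^bsub>?G\<^esub> B) \<otimes>\<^bsub>?G\<^esub> D = A \<otimes>\<^bsub>?G\<^esub> D \<oplus>\<^bsub>?G\<^esub> B \<otimes>\<^bsub>?G\<^esub> D" for A B D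
    by (intro ext) (simp add: mult add conv_add_left sum.distrib)
  show "D \<otimes>\<^bsub>?G\<^esub> (A \<oplus>\<^bsub>?G\<^esub> B) = D \<otimes>\<^bsub>?G\<^esub> A \<oplus>\<^bsub>?G\<^esub> D \<otimes>\<^bsub>?G\<^esub> B" for A B D
    by (intro ext) (simp add: mult add conv_add_right sum.distrib)
qed

lemma Mstar_left_module:
  assumes t: "t \<le> n" "t + 1 \<in> {1..n}"
  shows "left_module (Gamma C x t :: (nat \<Rightarrow> nat \<Rightarrow> 'm \<Rightarrow> 'k::field) ring) (Mstar C x t)"
proof -
  let ?G = "Gamma C x t :: (nat \<Rightarrow> nat \<Rightarrow> 'm \<Rightarrow> 'k) ring"
  let ?M = "Mstar C x t :: (nat \<Rightarrow> nat \<Rightarrow> 'm \<Rightarrow> 'k, nat \<Rightarrow> 'm \<Rightarrow> 'k) module"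
  have "abelian_group ?M"
  proof (rule abelian_groupI, goal_cases)
    case (1 A B)
    then show ?case unfolding Mstar_carrier by (auto simp: Mstar_def kHom_def)
  next
    case 2
    show ?case unfolding Mstar_carrier by (auto simp: Mstar_def)
  next
    case (6 A)
    have "(\<lambda>i m. - A i m) \<in> carrier ?M" using 6 unfolding Mstar_carrier by (auto simp: kHom_def)
    moreover have "(\<lambda>i m. - A i m) \<oplus>\<^bsub>?M\<^esub> A = \<zero>\<^bsub>?M\<^esub>" by (simp add: Mstar_def)
    ultimately show ?case by blast
  qed (simp_all add: Mstar_def algebra_simps)
  moreover have "left_module_axioms ?G ?M"
  proof
    have sm: "(A \<odot>\<^bsub>?M\<^esub> v) i = (\<lambda>m. \<Sum>l\<in>{1..t}. conv C (A i l) (v l) m)" for A v i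
      by (simp add: Mstar_def)
    have addG: "(A \<oplus>\<^bsub>?G\<^esub> B) i j = (\<lambda>m. A i j m + B i j m)" for A B i j by (simp add: Gamma_def)
    have addM: "(v \<oplus>\<^bsub>?M\<^esub> w) i = (\<lambda>m. v i m + w i m)" for v w i by (simp add: Mstar_def)
    fix A B v w assume A: "A \<in> carrier ?G" and v: "v \<in> carrier ?M"
    show "A \<odot>\<^bsub>?M\<^esub> v \<in> carrier ?M"
      unfolding Mstar_carrier
    proof (intro allI conjI impI)
      fix i
      show "(A \<odot>\<^bsub>?M\<^esub> v) i \<in> kHom C (x (t + 1)) (x i)"
        unfolding sm by (intro kHom_sum conv_kHom[of _ "x l" for l])
          (use A v in \<open>auto simp: Gamma_carrier Mstar_carrier\<close>)
      assume "i \<notin> {1..t}"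
      then have "A i l = (\<lambda>_. 0)" for l
        using A unfolding Gamma_carrier by (metis atLeastAtMost_iff le_trans)
      then show "(A \<odot>\<^bsub>?M\<^esub> v) i = (\<lambda>_. 0)" by (simp add: sm)
    qed
    show "(A \<oplus>\<^bsub>?G\<^esub> B) \<odot>\<^bsub>?M\<^esub> v = A \<odot>\<^bsub>?M\<^esub> v \<oplus>\<^bsub>?M\<^esub> B \<odot>\<^bsub>?M\<^esub> v"
      by (intro ext) (simp add: sm addG addM conv_add_left sum.distrib)
    show "A \<odot>\<^bsub>?M\<^esub> (v \<oplus>\<^bsub>?M\<^esub> w) = A \<odot>\<^bsub>?M\<^esub> v \<oplus>\<^bsub>?M\<^esub> A \<odot>\<^bsub>?M\<^esub> w"
      by (intro ext) (simp add: sm addM conv_add_right sum.distrib)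
    show "(A \<otimes>\<^bsub>?G\<^esub> B) \<odot>\<^bsub>?M\<^esub> v = A \<odot>\<^bsub>?M\<^esub> (B \<odot>\<^bsub>?M\<^esub> v)"
    proof (intro ext)
      fix i m
      have "((A \<otimes>\<^bsub>?G\<^esub> B) \<odot>\<^bsub>?M\<^esub> v) i m =
          (\<Sum>l\<in>{1..t}. \<Sum>p\<in>{1..t}. conv C (A i p) (conv C (B p l) (v l)) m)"
        by (simp add: sm Gamma_def conv_sum_left conv_assoc)
      also have "\<dots> = (A \<odot>\<^bsub>?M\<^esub> (B \<odot>\<^bsub>?M\<^esub> v)) i m"
        by (subst sum.swap) (simp add: sm conv_sum_right)
      finally show "((A \<otimes>\<^bsub>?G\<^esub> B) \<odot>\<^bsub>?M\<^esub> v) i m = (A \<odot>\<^bsub>?M\<^esub> (B \<odot>\<^bsub>?M\<^esub> v)) i m" .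
    qed
  next
    have sm: "(A \<odot>\<^bsub>?M\<^esub> v) i = (\<lambda>m. \<Sum>l\<in>{1..t}. conv C (A i l) (v l) m)" for A v i
      by (simp add: Mstar_def)
    fix v assume v: "v \<in> carrier ?M"
    show "\<one>\<^bsub>?G\<^esub> \<odot>\<^bsub>?M\<^esub> v = v"
    proof (intro ext)
      fix i m
      have vc: "v i \<in> kHom C (x (t + 1)) (x i)" "i \<notin> {1..t} \<Longrightarrow> v i = (\<lambda>_. 0)"
        using v by (auto simp: Mstar_carrier)
      have "(\<one>\<^bsub>?G\<^esub> \<odot>\<^bsub>?M\<^esub> v) i m =
          (\<Sum>l\<in>{1..t}. if i = l then conv C (basis_mor (Id C (x i))) (v i) m else 0)"
        unfolding sm by (intro sum.cong refl) (auto simp: Gamma_def)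
      also have "\<dots> = v i m"
        using vc(2) conv_Id(1)[OF vc(1)] t by (cases "i \<in> {1..t}") (auto simp: sum.delta')
      finally show "(\<one>\<^bsub>?G\<^esub> \<odot>\<^bsub>?M\<^esub> v) i m = v i m" .
    qed
  qed
  ultimately show ?thesis using Gamma_ring[OF t(1)] by (simp add: left_module_def)
qed

lemma finsum_Mstar:
  assumes t: "t \<le> n" "t + 1 \<in> {1..n}"
    and "finite S" "f \<in> S \<rightarrow> carrier (Mstar C x t :: (nat \<Rightarrow> nat \<Rightarrow> 'm \<Rightarrow> 'k::field, nat \<Rightarrow> 'm \<Rightarrow> 'k) module)"
  shows "(\<Oplus>\<^bsub>Mstar C x t :: (nat \<Rightarrow> nat \<Rightarrow> 'm \<Rightarrow> 'k, nat \<Rightarrow> 'm \<Rightarrow> 'k) module\<^esub>s\<in>S. f s) = (\<lambda>i m. \<Sum>s\<in>S. f s i m)"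
proof -
  interpret M: left_module "Gamma C x t :: (nat \<Rightarrow> nat \<Rightarrow> 'm \<Rightarrow> 'k) ring" "Mstar C x t"
    by (rule Mstar_left_module[OF t])
  from assms(3,4) show ?thesis
  proof (induction S rule: finite_induct)
    case empty
    show ?case by (simp only: M.finsum_empty) (simp add: Mstar_def)
  next
    case (insert s S)
    then have "f s \<in> carrier (Mstar C x t)" "f \<in> S \<rightarrow> carrier (Mstar C x t)" by auto
    with insert show ?case by (simp add: M.finsum_insert) (simp add: Mstar_def)
  qed
qed

end

section \<open>Coordinates of column modules\<close>

context directed_EI_category
begin

text \<open>For \<open>z = x (t + 1)\<close> these morphisms form the standard basis of the column module.\<close>

definition out :: "'o \<Rightarrow> 'm set" where
  "out z = {d \<in> Mor C. Dom C d = z \<and> Cod C d \<noteq> z}"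

lemma finite_out: "finite (out z)" by (simp add: out_def)

lemma out_comp: "\<lbrakk>d \<in> out z; a \<in> Mor C; Dom C a = Cod C d\<rbrakk> \<Longrightarrow> a \<cdot> d \<in> out z"
  using rank_less[of d] rank_mono[of a] by (force simp: out_def)

lemma rank_out:
  assumes "d \<in> out (x (t + 1))" "t < n"
  shows "rank (Cod C d) \<in> {1..t}" "x (rank (Cod C d)) = Cod C d" "i \<in> {1..n} \<Longrightarrow> x i = Cod C d \<longleftrightarrow> i = rank (Cod C d)"
proof -
  have d: "d \<in> Mor C" "Dom C d = x (t + 1)" "Cod C d \<noteq> x (t + 1)" using assms by (auto simp: out_def)
  have c: "Cod C d \<in> Obj C" using d Cod_closed by simp
  have "rank (Cod C d) < t + 1" using rank_less[of d] d assms by auto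
  then show "rank (Cod C d) \<in> {1..t}" using x_rank(2)[OF c] by auto
  show "x (rank (Cod C d)) = Cod C d" by (rule x_rank(1)[OF c])
  then show "i \<in> {1..n} \<Longrightarrow> x i = Cod C d \<longleftrightarrow> i = rank (Cod C d)" using rank_x by metis
qed

lemma Hom_out:
  assumes "d \<in> Hom C (x (t + 1)) (x i)" "i \<in> {1..t}" "t < n"
  shows "d \<in> out (x (t + 1))"
proof -
  have "i \<in> {1..n}" "t + 1 \<in> {1..n}" "i \<noteq> t + 1" using assms by auto
  then have "x i \<noteq> x (t + 1)" using rank_x by metis
  then show ?thesis using assms by (auto simp: out_def Hom_iff)
qed

text \<open>The coefficients \<open>\<psi> u d\<close> express the basis element \<open>d\<close> of the column module through the generators \<open>u\<close>.
  They are combinations of morphisms from the target of \<open>u\<close> to the target of \<open>d\<close>, that is, entries of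
  a matrix.\<close>

definition coordinates :: "'m set \<Rightarrow> ('m \<Rightarrow> 'm \<Rightarrow> 'm \<Rightarrow> 'k::field) \<Rightarrow> 'o \<Rightarrow> bool" where
  "coordinates U \<psi> z \<longleftrightarrow> U \<subseteq> out z \<and>
    (\<forall>u\<in>U. \<forall>d\<in>out z. \<psi> u d \<in> kHom C (Cod C u) (Cod C d)) \<and>
    (\<forall>d\<in>out z. \<forall>m. (\<Sum>u\<in>U. conv C (\<psi> u d) (basis_mor u) m) = basis_mor d m)"

text \<open>This is what makes the linear extension of \<open>d \<mapsto> \<psi> u d\<close> a homomorphism of modules over the matrix
  algebra.\<close>

definition equivariant :: "'m set \<Rightarrow> ('m \<Rightarrow> 'm \<Rightarrow> 'm \<Rightarrow> 'k::field) \<Rightarrow> 'o \<Rightarrow> bool" where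
  "equivariant U \<psi> z \<longleftrightarrow>
    (\<forall>u\<in>U. \<forall>d\<in>out z. \<forall>a\<in>Mor C. Dom C a = Cod C d \<longrightarrow>
      \<psi> u (a \<cdot> d) = conv C (basis_mor a) (\<psi> u d))"

definition column :: "nat \<Rightarrow> 'm \<Rightarrow> nat \<Rightarrow> 'm \<Rightarrow> 'k::field" where
  "column t u = (\<lambda>i. if i \<in> {1..t} \<and> x i = Cod C u then basis_mor u else (\<lambda>_. 0))"

text \<open>The coefficient of \<open>u\<close> in \<open>v\<close>, obtained from \<open>\<psi> u\<close> by linear extension.  A matrix acts on \<open>column t u\<close>
  only through the matrix column that belongs to the target of \<open>u\<close>, so everything else is zero.\<close>

definition coordinate_matrix ::
    "nat \<Rightarrow> ('m \<Rightarrow> 'm \<Rightarrow> 'm \<Rightarrow> 'k::field) \<Rightarrow> 'm \<Rightarrow> (nat \<Rightarrow> 'm \<Rightarrow> 'k) \<Rightarrow> nat \<Rightarrow> nat \<Rightarrow> 'm \<Rightarrow> 'k" where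
  "coordinate_matrix t \<psi> u v =
    (\<lambda>i j m. if j \<in> {1..t} \<and> x j = Cod C u then \<Sum>d\<in>Mor C. v i d * \<psi> u d m else 0)"

lemma column_eq:
  assumes "u \<in> out (x (t + 1))" "t < n"
  shows "column t u i = (if i = rank (Cod C u) then basis_mor u else (\<lambda>_. 0))"
  using rank_out[OF assms] assms by (auto simp: column_def)

lemma column_closed:
  assumes "u \<in> out (x (t + 1))" "t < n"
  shows "column t u \<in> carrier (Mstar C x t :: (nat \<Rightarrow> nat \<Rightarrow> 'm \<Rightarrow> 'k::field, nat \<Rightarrow> 'm \<Rightarrow> 'k) module)"
  unfolding Mstar_carrier using assms
  by (auto simp: column_def basis_mor_kHom out_def Hom_iff)

lemma inj_column:
  assumes "t < n"
  shows "inj_on (column t :: 'm \<Rightarrow> nat \<Rightarrow> 'm \<Rightarrow> 'k::field) (out (x (t + 1)))"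
proof (rule inj_onI)
  fix u u' assume u: "u \<in> out (x (t + 1))" "u' \<in> out (x (t + 1))"
    and eq: "(column t u :: nat \<Rightarrow> 'm \<Rightarrow> 'k) = column t u'"
  have "column t u (rank (Cod C u)) u = (1 :: 'k)" by (simp add: column_eq[OF u(1) assms] basis_mor_def)
  then have "column t u' (rank (Cod C u)) u = (1 :: 'k)" by (simp add: eq)
  then show "u = u'" by (auto simp: column_eq[OF u(2) assms] basis_mor_def split: if_splits)
qed

lemma Mstar_vanishes:
  assumes "v \<in> carrier (Mstar C x t)" "\<not> (i \<in> {1..t} \<and> d \<in> Hom C (x (t + 1)) (x i))"
  shows "v i d = 0"
proof (cases "i \<in> {1..t}")
  case True
  have "v i \<in> kHom C (x (t + 1)) (x i)" using assms(1) by (simp add: Mstar_carrier)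
  then show ?thesis using True assms(2) by (simp add: kHom_def)
next
  case False
  then have "v i = (\<lambda>_. 0)" using assms(1) unfolding Mstar_carrier by blast
  then show ?thesis by simp
qed

lemma coordinate_matrix_closed:
  assumes U: "coordinates U \<psi> (x (t + 1))" "u \<in> U" and t: "t < n" and v: "v \<in> carrier (Mstar C x t)"
  shows "coordinate_matrix t \<psi> u v \<in> carrier (Gamma C x t :: (nat \<Rightarrow> nat \<Rightarrow> 'm \<Rightarrow> 'k::field) ring)"
proof -
  have term0: "v i d * \<psi> u d m = 0" if "x j = Cod C u" "\<not> (i \<in> {1..t} \<and> m \<in> Hom C (x j) (x i))" for i j d m
  proof (cases "i \<in> {1..t} \<and> d \<in> Hom C (x (t + 1)) (x i)")
    case True
    then have "d \<in> out (x (t + 1))" "Cod C d = x i" using Hom_out t by (auto simp: Hom_iff)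
    moreover have "\<psi> u d \<in> kHom C (Cod C u) (Cod C d)"
      using U calculation(1) by (simp add: coordinates_def)
    ultimately have "\<psi> u d \<in> kHom C (x j) (x i)" using that by simp
    then show ?thesis using True that by (auto simp: kHom_def)
  next
    case False
    then have "v i d = 0" by (rule Mstar_vanishes[OF v])
    then show ?thesis by simp
  qed
  have "coordinate_matrix t \<psi> u v i j m = 0"
    if "\<not> (1 \<le> i \<and> i \<le> j \<and> j \<le> t \<and> m \<in> Hom C (x j) (x i))" for i j m
  proof (cases "j \<in> {1..t} \<and> x j = Cod C u")
    case True
    have "\<not> (i \<in> {1..t} \<and> m \<in> Hom C (x j) (x i))"
      using that True triangular[of j i] t by (cases "j < i") auto
    then have "v i d * \<psi> u d m = 0" for d using term0 True by blast
    then show ?thesis unfolding coordinate_matrix_def by (simp only: sum.neutral_const if_cancel)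
  qed (auto simp: coordinate_matrix_def)
  then show ?thesis unfolding Gamma_carrier kHom_def by (auto simp: fun_eq_iff)
qed

lemma Mstar_smult: "(A \<odot>\<^bsub>Mstar C x t\<^esub> v) i m = (\<Sum>l\<in>{1..t}. conv C (A i l) (v l) m)"
  by (simp add: Mstar_def)

lemma smult_column:
  assumes "u \<in> out (x (t + 1))" "t < n"
  shows "(A \<odot>\<^bsub>Mstar C x t\<^esub> column t u) i m = conv C (A i (rank (Cod C u))) (basis_mor u) m"
proof -
  have "(A \<odot>\<^bsub>Mstar C x t\<^esub> column t u) i m =
      (\<Sum>l\<in>{1..t}. if l = rank (Cod C u) then conv C (A i l) (basis_mor u) m else 0)"
    unfolding Mstar_smult by (intro sum.cong refl) (auto simp: column_eq[OF assms])
  then show ?thesis using rank_out(1)[OF assms] by (simp add: sum.delta)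
qed

lemma coordinates_expand:
  assumes U: "coordinates U \<psi> (x (t + 1))" and t: "t < n" and v: "v \<in> carrier (Mstar C x t)"
  shows "(\<Sum>u\<in>U. (coordinate_matrix t \<psi> u v \<odot>\<^bsub>Mstar C x t\<^esub> column t u) i m) = v i m"
proof -
  have UN: "u \<in> out (x (t + 1))" if "u \<in> U" for u using U that by (auto simp: coordinates_def)
  have "(\<Sum>u\<in>U. (coordinate_matrix t \<psi> u v \<odot>\<^bsub>Mstar C x t\<^esub> column t u) i m) =
      (\<Sum>u\<in>U. \<Sum>d\<in>Mor C. v i d * conv C (\<psi> u d) (basis_mor u) m)"
  proof (intro sum.cong refl)
    fix u assume u: "u \<in> U"
    have "coordinate_matrix t \<psi> u v i (rank (Cod C u)) = (\<lambda>m. \<Sum>d\<in>Mor C. v i d * \<psi> u d m)"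
      using rank_out[OF UN[OF u] t] by (simp add: coordinate_matrix_def)
    then show "(coordinate_matrix t \<psi> u v \<odot>\<^bsub>Mstar C x t\<^esub> column t u) i m =
        (\<Sum>d\<in>Mor C. v i d * conv C (\<psi> u d) (basis_mor u) m)"
      by (simp add: smult_column[OF UN[OF u] t] conv_sum_left conv_scale_left)
  qed
  also have "\<dots> = (\<Sum>d\<in>Mor C. v i d * (\<Sum>u\<in>U. conv C (\<psi> u d) (basis_mor u) m))"
    by (subst sum.swap) (simp add: sum_distrib_left)
  also have "\<dots> = (\<Sum>d\<in>Mor C. v i d * basis_mor d m)"
  proof (intro sum.cong refl)
    fix d
    show "v i d * (\<Sum>u\<in>U. conv C (\<psi> u d) (basis_mor u) m) = v i d * basis_mor d m"
    proof (cases "i \<in> {1..t} \<and> d \<in> Hom C (x (t + 1)) (x i)")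
      case True
      then have "d \<in> out (x (t + 1))" using Hom_out t by auto
      then show ?thesis using U by (simp add: coordinates_def)
    next
      case False
      then have "v i d = 0" by (rule Mstar_vanishes[OF v])
      then show ?thesis by simp
    qed
  qed
  also have "\<dots> = v i m"
  proof -
    have "v i \<in> kHom C (x (t + 1)) (x i)" using v by (auto simp: Mstar_carrier)
    from kHom_expand[OF this] show ?thesis by metis
  qed
  finally show ?thesis .
qed

lemma coordinate_matrix_add:
  "coordinate_matrix t \<psi> u (v \<oplus>\<^bsub>Mstar C x t\<^esub> w) =
    coordinate_matrix t \<psi> u v \<oplus>\<^bsub>Gamma C x t\<^esub> coordinate_matrix t \<psi> u w"
  by (auto simp: coordinate_matrix_def Mstar_def Gamma_def fun_eq_iff distrib_right sum.distrib)

lemma coordinate_matrix_smult: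
  assumes U: "equivariant U \<psi> (x (t + 1))" "u \<in> U" and t: "t < n"
    and A: "A \<in> carrier (Gamma C x t)" and v: "v \<in> carrier (Mstar C x t)"
  shows "coordinate_matrix t \<psi> u (A \<odot>\<^bsub>Mstar C x t\<^esub> v) = A \<otimes>\<^bsub>Gamma C x t\<^esub> coordinate_matrix t \<psi> u v"
proof (intro ext)
  fix i j m
  show "coordinate_matrix t \<psi> u (A \<odot>\<^bsub>Mstar C x t\<^esub> v) i j m =
    (A \<otimes>\<^bsub>Gamma C x t\<^esub> coordinate_matrix t \<psi> u v) i j m"
  proof (cases "j \<in> {1..t} \<and> x j = Cod C u")
    case True
    have Ae: "conv C (A i l) f m = (\<Sum>a\<in>Mor C. A i l a * conv C (basis_mor a) f m)" for l f
    proof -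
      have "A i l \<in> kHom C (x l) (x i)" using A by (auto simp: Gamma_carrier)
      then have "conv C (A i l) f m = conv C (\<lambda>m. \<Sum>a\<in>Mor C. A i l a * basis_mor a m) f m"
        using kHom_expand by metis
      then show ?thesis by (simp add: conv_sum_left conv_scale_left)
    qed
    have "coordinate_matrix t \<psi> u (A \<odot>\<^bsub>Mstar C x t\<^esub> v) i j m =
        (\<Sum>l\<in>{1..t}. \<Sum>d\<in>Mor C. conv C (A i l) (v l) d * \<psi> u d m)"
      using True by (subst sum.swap) (simp add: coordinate_matrix_def Mstar_smult sum_distrib_right)
    also have "\<dots> = (\<Sum>l\<in>{1..t}. \<Sum>a\<in>Mor C. \<Sum>d\<in>Mor C.
        if Cod C d = Dom C a then A i l a * v l d * \<psi> u (a \<cdot> d) m else 0)"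
      by (simp only: sum_conv)
    also have "\<dots> = (\<Sum>l\<in>{1..t}. \<Sum>a\<in>Mor C. \<Sum>d\<in>Mor C.
        A i l a * (v l d * conv C (basis_mor a) (\<psi> u d) m))"
    proof (intro sum.cong refl)
      fix l a d assume l: "l \<in> {1..t}" and a: "a \<in> Mor C" and d: "d \<in> Mor C"
      show "(if Cod C d = Dom C a then A i l a * v l d * \<psi> u (a \<cdot> d) m else 0) =
          A i l a * (v l d * conv C (basis_mor a) (\<psi> u d) m)"
      proof (cases "A i l a = 0 \<or> v l d = 0")
        case False
        then have "a \<in> Hom C (x l) (x i)" "d \<in> Hom C (x (t + 1)) (x l)"
          using A Mstar_vanishes[OF v, of l d] by (auto simp: Gamma_carrier kHom_def)
        then have "Cod C d = Dom C a" "d \<in> out (x (t + 1))" using Hom_out l t by (auto simp: Hom_iff)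
        then show ?thesis using U a unfolding equivariant_def by simp
      qed auto
    qed
    also have "\<dots> = (\<Sum>l\<in>{1..t}. conv C (A i l) (\<lambda>m. \<Sum>d\<in>Mor C. v l d * \<psi> u d m) m)"
      by (simp only: Ae) (simp add: conv_sum_right conv_scale_right sum_distrib_left)
    also have "\<dots> = (A \<otimes>\<^bsub>Gamma C x t\<^esub> coordinate_matrix t \<psi> u v) i j m"
      using True by (simp add: Gamma_def coordinate_matrix_def)
    finally show ?thesis .
  next
    case False
    then have "coordinate_matrix t \<psi> u w l j = (\<lambda>_. 0)" for w l
      by (auto simp: coordinate_matrix_def)
    then show ?thesis by (simp add: Gamma_def)
  qed
qed

text \<open>The coordinate matrices form a section of the homomorphism from the free module on the columns of
  the \<open>u \<in> U\<close> onto \<open>Mstar C x t\<close>.\<close>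

theorem equivariant_coordinates_projective:
  fixes \<psi> :: "'m \<Rightarrow> 'm \<Rightarrow> 'm \<Rightarrow> 'k::field"
  assumes U: "coordinates U \<psi> (x (t + 1))" "equivariant U \<psi> (x (t + 1))" and t: "t < n"
  shows "projective_left_module (Gamma C x t :: (nat \<Rightarrow> nat \<Rightarrow> 'm \<Rightarrow> 'k) ring) (Mstar C x t)"
proof -
  let ?G = "Gamma C x t :: (nat \<Rightarrow> nat \<Rightarrow> 'm \<Rightarrow> 'k) ring"
  let ?M = "Mstar C x t :: (nat \<Rightarrow> nat \<Rightarrow> 'm \<Rightarrow> 'k, nat \<Rightarrow> 'm \<Rightarrow> 'k) module"
  define B where "B = (column t ` U :: (nat \<Rightarrow> 'm \<Rightarrow> 'k) set)"
  have t': "t \<le> n" "t + 1 \<in> {1..n}" using t by auto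
  interpret M: left_module ?G ?M by (rule Mstar_left_module[OF t'])
  have UN: "U \<subseteq> out (x (t + 1))" using U by (simp add: coordinates_def)
  have inj: "inj_on (column t :: 'm \<Rightarrow> nat \<Rightarrow> 'm \<Rightarrow> 'k) U" using inj_column[OF t] UN by (rule inj_on_subset)
  have finU: "finite U" using UN finite_out by (rule finite_subset)
  have finB: "finite B" using finU by (simp add: B_def)
  have BM: "id \<in> B \<rightarrow> carrier ?M" using UN by (auto simp: B_def intro!: column_closed[OF subsetD t])
  define s where "s v = (\<lambda>b. if b \<in> B then coordinate_matrix t \<psi> (inv_into U (column t) b) v else \<zero>\<^bsub>?G\<^esub>)" for v
  have inv: "inv_into U (column t) b \<in> U" if "b \<in> B" for b
    using that unfolding B_def by (rule inv_into_into)
  have mat: "coordinate_matrix t \<psi> u v \<in> carrier ?G" if "u \<in> U" "v \<in> carrier ?M" for u v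
    using coordinate_matrix_closed[OF U(1) that(1) t that(2)] .
  have sc: "s v \<in> carrier (free_left_module ?G B)" if v: "v \<in> carrier ?M" for v
  proof -
    have "{b. s v b \<noteq> \<zero>\<^bsub>?G\<^esub>} \<subseteq> B" by (auto simp: s_def)
    then have "finite {b. s v b \<noteq> \<zero>\<^bsub>?G\<^esub>}" using finB by (rule finite_subset)
    then show ?thesis using mat[OF inv v] by (auto simp: free_left_module_def s_def)
  qed
  show ?thesis
  proof (rule retract_of_free_projective)
    show "left_module ?G ?M" by (rule M.left_module_axioms)
    show "s \<in> module_hom ?G ?M (free_left_module ?G B)"
    proof (rule module_homI)
      show "s v \<in> carrier (free_left_module ?G B)" if "v \<in> carrier ?M" for v using sc[OF that] .
      show "s (v \<oplus>\<^bsub>?M\<^esub> w) = s v \<oplus>\<^bsub>free_left_module ?G B\<^esub> s w"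
        if "v \<in> carrier ?M" "w \<in> carrier ?M" for v w
        by (auto simp: s_def free_left_module_def coordinate_matrix_add)
      show "s (A \<odot>\<^bsub>?M\<^esub> v) = A \<odot>\<^bsub>free_left_module ?G B\<^esub> s v"
        if "A \<in> carrier ?G" "v \<in> carrier ?M" for A v
        using that by (auto simp: s_def free_left_module_def coordinate_matrix_smult[OF U(2) inv t])
    qed
    show "free_lift ?G ?M id \<in> module_hom ?G (free_left_module ?G B) ?M"
      by (rule M.free_lift_hom[OF BM])
    show "free_lift ?G ?M id (s v) = v" if v: "v \<in> carrier ?M" for v
    proof (intro ext)
      fix i m
      have sB: "s v b \<odot>\<^bsub>?M\<^esub> id b \<in> carrier ?M" if "b \<in> B" for b
        using that mat[OF inv[OF that] v] BM by (auto simp: s_def intro!: M.smult_closed)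
      have "free_lift ?G ?M id (s v) i m = (\<Oplus>\<^bsub>?M\<^esub>b\<in>B. s v b \<odot>\<^bsub>?M\<^esub> id b) i m"
        by (subst M.free_lift_eq_finsum[OF sc[OF v] finB _ _ BM]) (auto simp: s_def)
      also have "\<dots> = (\<Sum>b\<in>B. (s v b \<odot>\<^bsub>?M\<^esub> b) i m)"
        using sB by (subst finsum_Mstar[OF t' finB]) auto
      also have "\<dots> = (\<Sum>u\<in>U. (coordinate_matrix t \<psi> u v \<odot>\<^bsub>?M\<^esub> column t u) i m)"
        unfolding B_def by (subst sum.reindex[OF inj]) (auto simp: s_def B_def inj intro!: sum.cong)
      also have "\<dots> = v i m" by (rule coordinates_expand[OF U(1) t v])
      finally show "free_lift ?G ?M id (s v) i m = v i m" .
    qed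
  qed
qed

text \<open>The coordinates \<open>\<psi>\<^sub>0\<close> only serve to show that the columns of the \<open>u \<in> U\<close> generate \<open>Mstar C x t\<close>.  A section
  of the resulting homomorphism from a free module has matrices as its components, and the entry of
  such a matrix at the targets of \<open>d\<close> and \<open>u\<close> is \<open>\<psi> u d\<close>.\<close>

theorem projective_equivariant_coordinates:
  fixes \<psi>\<^sub>0 :: "'m \<Rightarrow> 'm \<Rightarrow> 'm \<Rightarrow> 'k::field"
  assumes proj: "projective_left_module (Gamma C x t :: (nat \<Rightarrow> nat \<Rightarrow> 'm \<Rightarrow> 'k) ring) (Mstar C x t)"
    and U: "coordinates U \<psi>\<^sub>0 (x (t + 1))" and t: "t < n"
  obtains \<psi> :: "'m \<Rightarrow> 'm \<Rightarrow> 'm \<Rightarrow> 'k" where "coordinates U \<psi> (x (t + 1))" "equivariant U \<psi> (x (t + 1))"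
proof -
  let ?G = "Gamma C x t :: (nat \<Rightarrow> nat \<Rightarrow> 'm \<Rightarrow> 'k) ring"
  let ?M = "Mstar C x t :: (nat \<Rightarrow> nat \<Rightarrow> 'm \<Rightarrow> 'k, nat \<Rightarrow> 'm \<Rightarrow> 'k) module"
  let ?F = "free_left_module ?G U" and ?z = "x (t + 1)"
  have t': "t \<le> n" "t + 1 \<in> {1..n}" using t by auto
  interpret M: left_module ?G ?M by (rule Mstar_left_module[OF t'])
  have UN: "U \<subseteq> out ?z" using U by (simp add: coordinates_def)
  have finU: "finite U" using UN finite_out by (rule finite_subset)
  have UM: "column t \<in> U \<rightarrow> carrier ?M" using UN by (auto intro!: column_closed[OF subsetD t])
  have wc: "w u \<in> carrier ?G" if "w \<in> carrier ?F" for w u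
    using that by (auto simp: free_left_module_def)
  have lift: "free_lift ?G ?M (column t) w i m = (\<Sum>u\<in>U. (w u \<odot>\<^bsub>?M\<^esub> column t u) i m)"
    if w: "w \<in> carrier ?F" for w i m
  proof -
    have "{u. w u \<noteq> \<zero>\<^bsub>?G\<^esub>} \<subseteq> U" using w by (auto simp: free_left_module_def)
    moreover have "(\<lambda>u. w u \<odot>\<^bsub>?M\<^esub> column t u) \<in> U \<rightarrow> carrier ?M"
      using wc[OF w] UM by (auto intro!: M.smult_closed)
    ultimately show ?thesis
      by (subst M.free_lift_eq_finsum[OF w finU _ _ UM], simp, simp, subst finsum_Mstar[OF t' finU]) auto
  qed
  have surj: "\<exists>w\<in>carrier ?F. free_lift ?G ?M (column t) w = v" if v: "v \<in> carrier ?M" for v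
  proof -
    define w where "w u = (if u \<in> U then coordinate_matrix t \<psi>\<^sub>0 u v else \<zero>\<^bsub>?G\<^esub>)" for u
    have "{u. w u \<noteq> \<zero>\<^bsub>?G\<^esub>} \<subseteq> U" by (auto simp: w_def)
    then have "finite {u. w u \<noteq> \<zero>\<^bsub>?G\<^esub>}" using finU by (rule finite_subset)
    then have w: "w \<in> carrier ?F"
      using coordinate_matrix_closed[OF U _ t v] by (auto simp: free_left_module_def w_def)
    have "free_lift ?G ?M (column t) w = v"
    proof (intro ext)
      fix i m
      show "free_lift ?G ?M (column t) w i m = v i m"
        unfolding lift[OF w] coordinates_expand[OF U t v, of i m, symmetric]
        by (intro sum.cong refl) (simp add: w_def)
    qed
    then show ?thesis using w by blast
  qed
  obtain s where s: "s \<in> module_hom ?G ?M ?F"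
    "\<And>v. v \<in> carrier ?M \<Longrightarrow> free_lift ?G ?M (column t) (s v) = v"
  proof (rule projective_surjection_splits[OF proj M.R.free_left_module_is_left_module
        M.free_lift_hom[OF UM] surj])
    fix s
    assume "s \<in> module_hom ?G ?M ?F" "\<And>v. v \<in> carrier ?M \<Longrightarrow> free_lift ?G ?M (column t) (s v) = v"
    then show thesis by (rule that)
  qed
  define \<psi> where "\<psi> u d = s (column t d) u (rank (Cod C d)) (rank (Cod C u))" for u d
  have sG: "s (column t d) u \<in> carrier ?G" if "d \<in> out ?z" for d u
    using wc[OF module_hom_closed[OF s(1) column_closed[OF that t]]] .
  have "\<psi> u d \<in> kHom C (Cod C u) (Cod C d)" if "u \<in> U" "d \<in> out ?z" for u d
  proof -
    have "\<psi> u d \<in> kHom C (x (rank (Cod C u))) (x (rank (Cod C d)))"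
      using sG[OF that(2), of u] unfolding \<psi>_def Gamma_carrier by blast
    then show ?thesis using rank_out(2)[OF _ t] that UN by auto
  qed
  moreover have "(\<Sum>u\<in>U. conv C (\<psi> u d) (basis_mor u) m) = basis_mor d m" if d: "d \<in> out ?z" for d m
  proof -
    have "basis_mor d m = column t d (rank (Cod C d)) m" by (simp add: column_eq[OF d t])
    also have "\<dots> = free_lift ?G ?M (column t) (s (column t d)) (rank (Cod C d)) m"
      by (simp only: s(2)[OF column_closed[OF d t]])
    also have "\<dots> = (\<Sum>u\<in>U. (s (column t d) u \<odot>\<^bsub>?M\<^esub> column t u) (rank (Cod C d)) m)"
      by (rule lift[OF module_hom_closed[OF s(1) column_closed[OF d t]]])
    also have "\<dots> = (\<Sum>u\<in>U. conv C (\<psi> u d) (basis_mor u) m)"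
      using UN by (intro sum.cong refl) (auto simp: smult_column[OF _ t] \<psi>_def)
    finally show ?thesis ..
  qed
  ultimately have coords: "coordinates U \<psi> ?z" using UN by (simp add: coordinates_def)
  have "\<psi> u (a \<cdot> d) = conv C (basis_mor a) (\<psi> u d)"
    if u: "u \<in> U" and d: "d \<in> out ?z" and a: "a \<in> Mor C" "Dom C a = Cod C d" for u d a
  proof -
    (* The matrix unit at the two ends of a, with entry a: it carries the column of d to
       that of the composite of d and a. *)
    define E :: "nat \<Rightarrow> nat \<Rightarrow> 'm \<Rightarrow> 'k" where
      "E i j = (if i = rank (Cod C a) \<and> j = rank (Cod C d) then basis_mor a else (\<lambda>_. 0))" for i j
    have ad: "a \<cdot> d \<in> out ?z" "Cod C (a \<cdot> d) = Cod C a" using out_comp[OF d a] a d by (auto simp: out_def)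
    note ra = rank_out[OF ad(1) t, unfolded ad(2)] and rd = rank_out[OF d t]
    have "rank (Cod C a) \<le> rank (Cod C d)" using rank_mono[OF a(1)] a(2) by simp
    then have E: "E \<in> carrier ?G"
      unfolding Gamma_carrier using ra rd a by (auto simp: E_def basis_mor_kHom Hom_iff)
    have "E \<odot>\<^bsub>?M\<^esub> column t d = column t (a \<cdot> d)"
    proof (intro ext)
      fix i m
      show "(E \<odot>\<^bsub>?M\<^esub> column t d) i m = column t (a \<cdot> d) i m"
        using a d ad(2) conv_basis[of a d]
        by (auto simp: smult_column[OF d t] column_eq[OF ad(1) t] E_def conv_basis out_def)
    qed
    then have "s (column t (a \<cdot> d)) u = E \<otimes>\<^bsub>?G\<^esub> s (column t d) u"
      using module_hom_smult[OF s(1) E column_closed[OF d t]] by (simp add: free_left_module_def)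
    moreover have "(E \<otimes>\<^bsub>?G\<^esub> S) (rank (Cod C a)) j m = conv C (basis_mor a) (S (rank (Cod C d)) j) m" for S j m
    proof -
      have "(E \<otimes>\<^bsub>?G\<^esub> S) (rank (Cod C a)) j m =
          (\<Sum>l\<in>{1..t}. conv C (E (rank (Cod C a)) l) (S l j) m)"
        by (simp add: Gamma_def)
      also have "\<dots> = (\<Sum>l\<in>{1..t}. if l = rank (Cod C d) then conv C (basis_mor a) (S l j) m else 0)"
        by (intro sum.cong refl) (simp add: E_def)
      finally show ?thesis using rd(1) by (simp add: sum.delta)
    qed
    ultimately show ?thesis by (intro ext) (simp add: \<psi>_def ad(2))
  qed
  then have "equivariant U \<psi> ?z" by (simp add: equivariant_def)
  with coords show ?thesis by (rule that)
qed

end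

section \<open>Free categories have projective column modules\<close>

context directed_EI_category
begin

lemma finsum_kHom_left:
  assumes "left_module (group_algebra C y) (kHom_left C z y :: ('m \<Rightarrow> 'k::field, 'm \<Rightarrow> 'k) module)"
    and "finite S" "f \<in> S \<rightarrow> carrier (kHom_left C z y :: ('m \<Rightarrow> 'k, 'm \<Rightarrow> 'k) module)"
  shows "(\<Oplus>\<^bsub>kHom_left C z y :: ('m \<Rightarrow> 'k, 'm \<Rightarrow> 'k) module\<^esub>s\<in>S. f s) = (\<lambda>m. \<Sum>s\<in>S. f s m)"
proof -
  interpret M: left_module "group_algebra C y :: ('m \<Rightarrow> 'k) ring" "kHom_left C z y"
    by (fact assms(1))
  from assms(2,3) show ?thesis
  proof (induction S rule: finite_induct)
    case empty
    show ?case by (simp only: M.finsum_empty) (simp add: kHom_left_def)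
  next
    case (insert s S)
    then have "f s \<in> carrier (kHom_left C z y)" "f \<in> S \<rightarrow> carrier (kHom_left C z y)" by auto
    with insert show ?case by (simp add: M.finsum_insert) (simp add: kHom_left_def)
  qed
qed

text \<open>The analogous coordinates over a group algebra.  The generators are all morphisms from \<open>z\<close> to \<open>y\<close>, and
  the surjection from the free module on them splits.\<close>

lemma projective_kHom_coordinates:
  assumes proj: "projective_left_module (group_algebra C y) (kHom_left C z y :: ('m \<Rightarrow> 'k::field, 'm \<Rightarrow> 'k) module)"
    and y: "y \<in> Obj C"
  shows "\<exists>D :: 'm \<Rightarrow> 'm \<Rightarrow> 'm \<Rightarrow> 'k. \<forall>b\<in>Hom C z y.
     (\<forall>u\<in>Hom C z y. D u b \<in> kHom C y y \<and>
        (\<forall>h\<in>Aut C y. D u (h \<cdot> b) = conv C (basis_mor h) (D u b))) \<and>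
     (\<forall>m. (\<Sum>u\<in>Hom C z y. conv C (D u b) (basis_mor u) m) = basis_mor b m)"
proof -
  let ?R = "group_algebra C y :: ('m \<Rightarrow> 'k) ring"
  let ?P = "kHom_left C z y :: ('m \<Rightarrow> 'k, 'm \<Rightarrow> 'k) module"
  let ?U = "Hom C z y"
  let ?F = "free_left_module ?R ?U"
  have P: "left_module ?R ?P" using proj by (simp add: projective_left_module_def)
  interpret P: left_module ?R ?P by (fact P)
  have finU: "finite ?U" by (rule finite_subset[OF _ finite_Mor]) (auto simp: Hom_iff)
  have UP: "basis_mor \<in> ?U \<rightarrow> carrier ?P" by (auto simp: kHom_left_def basis_mor_kHom)
  have wc: "w u \<in> kHom C y y" if "w \<in> carrier ?F" for w u
    using that by (auto simp: free_left_module_def group_algebra_def)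
  have lift: "free_lift ?R ?P basis_mor w m = (\<Sum>u\<in>?U. conv C (w u) (basis_mor u) m)"
    if w: "w \<in> carrier ?F" for w m
  proof -
    have "{u. w u \<noteq> \<zero>\<^bsub>?R\<^esub>} \<subseteq> ?U" using w by (auto simp: free_left_module_def)
    moreover have "(\<lambda>u. w u \<odot>\<^bsub>?P\<^esub> basis_mor u) \<in> ?U \<rightarrow> carrier ?P"
      using wc[OF w] UP by (auto intro!: P.smult_closed simp: group_algebra_def)
    ultimately have "free_lift ?R ?P basis_mor w m = (\<Sum>u\<in>?U. (w u \<odot>\<^bsub>?P\<^esub> basis_mor u) m)"
      by (subst P.free_lift_eq_finsum[OF w finU _ _ UP], simp, simp, subst finsum_kHom_left[OF P finU]) auto
    then show ?thesis by (simp add: kHom_left_def)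
  qed
  have surj: "\<exists>w\<in>carrier ?F. free_lift ?R ?P basis_mor w = v" if v: "v \<in> carrier ?P" for v
  proof -
    have vk: "v \<in> kHom C z y" using v by (simp add: kHom_left_def)
    define w where "w u = (\<lambda>m. v u * basis_mor (Id C y) m)" for u
    have v0: "v u = 0" if "u \<notin> ?U" for u using vk that by (simp add: kHom_def)
    have "{u. w u \<noteq> \<zero>\<^bsub>?R\<^esub>} \<subseteq> ?U" using v0 by (auto simp: w_def group_algebra_def)
    then have "finite {u. w u \<noteq> \<zero>\<^bsub>?R\<^esub>}" using finU by (rule finite_subset)
    moreover have "w u \<in> kHom C y y" for u
      unfolding w_def using y by (intro kHom_scale) (auto simp: basis_mor_kHom Hom_iff)
    ultimately have w: "w \<in> carrier ?F"
      using v0 by (auto simp: free_left_module_def group_algebra_def w_def)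
    have "free_lift ?R ?P basis_mor w m = v m" for m
    proof -
      have "free_lift ?R ?P basis_mor w m = (\<Sum>u\<in>?U. v u * basis_mor u m)"
        unfolding lift[OF w] w_def conv_scale_left
        using y by (intro sum.cong refl) (auto simp: conv_basis Hom_iff)
      also have "\<dots> = (\<Sum>u\<in>Mor C. v u * basis_mor u m)"
        by (rule sum.mono_neutral_left) (auto simp: v0 Hom_iff)
      also have "\<dots> = v m" using kHom_expand[OF vk] by metis
      finally show ?thesis .
    qed
    then show ?thesis using w by blast
  qed
  obtain s where s: "s \<in> module_hom ?R ?P ?F"
    "\<And>v. v \<in> carrier ?P \<Longrightarrow> free_lift ?R ?P basis_mor (s v) = v"
  proof (rule projective_surjection_splits[OF proj P.R.free_left_module_is_left_module
        P.free_lift_hom[OF UP] surj])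
    fix s
    assume "s \<in> module_hom ?R ?P ?F" "\<And>v. v \<in> carrier ?P \<Longrightarrow> free_lift ?R ?P basis_mor (s v) = v"
    then show thesis by (rule that)
  qed
  have bP: "basis_mor b \<in> carrier ?P" if "b \<in> ?U" for b using UP that by auto
  show ?thesis
  proof (intro exI[of _ "\<lambda>u b. s (basis_mor b) u"] ballI conjI allI)
    fix b assume b: "b \<in> ?U"
    note sb = module_hom_closed[OF s(1) bP[OF b]]
    show "s (basis_mor b) u \<in> kHom C y y" for u by (rule wc[OF sb])
    show "s (basis_mor (h \<cdot> b)) u = conv C (basis_mor h) (s (basis_mor b) u)" if h: "h \<in> Aut C y" for h u
    proof -
      have "basis_mor (h \<cdot> b) = basis_mor h \<odot>\<^bsub>?P\<^esub> basis_mor b"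
        using h b by (auto simp: kHom_left_def Aut_def Hom_iff conv_basis)
      moreover have "basis_mor h \<in> carrier ?R" using h by (simp add: group_algebra_def Aut_def basis_mor_kHom)
      ultimately have "s (basis_mor (h \<cdot> b)) = basis_mor h \<odot>\<^bsub>?F\<^esub> s (basis_mor b)"
        using module_hom_smult[OF s(1) _ bP[OF b]] by simp
      then show ?thesis by (simp add: free_left_module_def group_algebra_def)
    qed
    show "(\<Sum>u\<in>?U. conv C (s (basis_mor b) u) (basis_mor u) m) = basis_mor b m" for m
      unfolding lift[OF sb, symmetric] s(2)[OF bP[OF b]] ..
  qed
qed

definition unf_out :: "'o \<Rightarrow> 'm set" where
  "unf_out z = {u. unfactorizable C u \<and> Dom C u = z}"

lemma unf_out_subset: "unf_out z \<subseteq> out z"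
  by (auto simp: unf_out_def out_def unfactorizable_iff)

lemma choose_factorizations:
  obtains g b where "\<And>d. d \<in> out z \<Longrightarrow> b d \<in> unf_out z"
    "\<And>d. d \<in> out z \<Longrightarrow> g d \<in> Hom C (Cod C (b d)) (Cod C d)" "\<And>d. d \<in> out z \<Longrightarrow> g d \<cdot> b d = d"
proof -
  have "\<exists>g b. b \<in> unf_out z \<and> g \<in> Hom C (Cod C b) (Cod C d) \<and> g \<cdot> b = d" if d: "d \<in> out z" for d
  proof -
    obtain g b where gb: "g \<in> Mor C" "unfactorizable C b" "Cod C b = Dom C g" "d = g \<cdot> b"
      using exists_unfactorizable_factor[of d] d by (auto simp: out_def)
    moreover have "b \<in> Mor C" using gb(2) by (simp add: unfactorizable_iff)
    ultimately show ?thesis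
      using d by (intro exI[of _ g] exI[of _ b]) (auto simp: unf_out_def out_def Hom_iff)
  qed
  then show ?thesis using that by metis
qed

text \<open>The coordinates of \<open>d = g \<cdot> b\<close> are those of \<open>b\<close> over the group algebra of the object in the middle,
  composed with \<open>g\<close>.  Another factorization of the same morphism replaces \<open>(g, b)\<close> by \<open>(g', h \<cdot> b)\<close>
  with \<open>g = g' \<cdot> h\<close>, and the equivariance of \<open>D\<close> under \<open>h\<close> makes up for the difference.\<close>

lemma two_step_unique_coordinates:
  assumes unique: "\<And>y. two_step_unique z y"
    and proj: "\<And>y. \<exists>d\<in>out z. Cod C d = y \<Longrightarrow>
      projective_left_module (group_algebra C y) (kHom_left C z y :: ('m \<Rightarrow> 'k::field, 'm \<Rightarrow> 'k) module)"
  obtains \<psi> :: "'m \<Rightarrow> 'm \<Rightarrow> 'm \<Rightarrow> 'k::field" where "coordinates (out z) \<psi> z" "equivariant (out z) \<psi> z"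
proof -
  obtain g b where b: "\<And>d. d \<in> out z \<Longrightarrow> b d \<in> unf_out z"
    and g: "\<And>d. d \<in> out z \<Longrightarrow> g d \<in> Hom C (Cod C (b d)) (Cod C d)"
    and gb: "\<And>d. d \<in> out z \<Longrightarrow> g d \<cdot> b d = d"
    by (rule choose_factorizations[of z]) blast
  have bM: "b d \<in> Mor C" "Dom C (b d) = z" "Cod C (b d) \<noteq> z" "b d \<in> out z" if "d \<in> out z" for d
    using b[OF that] unf_out_subset[of z] by (auto simp: out_def)
  have gM: "g d \<in> Mor C" "Dom C (g d) = Cod C (b d)" "Cod C (g d) = Cod C d" if "d \<in> out z" for d
    using g[OF that] by (simp_all add: Hom_iff)
  define good :: "'o \<Rightarrow> ('m \<Rightarrow> 'm \<Rightarrow> 'm \<Rightarrow> 'k) \<Rightarrow> bool" where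
    "good y D \<longleftrightarrow> (\<forall>b\<in>Hom C z y.
       (\<forall>u\<in>Hom C z y. D u b \<in> kHom C y y \<and>
          (\<forall>h\<in>Aut C y. D u (h \<cdot> b) = conv C (basis_mor h) (D u b))) \<and>
       (\<forall>m. (\<Sum>u\<in>Hom C z y. conv C (D u b) (basis_mor u) m) = basis_mor b m))" for y D
  have "\<exists>D. good y D" if y: "\<exists>d\<in>out z. Cod C d = y" for y
  proof -
    have "y \<in> Obj C" using y Cod_closed by (auto simp: out_def)
    then show ?thesis unfolding good_def by (rule projective_kHom_coordinates[OF proj[OF y]])
  qed
  then have "\<forall>y. \<exists>D. (\<exists>d\<in>out z. Cod C d = y) \<longrightarrow> good y D" by blast
  from choice[OF this] obtain D where "\<forall>y. (\<exists>d\<in>out z. Cod C d = y) \<longrightarrow> good y (D y)" by (rule exE)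
  then have D0: "good (Cod C d) (D (Cod C d))" if "d \<in> out z" for d using that by blast
  have HomU: "u \<in> Hom C z (Cod C u)" if "u \<in> out z" for u using that by (simp add: out_def Hom_iff)
  have D: "D (Cod C d) u d \<in> kHom C (Cod C d) (Cod C d)"
      "h \<in> Aut C (Cod C d) \<Longrightarrow> D (Cod C d) u (h \<cdot> d) = conv C (basis_mor h) (D (Cod C d) u d)"
    if "d \<in> out z" "u \<in> Hom C z (Cod C d)" for d u h
    using D0[OF that(1)] HomU[OF that(1)] that(2) unfolding good_def by blast+
  have Dsum: "(\<Sum>u\<in>Hom C z (Cod C d). conv C (D (Cod C d) u d) (basis_mor u) m) = basis_mor d m"
    if "d \<in> out z" for d m
    using D0[OF that] HomU[OF that] unfolding good_def by blast
  define \<psi> where "\<psi> u d = (if Cod C u = Cod C (b d) then conv C (basis_mor (g d)) (D (Cod C u) u (b d)) else (\<lambda>_. 0))"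
    for u d
  have "\<psi> u d \<in> kHom C (Cod C u) (Cod C d)" if "u \<in> out z" "d \<in> out z" for u d
  proof (cases "Cod C u = Cod C (b d)")
    case True
    have "D (Cod C u) u (b d) \<in> kHom C (Cod C u) (Cod C u)"
      using D(1)[OF bM(4)[OF that(2)], of u] HomU[OF that(1)] True by simp
    moreover have "basis_mor (g d) \<in> kHom C (Cod C u) (Cod C d)"
      using True g[OF that(2)] by (simp add: basis_mor_kHom)
    ultimately have "conv C (basis_mor (g d)) (D (Cod C u) u (b d)) \<in> kHom C (Cod C u) (Cod C d)"
      by (rule conv_kHom[rotated])
    then show ?thesis using True by (simp add: \<psi>_def)
  qed (simp add: \<psi>_def)
  moreover have "(\<Sum>u\<in>out z. conv C (\<psi> u d) (basis_mor u) m) = basis_mor d m" if d: "d \<in> out z" for d m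
  proof -
    let ?y = "Cod C (b d)"
    have "(\<Sum>u\<in>out z. conv C (\<psi> u d) (basis_mor u) m) = (\<Sum>u\<in>Hom C z ?y. conv C (\<psi> u d) (basis_mor u) m)"
    proof (rule sum.mono_neutral_right[OF finite_out])
      show "Hom C z ?y \<subseteq> out z" using bM(3)[OF d] by (auto simp: out_def Hom_iff)
      show "\<forall>u\<in>out z - Hom C z ?y. conv C (\<psi> u d) (basis_mor u) m = 0"
      proof
        fix u assume "u \<in> out z - Hom C z ?y"
        then have "\<psi> u d = (\<lambda>_. 0)" by (auto simp: \<psi>_def out_def Hom_iff)
        then show "conv C (\<psi> u d) (basis_mor u) m = 0" by simp
      qed
    qed
    also have "\<dots> = conv C (basis_mor (g d)) (\<lambda>m. \<Sum>u\<in>Hom C z ?y. conv C (D ?y u (b d)) (basis_mor u) m) m"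
      unfolding conv_sum_right by (intro sum.cong refl) (simp add: \<psi>_def conv_assoc Hom_iff)
    also have "(\<lambda>m. \<Sum>u\<in>Hom C z ?y. conv C (D ?y u (b d)) (basis_mor u) m) = basis_mor (b d)"
      using Dsum[OF bM(4)[OF d]] by (intro ext)
    also have "conv C (basis_mor (g d)) (basis_mor (b d)) m = basis_mor d m"
      by (simp add: conv_basis gM[OF d] bM[OF d] gb[OF d])
    finally show ?thesis .
  qed
  ultimately have coords: "coordinates (out z) \<psi> z" by (simp add: coordinates_def)
  have "\<psi> u (a \<cdot> d) = conv C (basis_mor a) (\<psi> u d)"
    if u: "u \<in> out z" and d: "d \<in> out z" and a: "a \<in> Mor C" "Dom C a = Cod C d" for u d a
  proof -
    have ad: "a \<cdot> d \<in> out z" by (rule out_comp[OF d a])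
    have agM: "a \<cdot> g d \<in> Hom C (Cod C (b d)) (Cod C a)" using a gM[OF d] by (simp add: Hom_iff)
    have "(a \<cdot> g d) \<cdot> b d = a \<cdot> d"
      using a gM[OF d] bM[OF d] by (simp add: comp_assoc gb[OF d])
    also have "\<dots> = g (a \<cdot> d) \<cdot> b (a \<cdot> d)" by (rule gb[OF ad, symmetric])
    finally have "equiv_factorizations (a \<cdot> g d) (b d) (g (a \<cdot> d)) (b (a \<cdot> d))"
      using unique[of "Cod C a"] agM b[OF d] b[OF ad] gM[OF ad] a d
      unfolding two_step_unique_def unf_out_def by (auto simp: Hom_iff out_def)
    then obtain h where h: "Cod C (b d) = Cod C (b (a \<cdot> d))" "h \<in> Aut C (Cod C (b d))"
      "b (a \<cdot> d) = h \<cdot> b d" "a \<cdot> g d = g (a \<cdot> d) \<cdot> h"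
      unfolding equiv_factorizations_def by blast
    have hM: "h \<in> Mor C" "Dom C h = Cod C (b d)" "Cod C h = Cod C (b d)" using h by (auto simp: Aut_def Hom_iff)
    show ?thesis
    proof (cases "Cod C u = Cod C (b d)")
      case True
      have "D (Cod C u) u (h \<cdot> b d) = conv C (basis_mor h) (D (Cod C u) u (b d))"
        using D(2)[OF bM(4)[OF d], of u h] HomU[OF u] h(2) True by simp
      then have "\<psi> u (a \<cdot> d) = conv C (conv C (basis_mor (g (a \<cdot> d))) (basis_mor h)) (D (Cod C u) u (b d))"
        using True h by (simp add: \<psi>_def conv_assoc)
      also have "conv C (basis_mor (g (a \<cdot> d))) (basis_mor h) = conv C (basis_mor a) (basis_mor (g d))"
        using h hM gM[OF ad] gM[OF d] a by (simp add: conv_basis)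
      finally show ?thesis using True by (simp add: \<psi>_def conv_assoc)
    next
      case False
      then show ?thesis using h(1) by (simp add: \<psi>_def)
    qed
  qed
  then have "equivariant (out z) \<psi> z" by (simp add: equivariant_def)
  with coords show ?thesis by (rule that)
qed

section \<open>Projective column modules force unique factorization\<close>

text \<open>An arbitrary choice of factorizations \<open>d = g \<cdot> b\<close> gives coordinates with the single nonzero
  coefficient \<open>g\<close> at \<open>b\<close>; in general they are not equivariant.\<close>

lemma exists_unfactorizable_coordinates: "\<exists>\<psi> :: 'm \<Rightarrow> 'm \<Rightarrow> 'm \<Rightarrow> 'k::field. coordinates (unf_out z) \<psi> z"
proof -
  obtain g b where b: "\<And>d. d \<in> out z \<Longrightarrow> b d \<in> unf_out z"
    and g: "\<And>d. d \<in> out z \<Longrightarrow> g d \<in> Hom C (Cod C (b d)) (Cod C d)"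
    and gb: "\<And>d. d \<in> out z \<Longrightarrow> g d \<cdot> b d = d"
    by (rule choose_factorizations[of z]) blast
  have bM: "b d \<in> Mor C" "Dom C (b d) = z" "Cod C (b d) \<noteq> z" "b d \<in> out z" if "d \<in> out z" for d
    using b[OF that] unf_out_subset[of z] by (auto simp: out_def)
  have gM: "g d \<in> Mor C" "Dom C (g d) = Cod C (b d)" "Cod C (g d) = Cod C d" if "d \<in> out z" for d
    using g[OF that] by (simp_all add: Hom_iff)
  define \<psi> :: "'m \<Rightarrow> 'm \<Rightarrow> 'm \<Rightarrow> 'k" where
    "\<psi> u d = (if u = b d then basis_mor (g d) else (\<lambda>_. 0))" for u d
  have "(\<Sum>u\<in>unf_out z. conv C (\<psi> u d) (basis_mor u) m) = basis_mor d m" if d: "d \<in> out z" for d m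
  proof -
    have "finite (unf_out z)" using unf_out_subset finite_out by (rule finite_subset)
    have "(\<Sum>u\<in>unf_out z. conv C (\<psi> u d) (basis_mor u) m) =
        (\<Sum>u\<in>unf_out z. if u = b d then conv C (basis_mor (g d)) (basis_mor (b d)) m else (0 :: 'k))"
      by (intro sum.cong refl) (auto simp: \<psi>_def)
    also have "\<dots> = conv C (basis_mor (g d)) (basis_mor (b d)) m"
      using \<open>finite (unf_out z)\<close> b[OF d] by (simp add: sum.delta)
    also have "\<dots> = basis_mor d m"
      by (simp add: conv_basis gM[OF d] bM[OF d] gb[OF d])
    finally show ?thesis .
  qed
  moreover have "\<psi> u d \<in> kHom C (Cod C u) (Cod C d)" if "d \<in> out z" for u d
    using g[OF that] by (simp add: \<psi>_def basis_mor_kHom)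
  ultimately have "coordinates (unf_out z) \<psi> z" using unf_out_subset by (simp add: coordinates_def)
  then show ?thesis by blast
qed

text \<open>By equivariance, the sum is that of \<open>\<psi> u b1 c * \<Phi> (a \<cdot> c) u\<close>.  Its second factor depends on the
  composite \<open>c \<cdot> u\<close> alone, by the last hypothesis.  So the sum is the value of a linear functional at
  \<open>\<Sum>u. \<psi> u b1 \<cdot> u = b1\<close>, where \<open>b1 = Id \<cdot> b1\<close> contributes \<open>\<Phi> a b1\<close>.\<close>

lemma equivariant_coordinates_evaluate:
  fixes \<psi> :: "'m \<Rightarrow> 'm \<Rightarrow> 'm \<Rightarrow> 'k::field"
  assumes coords: "coordinates (unf_out z) \<psi> z" and equi: "equivariant (unf_out z) \<psi> z"
    and b1: "b1 \<in> unf_out z" and a: "a \<in> Mor C" "Dom C a = Cod C b1"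
    and inv: "\<And>c u c' u'. \<lbrakk>u \<in> unf_out z; u' \<in> unf_out z; c \<in> Hom C (Cod C u) (Cod C b1);
       c' \<in> Hom C (Cod C u') (Cod C b1); c \<cdot> u = c' \<cdot> u'\<rbrakk> \<Longrightarrow> \<Phi> (a \<cdot> c) u = \<Phi> (a \<cdot> c') u'"
  shows "(\<Sum>u\<in>unf_out z. \<Sum>c\<in>Mor C. \<psi> u (a \<cdot> b1) c * \<Phi> c u) = (\<Phi> a b1 :: 'k)"
proof -
  let ?U = "unf_out z" and ?l = "Cod C b1"
  have b1M: "b1 \<in> Mor C" "b1 \<in> out z" using b1 unf_out_subset by (auto simp: out_def)
  have uM: "u \<in> Mor C" if "u \<in> ?U" for u using that by (simp add: unf_out_def unfactorizable_iff)
  have supp: "\<psi> u b1 c = 0" if "u \<in> ?U" "c \<notin> Hom C (Cod C u) ?l" for u c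
  proof -
    have "\<psi> u b1 \<in> kHom C (Cod C u) ?l" using coords that b1M by (simp add: coordinates_def)
    then show ?thesis using that by (simp add: kHom_def)
  qed
  (* The functional on morphisms from z to the target of b1 through which the test
     function factors. *)
  define \<Psi> where "\<Psi> m = (SOME r. \<exists>u\<in>?U. \<exists>c\<in>Hom C (Cod C u) ?l. m = c \<cdot> u \<and> r = \<Phi> (a \<cdot> c) u)" for m
  have \<Psi>: "\<Psi> (c \<cdot> u) = \<Phi> (a \<cdot> c) u" if u: "u \<in> ?U" and c: "c \<in> Hom C (Cod C u) ?l" for c u
  proof -
    have "\<exists>u'\<in>?U. \<exists>c'\<in>Hom C (Cod C u') ?l. c \<cdot> u = c' \<cdot> u' \<and> \<Psi> (c \<cdot> u) = \<Phi> (a \<cdot> c') u'"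
      unfolding \<Psi>_def by (rule someI_ex) (use u c in blast)
    then obtain u' c' where "u' \<in> ?U" "c' \<in> Hom C (Cod C u') ?l" "c \<cdot> u = c' \<cdot> u'" "\<Psi> (c \<cdot> u) = \<Phi> (a \<cdot> c') u'"
      by blast
    then show ?thesis using inv[OF u _ c, of u' c'] by simp
  qed
  have delta: "(\<Sum>c\<in>Mor C. basis_mor e c * f c) = (f e :: 'k)" if "e \<in> Mor C" for e f
  proof -
    have "(\<Sum>c\<in>Mor C. basis_mor e c * f c) = (\<Sum>c\<in>Mor C. if c = e then f c else 0)"
      by (intro sum.cong refl) (simp add: basis_mor_def)
    then show ?thesis using that by (simp add: sum.delta)
  qed
  have "(\<Sum>u\<in>?U. \<Sum>c\<in>Mor C. \<psi> u (a \<cdot> b1) c * \<Phi> c u) =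
      (\<Sum>u\<in>?U. \<Sum>c\<in>Mor C. conv C (basis_mor a) (\<psi> u b1) c * \<Phi> c u)"
    using equi a b1M by (intro sum.cong refl) (simp add: equivariant_def)
  also have "\<dots> = (\<Sum>u\<in>?U. \<Sum>e\<in>Mor C. basis_mor a e *
      (\<Sum>c\<in>Mor C. if Cod C c = Dom C e then \<psi> u b1 c * \<Phi> (e \<cdot> c) u else 0))"
    unfolding sum_conv sum_distrib_left by (intro sum.cong refl) auto
  also have "\<dots> = (\<Sum>u\<in>?U. \<Sum>c\<in>Mor C. if Cod C c = ?l then \<psi> u b1 c * \<Phi> (a \<cdot> c) u else 0)"
    by (simp add: delta[OF a(1)] a(2))
  also have "\<dots> = (\<Sum>u\<in>?U. \<Sum>c\<in>Mor C. if Cod C u = Dom C c then \<psi> u b1 c * \<Psi> (c \<cdot> u) else 0)"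
  proof (intro sum.cong refl)
    fix u c assume u: "u \<in> ?U" and "c \<in> Mor C"
    then show "(if Cod C c = ?l then \<psi> u b1 c * \<Phi> (a \<cdot> c) u else 0) =
        (if Cod C u = Dom C c then \<psi> u b1 c * \<Psi> (c \<cdot> u) else 0)"
      using supp[OF u, of c] \<Psi>[OF u, of c] by (cases "c \<in> Hom C (Cod C u) ?l") (auto simp: Hom_iff)
  qed
  also have "\<dots> = (\<Sum>u\<in>?U. \<Sum>c\<in>Mor C. \<Sum>e\<in>Mor C. basis_mor u e *
      (if Cod C e = Dom C c then \<psi> u b1 c * \<Psi> (c \<cdot> e) else 0))"
    by (intro sum.cong refl) (simp add: delta[OF uM])
  also have "\<dots> = (\<Sum>u\<in>?U. \<Sum>m\<in>Mor C. conv C (\<psi> u b1) (basis_mor u) m * \<Psi> m)"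
    unfolding sum_conv by (intro sum.cong refl) auto
  also have "\<dots> = (\<Sum>m\<in>Mor C. (\<Sum>u\<in>?U. conv C (\<psi> u b1) (basis_mor u) m) * \<Psi> m)"
    by (subst sum.swap) (simp add: sum_distrib_right)
  also have "\<dots> = (\<Sum>m\<in>Mor C. basis_mor b1 m * \<Psi> m)"
    using coords b1M by (simp add: coordinates_def)
  also have "\<dots> = \<Psi> b1" by (rule delta[OF b1M(1)])
  also have "\<dots> = \<Phi> a b1"
    using \<Psi>[OF b1, of "Id C ?l"] b1M a Cod_closed[of b1] by (simp add: Hom_iff)
  finally show ?thesis .
qed

text \<open>The test function \<open>\<Phi>\<close> is the indicator of the class of \<open>(g, b)\<close>.  Evaluated on the coordinates of the
  morphism \<open>g \<cdot> b = g' \<cdot> b'\<close>, it gives both \<open>\<Phi> g b = 1\<close> and \<open>\<Phi> g' b'\<close>.  The invariance that the evaluation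
  needs is two-step uniqueness at the sources of \<open>g\<close> and \<open>g'\<close>, which have larger index than \<open>y\<close>.\<close>

lemma coordinates_two_step_unique:
  fixes \<psi> :: "'m \<Rightarrow> 'm \<Rightarrow> 'm \<Rightarrow> 'k::field"
  assumes coords: "coordinates (unf_out z) \<psi> z" and equi: "equivariant (unf_out z) \<psi> z"
  shows "two_step_unique z y"
proof (induction "rank z - rank y" arbitrary: y rule: less_induct)
  case less
  have IH: "two_step_unique z l" if "rank y < rank l" "rank l < rank z" for l
    using that by (intro less.hyps) auto
  have "equiv_factorizations g b g' b'"
    if g: "g \<in> Hom C (Cod C b) y" and b: "b \<in> unf_out z"
      and g': "g' \<in> Hom C (Cod C b') y" and b': "b' \<in> unf_out z"
      and eq: "g \<cdot> b = g' \<cdot> b'" for g b g' b'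
  proof (cases "Cod C b = y \<or> Cod C b' = y")
    case True
    then show ?thesis using equiv_factorizations_of_Aut[OF g _ g' _ eq] b b' by (simp add: unf_out_def)
  next
    case False
    define \<Phi> :: "'m \<Rightarrow> 'm \<Rightarrow> 'k" where "\<Phi> c u = (if equiv_factorizations g b c u then 1 else 0)" for c u
    have bM: "b \<in> Mor C" using b by (simp add: unf_out_def unfactorizable_iff)
    have eval: "(\<Sum>u\<in>unf_out z. \<Sum>c\<in>Mor C. \<psi> u (a \<cdot> b1) c * \<Phi> c u) = \<Phi> a b1"
      if b1: "b1 \<in> unf_out z" and a: "a \<in> Hom C (Cod C b1) y" and ne: "Cod C b1 \<noteq> y" for a b1
    proof (rule equivariant_coordinates_evaluate[OF coords equi b1])
      show aM: "a \<in> Mor C" "Dom C a = Cod C b1" using a by (auto simp: Hom_iff)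
      fix c u c' u'
      assume u: "u \<in> unf_out z" "u' \<in> unf_out z" and c: "c \<in> Hom C (Cod C u) (Cod C b1)"
        "c' \<in> Hom C (Cod C u') (Cod C b1)" and cu: "c \<cdot> u = c' \<cdot> u'"
      have "rank y < rank (Cod C b1)" using rank_less[of a] a ne by (auto simp: Hom_iff)
      moreover have "rank (Cod C b1) < rank z"
        using rank_less[of b1] b1 by (auto simp: unf_out_def unfactorizable_iff)
      ultimately have "two_step_unique z (Cod C b1)" by (rule IH)
      then have e: "equiv_factorizations c u c' u'"
        using u c cu unfolding two_step_unique_def unf_out_def by blast
      have M: "c \<in> Mor C" "Dom C c = Cod C u" "Cod C c = Cod C b1"
        "c' \<in> Mor C" "Dom C c' = Cod C u'" "Cod C c' = Cod C b1" "u \<in> Mor C" "u' \<in> Mor C"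
        using c u by (auto simp: Hom_iff unf_out_def unfactorizable_iff)
      have e1: "equiv_factorizations (a \<cdot> c) u (a \<cdot> c') u'"
        using equiv_factorizations_comp[OF e, of a] M aM by simp
      have e2: "equiv_factorizations (a \<cdot> c') u' (a \<cdot> c) u"
        using equiv_factorizations_sym[OF e1] M aM by simp
      have "equiv_factorizations g b (a \<cdot> c) u \<longleftrightarrow> equiv_factorizations g b (a \<cdot> c') u'"
        using equiv_factorizations_trans[OF _ e1 bM] equiv_factorizations_trans[OF _ e2 bM] M aM by auto
      then show "\<Phi> (a \<cdot> c) u = \<Phi> (a \<cdot> c') u'" by (simp add: \<Phi>_def)
    qed
    have "\<Phi> g b = \<Phi> g' b'"
      using eval[OF b g] eval[OF b' g'] False eq by simp
    moreover have "\<Phi> g b = 1"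
      using equiv_factorizations_refl[OF bM, of g] g by (simp add: \<Phi>_def Hom_iff)
    ultimately show ?thesis by (simp add: \<Phi>_def split: if_splits)
  qed
  then show ?case unfolding two_step_unique_def unf_out_def by blast
qed

end

section \<open>The characterization of freeness\<close>

theorem proposition4p5:
  fixes C :: "('o, 'm) category"
    and x :: "nat \<Rightarrow> 'o"
    and n :: nat
  assumes "finite_EI_category C"
    and "skeletal C"
    and "n \<ge> 2"
    and "bij_betw x {1..n} (Obj C)"
    and "\<And>i j. i \<in> {1..n} \<Longrightarrow> j \<in> {1..n} \<Longrightarrow> i < j \<Longrightarrow> Hom C (x i) (x j) = {}"
    and "projective_over TYPE('k::field) C x n"
  shows "free_category C \<longleftrightarrow>
    (\<forall>t\<in>{1..n - 1}. projective_left_module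
       (Gamma C x t :: (nat \<Rightarrow> nat \<Rightarrow> 'm \<Rightarrow> 'k) ring)
       (Mstar C x t))"
proof -
  interpret directed_EI_category C x n
    using assms unfolding directed_EI_category_def directed_EI_category_axioms_def finite_EI_category_def
    by blast
  show ?thesis
  proof
    assume "free_category C"
    then have unique: "two_step_unique z y" for z y by (simp add: free_category_iff_two_step_unique)
    show "\<forall>t\<in>{1..n - 1}. projective_left_module
       (Gamma C x t :: (nat \<Rightarrow> nat \<Rightarrow> 'm \<Rightarrow> 'k) ring) (Mstar C x t)"
    proof
      fix t assume "t \<in> {1..n - 1}"
      then have t: "t < n" using assms(3) by auto
      have "projective_left_module (group_algebra C y) (kHom_left C (x (t + 1)) y :: ('m \<Rightarrow> 'k, 'm \<Rightarrow> 'k) module)"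
        if "\<exists>d\<in>out (x (t + 1)). Cod C d = y" for y
      proof -
        obtain d where d: "d \<in> out (x (t + 1))" "Cod C d = y" using \<open>\<exists>d\<in>out (x (t + 1)). Cod C d = y\<close> by blast
        have y: "rank y \<in> {1..t}" "x (rank y) = y" using rank_out(1,2)[OF d(1) t] d(2) by simp_all
        then have "1 \<le> rank y" "rank y < t + 1" "t + 1 \<le> n" using t by auto
        then have "projective_left_module (group_algebra C (x (rank y)))
            (kHom_left C (x (t + 1)) (x (rank y)) :: ('m \<Rightarrow> 'k, 'm \<Rightarrow> 'k) module)"
          using assms(6) unfolding projective_over_def by blast
        then show ?thesis unfolding y(2) .
      qed
      from two_step_unique_coordinates[OF unique this] obtain \<psi> :: "'m \<Rightarrow> 'm \<Rightarrow> 'm \<Rightarrow> 'k" where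
        "coordinates (out (x (t + 1))) \<psi> (x (t + 1))" "equivariant (out (x (t + 1))) \<psi> (x (t + 1))" by blast
      then show "projective_left_module (Gamma C x t :: (nat \<Rightarrow> nat \<Rightarrow> 'm \<Rightarrow> 'k) ring) (Mstar C x t)"
        using t by (rule equivariant_coordinates_projective)
    qed
  next
    assume proj: "\<forall>t\<in>{1..n - 1}. projective_left_module
       (Gamma C x t :: (nat \<Rightarrow> nat \<Rightarrow> 'm \<Rightarrow> 'k) ring) (Mstar C x t)"
    have "two_step_unique z y" for z y
    proof (cases "unf_out z = {}")
      case True
      then show ?thesis by (auto simp: two_step_unique_def unf_out_def)
    next
      case False
      then obtain u where u: "u \<in> Mor C" "Dom C u = z" "Cod C u \<noteq> z"
        by (auto simp: unf_out_def unfactorizable_iff)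
      define t where "t = rank z - 1"
      have "z \<in> Obj C" "Cod C u \<in> Obj C" using u Dom_closed Cod_closed by auto
      then have "x (rank z) = z" "rank z \<in> {1..n}" "1 \<le> rank (Cod C u)" using x_rank by auto
      moreover have "rank (Cod C u) < rank z" using rank_less[of u] u by auto
      ultimately have t: "t < n" "t \<in> {1..n - 1}" and z: "z = x (t + 1)" by (auto simp: t_def)
      obtain \<psi>\<^sub>0 :: "'m \<Rightarrow> 'm \<Rightarrow> 'm \<Rightarrow> 'k" where "coordinates (unf_out z) \<psi>\<^sub>0 z"
        using exists_unfactorizable_coordinates by blast
      then obtain \<psi> :: "'m \<Rightarrow> 'm \<Rightarrow> 'm \<Rightarrow> 'k" where "coordinates (unf_out z) \<psi> z" "equivariant (unf_out z) \<psi> z"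
        using projective_equivariant_coordinates[OF bspec[OF proj t(2)] _ t(1)] unfolding z by blast
      then show ?thesis by (rule coordinates_two_step_unique)
    qed
    then show "free_category C" by (simp add: free_category_iff_two_step_unique)
  qed
qed

end
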